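(* (Structure theorem) Let $U$ be an unoccupied piece. Then: (a) all arrows in the top path between the start square and the pre-top square are of left type or of up type; (b) the arrow from the pre-top square to the top square is of right type or of up type; (c) the arrow from the top square to the end square is of right type or of down type; (d) each arrow in the bottom path between the start square and the penultimate square is of right type or of down type; (e) the arrow from the penultimate square to the end square is of right type or of up type.
   Context: Consider an instance of the Square Strip Packing Problem with strip width $W$ and an ordering $S_1,\dots,S_n$ with its bottom-left packing (each square in turn is placed, without overlapping interiors and inside $[0,W]\times[0,\infty)$, at the feasible position $(x,y)$ with $(y,x)$ lexicographically minimal). Squares are closed sets. $i$-pieces: inductively for $i=1,\dots,n$, the $i$-pieces are the bounded connected components of $([0,W]\times[0,\infty))\setminus\big(\bigcup_{j\le i}S_j\cup\bigcup\{\text{$k$-pieces},\,k<i\}\big)$. An unoccupied piece is an $i$-piece for some $i$, considered in the packing of the first $i$ squares. Formal squares: $S_{\text{left}}=\{0\}\times\mathbb{R}_{\ge0}$, $S_{\text{right}}=\{W\}\times\mathbb{R}_{\ge0}$, $S_{\text{bottom}}=[0,W]\times\{0\}$. A (formal) square $S$ is adjacent to $U$ if $\overline U\cap S\ne\varnothing$; two (formal) squares are adjacent if they intersect. For a set $X$: $\mathrm{tf}(X)=\max\{y:(x,y)\in X\}$, $\mathrm{bf}(X)=\min y$, $\mathrm{lf}(X)=\min x$, $\mathrm{rf}(X)=\max x$. Arrows: an arrow is an ordered pair $(S_1,S_2)$ of adjacent (formal) squares. It is of left type if $\mathrm{lf}(S_1)=\mathrm{rf}(S_2)$, right type if $\mathrm{rf}(S_1)=\mathrm{lf}(S_2)$,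 up type if $\mathrm{tf}(S_1)=\mathrm{bf}(S_2)$, down type if $\mathrm{bf}(S_1)=\mathrm{tf}(S_2)$ (an arrow may have two types). The (formal) squares adjacent to $U$, taken in the order in which they are met when traversing the boundary of $U$ clockwise (so $U$ lies to the right), form a directed circuit $C$ visiting each of them exactly once. Start square: an adjacent square with lowest top face, leftmost among ties. Top square: an adjacent square with highest bottom face, rightmost among ties. End square: successor of the top square on $C$. Pre-top square: predecessor of the top square on $C$. Penultimate square: successor of the end square on $C$. Top path: the directed path along $C$ from the start square to the end square passing through the top square. Bottom path: the other path between start and end square on $C$, directed from the start square to the end square (it does not pass through the top square, and its last arrow goes from the penultimate square to the end square). *)

theory Defs
  imports "HOL-Complex_Analysis.Complex_Analysis" "HOL-Library.Extended_Real"
begin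

type_synonym point = "real \<times> real"

definition sq :: "point \<Rightarrow> real \<Rightarrow> point set" where
  "sq p a = {fst p .. fst p + a} \<times> {snd p .. snd p + a}"

definition strip :: "real \<Rightarrow> point set" where
  "strip W = {0..W} \<times> {0..}"

definition feasible :: "real \<Rightarrow> (nat \<Rightarrow> real) \<Rightarrow> (nat \<Rightarrow> point) \<Rightarrow> nat \<Rightarrow> point \<Rightarrow> bool" where
  "feasible W s P i q \<longleftrightarrow> sq q (s i) \<subseteq> strip W \<and>
     (\<forall>j<i. interior (sq q (s i)) \<inter> interior (sq (P j) (s j)) = {})"

definition yx_le :: "point \<Rightarrow> point \<Rightarrow> bool" where
  "yx_le p q \<longleftrightarrow> snd p < snd q \<or> (snd p = snd q \<and> fst p \<le> fst q)"

definition bl_packing :: "real \<Rightarrow> nat \<Rightarrow> (nat \<Rightarrow> real) \<Rightarrow> (nat \<Rightarrow> point) \<Rightarrow> bool" where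
  "bl_packing W n s P \<longleftrightarrow> (\<forall>i<n. feasible W s P i (P i) \<and>
       (\<forall>q. feasible W s P i q \<longrightarrow> yx_le (P i) q))"

text \<open>i-pieces (i >= 1) use the first i squares, i.e. those with 0-based index j < i,
  and all k-pieces with k < i (collected in Old).\<close>
definition new_pieces :: "real \<Rightarrow> (nat \<Rightarrow> real) \<Rightarrow> (nat \<Rightarrow> point) \<Rightarrow> nat \<Rightarrow> point set set \<Rightarrow> point set set" where
  "new_pieces W s P i Old =
     {C \<in> components (strip W - (\<Union>j<i. sq (P j) (s j)) - \<Union>Old). bounded C}"

primrec old_pieces :: "real \<Rightarrow> (nat \<Rightarrow> real) \<Rightarrow> (nat \<Rightarrow> point) \<Rightarrow> nat \<Rightarrow> point set set" where
  "old_pieces W s P 0 = {}"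
| "old_pieces W s P (Suc i) = old_pieces W s P i \<union> new_pieces W s P i (old_pieces W s P i)"

definition pieces :: "real \<Rightarrow> (nat \<Rightarrow> real) \<Rightarrow> (nat \<Rightarrow> point) \<Rightarrow> nat \<Rightarrow> point set set" where
  "pieces W s P i = new_pieces W s P i (old_pieces W s P i)"

datatype fsq = Sq nat | SLeft | SRight | SBottom

fun fset :: "real \<Rightarrow> (nat \<Rightarrow> real) \<Rightarrow> (nat \<Rightarrow> point) \<Rightarrow> fsq \<Rightarrow> point set" where
  "fset W s P (Sq j) = sq (P j) (s j)"
| "fset W s P SLeft = {0} \<times> {0..}"
| "fset W s P SRight = {W} \<times> {0..}"
| "fset W s P SBottom = {0..W} \<times> {0}"

text \<open>Faces, valued in the extended reals (the formal side squares have top face +infinity).\<close>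
definition tf :: "point set \<Rightarrow> ereal" where "tf X = Sup ((\<lambda>p. ereal (snd p)) ` X)"
definition bf :: "point set \<Rightarrow> ereal" where "bf X = Inf ((\<lambda>p. ereal (snd p)) ` X)"
definition lf :: "point set \<Rightarrow> ereal" where "lf X = Inf ((\<lambda>p. ereal (fst p)) ` X)"
definition rf :: "point set \<Rightarrow> ereal" where "rf X = Sup ((\<lambda>p. ereal (fst p)) ` X)"

definition present :: "nat \<Rightarrow> fsq \<Rightarrow> bool" where
  "present i F \<longleftrightarrow> (case F of Sq j \<Rightarrow> j < i | _ \<Rightarrow> True)"

definition adj_squares :: "real \<Rightarrow> (nat \<Rightarrow> real) \<Rightarrow> (nat \<Rightarrow> point) \<Rightarrow> nat \<Rightarrow> point set \<Rightarrow> fsq set" where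
  "adj_squares W s P i U = {F. present i F \<and> closure U \<inter> fset W s P F \<noteq> {}}"

definition left_type :: "point set \<Rightarrow> point set \<Rightarrow> bool" where "left_type A B \<longleftrightarrow> lf A = rf B"
definition right_type :: "point set \<Rightarrow> point set \<Rightarrow> bool" where "right_type A B \<longleftrightarrow> rf A = lf B"
definition up_type :: "point set \<Rightarrow> point set \<Rightarrow> bool" where "up_type A B \<longleftrightarrow> tf A = bf B"
definition down_type :: "point set \<Rightarrow> point set \<Rightarrow> bool" where "down_type A B \<longleftrightarrow> bf A = tf B"

definition to_cplx :: "point \<Rightarrow> complex" where "to_cplx p = Complex (fst p) (snd p)"

text \<open>C lists the (formal) squares adjacent to U, each exactly once, in the order in which they
  are met when the boundary of U is traversed clockwise (U on the right, i.e. winding number -1):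
  there is a closed curve g running over the frontier of U and a subdivision
  0 = a 0 <= a 1 <= ... <= a m = 1 such that on [a k, a (k+1)] the curve runs inside C!k.\<close>
definition boundary_circuit :: "real \<Rightarrow> (nat \<Rightarrow> real) \<Rightarrow> (nat \<Rightarrow> point) \<Rightarrow> nat \<Rightarrow> point set \<Rightarrow> fsq list \<Rightarrow> bool" where
  "boundary_circuit W s P i U C \<longleftrightarrow>
     distinct C \<and> set C = adj_squares W s P i U \<and>
     (\<exists>(g :: real \<Rightarrow> point) (a :: nat \<Rightarrow> real).
        path g \<and> pathfinish g = pathstart g \<and> path_image g = frontier U \<and>
        (\<forall>z \<in> U - path_image g. winding_number (to_cplx \<circ> g) (to_cplx z) = -1) \<and>
        a 0 = 0 \<and> a (length C) = 1 \<and>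
        (\<forall>k < length C. a k \<le> a (Suc k) \<and> g ` {a k .. a (Suc k)} \<subseteq> fset W s P (C ! k)))"

text \<open>Start square: lowest top face, leftmost among ties.
  Top square: highest bottom face, rightmost among ties (ties in the right face broken by the
  left face, which only matters for formal squares).\<close>
definition is_start :: "real \<Rightarrow> (nat \<Rightarrow> real) \<Rightarrow> (nat \<Rightarrow> point) \<Rightarrow> fsq set \<Rightarrow> fsq \<Rightarrow> bool" where
  "is_start W s P A F \<longleftrightarrow> F \<in> A \<and>
     (\<forall>G\<in>A. tf (fset W s P F) \<le> tf (fset W s P G)) \<and>
     (\<forall>G\<in>A. tf (fset W s P G) = tf (fset W s P F) \<longrightarrow> lf (fset W s P F) \<le> lf (fset W s P G))"

definition is_top :: "real \<Rightarrow> (nat \<Rightarrow> real) \<Rightarrow> (nat \<Rightarrow> point) \<Rightarrow> fsq set \<Rightarrow> fsq \<Rightarrow> bool" where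
  "is_top W s P A F \<longleftrightarrow> F \<in> A \<and>
     (\<forall>G\<in>A. bf (fset W s P G) \<le> bf (fset W s P F)) \<and>
     (\<forall>G\<in>A. bf (fset W s P G) = bf (fset W s P F) \<longrightarrow>
        rf (fset W s P G) < rf (fset W s P F) \<or>
        (rf (fset W s P G) = rf (fset W s P F) \<and> lf (fset W s P G) \<le> lf (fset W s P F)))"

definition cnext :: "nat \<Rightarrow> nat \<Rightarrow> nat" where "cnext m k = (k + 1) mod m"
definition cprev :: "nat \<Rightarrow> nat \<Rightarrow> nat" where "cprev m k = (k + m - 1) mod m"
definition cdist :: "nat \<Rightarrow> nat \<Rightarrow> nat \<Rightarrow> nat" where "cdist m x y = (y + m - x) mod m"

end

theory Submission
  imports Defs
begin

text \<open>
  Thicken the walls and the floor of the strip, so that all formal squares become rectangles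
  (boxes). By bottom-left placement every box either touches another box along a piece of its left
  side or has nothing of the hole to its left, and the same holds for bottom sides; this is all that
  is used of the packing, and it is symmetric under exchanging the coordinates.

  The winding number of the circuit is -1 in the hole and 0 in the boxes, since the interior of a
  box is joined to the outside through its bottom supports. Its jump at an exposed point of a box
  shows that the circuit runs counterclockwise along the box. A local inspection of the transition
  from one box to the next then shows that an arrow which is neither of left nor of up type comes
  with an upper right corner of the hole, up to sliding along an exposed lower left corner of a box.

  Such a corner is unique. Below its upper box follow the bottom supports down to the floor, and to
  the left of its right box follow the left supports to the wall. Being to the right of the first
  chain and above the second is a locally constant property on the part of the hole below and to
  the left of the corner, and the two boxes close this part off: so the whole hole lies there.
\<close>

section \<open>Crossing a closed curve\<close>

text \<open>The obstacle is degeneracy. The curve need not be simple, the closure of the hole may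
  touch itself, and a transition between two boxes may happen where several boxes meet in one point.
  Therefore the orientation is read off from winding numbers alone, at points where only one box
  takes part, and the geometry near a point is recorded by its four open quadrants: which of them
  belong to the hole and which are filled by a box.

  A hole between arbitrary boxes could have many upper right corners, as under a staircase
  descending to the right. The support chains exclude all but one of them, with a single exception:
  a box may poke its lower left corner into the hole and so produce two upper right corners, one at
  its left side and one below it.

  The boxes at the corner turn out to be the top and the end square, up to ties. An arrow away from
  them therefore has no corner left to it and is of left or up type. The bottom path traverses such
  arrows backwards, which turns left into right and up into down.\<close>

lemma exp_eq_1_constant:
  fixes f :: "real \<Rightarrow> complex"
  assumes "continuous_on {a..b} f" "\<And>t. t \<in> {a..b} \<Longrightarrow> exp (f t) = c" "a \<le> b"
  shows "f a = f b"
proof -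
  have "f constant_on {a..b}"
  proof (rule continuous_discrete_range_constant)
    fix x assume x: "x \<in> {a..b}"
    show "\<exists>e>0. \<forall>y. y \<in> {a..b} \<and> f y \<noteq> f x \<longrightarrow> e \<le> norm (f y - f x)"
    proof (intro exI[of _ "2*pi"] conjI allI impI)
      fix y assume y: "y \<in> {a..b} \<and> f y \<noteq> f x"
      have "exp (f y) = exp (f x)" using assms(2) x y by simp
      then obtain n :: int where n: "f y = f x + of_int (2*n) * pi * \<i>"
        using exp_eq by metis
      with y have "n \<noteq> 0" by auto
      then have n1: "1 \<le> \<bar>real_of_int n\<bar>" by linarith
      have "norm (f y - f x) = 2 * pi * \<bar>real_of_int n\<bar>"
        using n by (simp add: norm_mult)
      then show "2 * pi \<le> norm (f y - f x)" using n1 by simp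
    qed auto
  qed (use assms in auto)
  then show ?thesis using assms(3) by (auto simp: constant_on_def)
qed

text \<open>A continuous logarithm of \<open>\<gamma> t - z\<close> exists because the parameter
  interval is contractible. It is kept explicit so that its increment can be computed piece by piece
  on subintervals.\<close>

lemma winding_number_continuous_log:
  assumes "path \<gamma>" "z \<notin> path_image \<gamma>"
  obtains q where "continuous_on {0..1} q" "\<And>t. t \<in> {0..1} \<Longrightarrow> \<gamma> t - z = exp (q t)"
    "q 1 - q 0 = 2 * pi * \<i> * winding_number \<gamma> z"
proof -
  have c1: "continuous_on {0..1} (\<lambda>t. \<gamma> t - z)" using assms(1) unfolding path_def by (intro continuous_intros)
  have c2: "contractible {0..1::real}" by (rule convex_imp_contractible) simp
  have c3: "\<gamma> t - z \<noteq> 0" if "t \<in> {0..1}" for t using assms(2) that by (auto simp: path_image_def)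
  obtain q where q: "continuous_on {0..1} q" "\<And>t. t \<in> {0..1} \<Longrightarrow> \<gamma> t - z = exp (q t)"
    using continuous_logarithm_on_contractible[OF c1 c2 c3] by blast
  have "winding_number \<gamma> z = winding_number (\<lambda>t. \<gamma> t - z) 0" by (rule winding_number_offset)
  also have "\<dots> = winding_number (exp \<circ> q) 0"
    by (rule winding_number_cong) (auto simp: q)
  also have "\<dots> = (pathfinish q - pathstart q) / (2 * of_real pi * \<i>)"
    by (rule winding_number_compose_exp) (use q in \<open>simp add: path_def\<close>)
  finally show ?thesis using that[OF q] by (simp add: pathfinish_def pathstart_def)
qed

text \<open>While \<open>h\<close> avoids the nonpositive reals, \<open>Ln\<close> is itself a
  continuous branch along \<open>h\<close>, and two continuous branches differ by a constant; the
  factor \<open>c\<close> only changes this constant.\<close>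

lemma Ln_increment:
  fixes h :: "real \<Rightarrow> complex"
  assumes "a \<le> b" "continuous_on {a..b} h" "continuous_on {a..b} q"
    "\<And>t. t \<in> {a..b} \<Longrightarrow> h t \<notin> \<real>\<^sub>\<le>\<^sub>0" "\<And>t. t \<in> {a..b} \<Longrightarrow> exp (q t) = c * h t" "c \<noteq> 0"
  shows "q b - q a = Ln (h b) - Ln (h a)"
proof -
  have nz: "h t \<noteq> 0" if "t \<in> {a..b}" for t using assms(4)[OF that] by auto
  have "(\<lambda>t. q t - Ln (h t)) a = (\<lambda>t. q t - Ln (h t)) b"
  proof (rule exp_eq_1_constant)
    show "continuous_on {a..b} (\<lambda>t. q t - Ln (h t))"
      using assms by (intro continuous_intros continuous_on_Ln) auto
    show "exp (q t - Ln (h t)) = c" if "t \<in> {a..b}" for t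
      using assms(5)[OF that] nz[OF that] by (simp add: exp_diff)
  qed fact
  then show ?thesis by (simp add: algebra_simps)
qed

text \<open>Only the segment between the two points is sent to the nonpositive reals by the
  quotient. So off this segment the principal logarithm of the quotient is a continuous branch of
  the difference of the two logarithms.\<close>

lemma mobius_nonpos:
  fixes \<zeta> :: complex and \<epsilon> :: real
  assumes "\<epsilon> > 0" "(\<zeta> - \<epsilon>) / (\<zeta> + \<epsilon>) \<in> \<real>\<^sub>\<le>\<^sub>0"
  shows "Im \<zeta> = 0 \<and> \<bar>Re \<zeta>\<bar> \<le> \<epsilon>"
proof (cases "\<zeta> + \<epsilon> = 0")
  \<comment> \<open>Here the division yields 0, which is a nonpositive real, and
    \<open>\<zeta>\<close> is an end of the segment.\<close>
  case True
  then have "\<zeta> = - of_real \<epsilon>" by (simp add: add_eq_0_iff)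
  then show ?thesis using assms by simp
next
  case False
  obtain s where s: "(\<zeta> - \<epsilon>) / (\<zeta> + \<epsilon>) = of_real s" "s \<le> 0"
    using assms(2) by (metis complex_nonpos_Reals_iff complex_is_Real_iff Reals_cases Re_complex_of_real)
  then have "\<zeta> - \<epsilon> = s * (\<zeta> + \<epsilon>)" using False by (simp add: field_simps)
  then have eq: "(1 - of_real s) * \<zeta> = of_real (\<epsilon> * (1 + s))" by (simp add: algebra_simps)
  have ns: "1 - s > 0" using s by simp
  have "(1 - s) * Im \<zeta> = 0" using arg_cong[OF eq, of Im] by (simp add: algebra_simps)
  then have im: "Im \<zeta> = 0" using ns by auto
  have re: "(1 - s) * Re \<zeta> = \<epsilon> * (1 + s)" using arg_cong[OF eq, of Re] by (simp add: algebra_simps)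
  have "(1 - s) * Re \<zeta> \<le> (1 - s) * \<epsilon>" unfolding re using assms(1) s(2)
    by (simp add: algebra_simps mult_nonneg_nonpos)
  moreover have "(1 - s) * (- \<epsilon>) \<le> (1 - s) * Re \<zeta>" unfolding re using assms(1) s(2)
    by (simp add: algebra_simps)
  ultimately have "Re \<zeta> \<le> \<epsilon>" "- \<epsilon> \<le> Re \<zeta>" using ns by (simp_all only: mult_le_cancel_left_pos)
  then show ?thesis using im by (auto simp: abs_le_iff)
qed

text \<open>The first two logarithms form the branch that works while the curve crosses the segment,
  the last one the branch that works off the segment. Their mismatch is an odd multiple of
  \<open>pi\<close>, since its exponential is -1. The three imaginary parts enter with the same sign
  and modulus below \<open>pi\<close>, which leaves one value on each side of the axis.\<close>

lemma crossing_phase: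
  fixes \<zeta> :: complex and \<epsilon> :: real
  assumes eps: "\<epsilon> > 0" and nz: "Im \<zeta> \<noteq> 0"
  shows "Im (Ln (\<epsilon> - \<zeta>) - Ln (\<zeta> + \<epsilon>) - Ln ((\<zeta> - \<epsilon>) / (\<zeta> + \<epsilon>))) = - sgn (Im \<zeta>) * pi"
proof -
  let ?\<Psi> = "Ln (\<epsilon> - \<zeta>) - Ln (\<zeta> + \<epsilon>) - Ln ((\<zeta> - \<epsilon>) / (\<zeta> + \<epsilon>))" and ?q = "(\<zeta> - \<epsilon>) / (\<zeta> + \<epsilon>)"
  have n1: "\<epsilon> - \<zeta> \<noteq> 0" "\<zeta> + \<epsilon> \<noteq> 0" "\<zeta> - \<epsilon> \<noteq> 0" using nz by (auto simp: complex_eq_iff)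
  have "exp ?\<Psi> = (\<epsilon> - \<zeta>) / (\<zeta> + \<epsilon>) / ?q" using n1 by (simp add: exp_diff)
  also have "\<dots> = (\<epsilon> - \<zeta>) / (\<zeta> - \<epsilon>)" using n1 by simp
  also have "\<dots> = -1" using n1 by (metis divide_self minus_diff_eq minus_divide_left)
  finally have "exp ?\<Psi> = exp (\<i> * pi)" by simp
  then obtain n :: int where n: "?\<Psi> = \<i> * pi + of_int (2*n) * pi * \<i>"
    using exp_eq by metis
  have imn: "Im ?\<Psi> = (1 + 2 * n) * pi" unfolding n by (simp add: algebra_simps)
  have imq: "Im ?q = 2 * \<epsilon> * Im \<zeta> / (cmod (\<zeta> + \<epsilon>))\<^sup>2"
    unfolding Im_divide' by (simp add: cmod_power2 algebra_simps power2_eq_square diff_divide_distrib[symmetric] add_divide_distrib[symmetric])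
  have q: "sgn (Im ?q) = sgn (Im \<zeta>)" "?q \<noteq> 0" unfolding imq using eps n1 by (simp_all add: sgn_mult sgn_divide)
  have Ln: "\<bar>Im (Ln z)\<bar> < pi \<and> sgn (Im (Ln z)) = sgn (Im z)" if "Im z \<noteq> 0" for z
  proof -
    have "z \<noteq> 0" using that by auto
    then show ?thesis
      using that Im_Ln_pos_lt[of z] Im_Ln_pos_le[of z] Im_Ln_le_pi[of z] mpi_less_Im_Ln[of z]
      by (cases "Im z > 0") (auto simp: sgn_if)
  qed
  have "Im (of_real \<epsilon> - \<zeta>) = - Im \<zeta>" "Im (\<zeta> + \<epsilon>) = Im \<zeta>" by simp_all
  moreover have "Im ?q \<noteq> 0" using q(1) nz by (metis sgn_zero_iff)
  ultimately have "\<bar>Im ?\<Psi>\<bar> < 3 * pi \<and> sgn (Im ?\<Psi>) = - sgn (Im \<zeta>)"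
    using Ln[of "\<epsilon> - \<zeta>"] Ln[of "\<zeta> + \<epsilon>"] Ln[of ?q] q(1) nz
    by (cases "Im \<zeta> > 0") (auto simp: sgn_if split: if_splits)
  then have b: "\<bar>real_of_int (1 + 2 * n)\<bar> * pi < 3 * pi" "sgn (real_of_int (1 + 2 * n)) = - sgn (Im \<zeta>)"
    unfolding imn by (auto simp: abs_mult sgn_mult)
  then have "\<bar>real_of_int (1 + 2 * n)\<bar> < 3" by (simp only: mult_less_cancel_right_pos pi_gt_zero)
  then have "n = 0 \<or> n = -1" by linarith
  then show ?thesis using b(2) nz unfolding imn by (auto simp: sgn_if split: if_splits)
qed

text \<open>In the coordinate \<open>\<zeta>\<close> the line is the real axis. The difference of
  the logarithms seen from the two ends has total increment \<open>- 2 * pi * \<i>\<close>. Between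
  \<alpha> and \<beta> it follows one branch and elsewhere the other, so the total is the change of
  the mismatch in \<open>crossing_phase\<close> between these two times. This forces a passage from
  the lower to the upper side.\<close>

lemma winding_number_crossing:
  fixes \<gamma> :: "real \<Rightarrow> complex" and e u :: complex and \<alpha> \<beta> \<epsilon> :: real
  assumes path: "path \<gamma>" "pathfinish \<gamma> = pathstart \<gamma>"
    and ab: "0 \<le> \<alpha>" "\<alpha> \<le> \<beta>" "\<beta> \<le> 1"
    and u: "u \<noteq> 0" and eps: "\<epsilon> > 0"
    and notin: "e + \<epsilon> * u \<notin> path_image \<gamma>" "e - \<epsilon> * u \<notin> path_image \<gamma>"
    and wind: "winding_number \<gamma> (e + \<epsilon> * u) - winding_number \<gamma> (e - \<epsilon> * u) = -1"
    and outer: "\<And>t s. t \<in> {0..\<alpha>} \<union> {\<beta>..1} \<Longrightarrow> \<bar>s\<bar> \<le> \<epsilon> \<Longrightarrow> \<gamma> t \<noteq> e + of_real s * u"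
    and inner: "\<And>t s. t \<in> {\<alpha>..\<beta>} \<Longrightarrow> \<gamma> t = e + of_real s * u \<Longrightarrow> s = 0"
  shows "Im ((\<gamma> \<alpha> - e) / u) < 0 \<and> 0 < Im ((\<gamma> \<beta> - e) / u)"
proof -
  define \<zeta> where "\<zeta> t = (\<gamma> t - e) / u" for t
  have g: "\<gamma> t = e + \<zeta> t * u" for t using u by (simp add: \<zeta>_def)
  have cont\<gamma>: "continuous_on {0..1} \<gamma>" using path(1) by (simp add: path_def)
  have cont: "continuous_on {0..1} \<zeta>" unfolding \<zeta>_def by (intro continuous_intros cont\<gamma>) (use u in auto)
  have real\<zeta>: "\<zeta> t = of_real (Re (\<zeta> t))" if "Im (\<zeta> t) = 0" for t using that by (simp add: complex_eq_iff)
  have out: "\<not> (Im (\<zeta> t) = 0 \<and> \<bar>Re (\<zeta> t)\<bar> \<le> \<epsilon>)" if "t \<in> {0..\<alpha>} \<union> {\<beta>..1}" for t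
    using outer[OF that, of "Re (\<zeta> t)"] real\<zeta>[of t] g[of t] by metis
  have inn: "\<zeta> t = 0" if "t \<in> {\<alpha>..\<beta>}" "Im (\<zeta> t) = 0" for t
    using inner[OF that(1), of "Re (\<zeta> t)"] real\<zeta>[OF that(2)] g[of t] by (metis of_real_0)
  have ne: "\<zeta> t - \<epsilon> \<noteq> 0" "\<zeta> t + \<epsilon> \<noteq> 0" if "t \<in> {0..1}" for t
  proof -
    show "\<zeta> t - \<epsilon> \<noteq> 0"
    proof
      assume "\<zeta> t - \<epsilon> = 0"
      then have "\<gamma> t = e + \<epsilon> * u" using g[of t] by simp
      then show False using notin(1) that unfolding path_image_def by (metis image_eqI)
    qed
    show "\<zeta> t + \<epsilon> \<noteq> 0"
    proof
      assume "\<zeta> t + \<epsilon> = 0"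
      then have "\<zeta> t = - \<epsilon>" by (simp add: add_eq_0_iff)
      then have "\<gamma> t = e - \<epsilon> * u" using g[of t] by simp
      then show False using notin(2) that unfolding path_image_def by (metis image_eqI)
    qed
  qed
  obtain qz where qz: "continuous_on {0..1} qz"
    "\<And>t. t \<in> {0..1} \<Longrightarrow> \<gamma> t - (e + \<epsilon> * u) = exp (qz t)"
    "qz 1 - qz 0 = 2 * pi * \<i> * winding_number \<gamma> (e + \<epsilon> * u)"
    using winding_number_continuous_log[OF path(1) notin(1)] by metis
  obtain qw where qw: "continuous_on {0..1} qw"
    "\<And>t. t \<in> {0..1} \<Longrightarrow> \<gamma> t - (e - \<epsilon> * u) = exp (qw t)"
    "qw 1 - qw 0 = 2 * pi * \<i> * winding_number \<gamma> (e - \<epsilon> * u)"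
    using winding_number_continuous_log[OF path(1) notin(2)] by metis
  have ez: "exp (qz t) = u * (\<zeta> t - \<epsilon>)" if "t \<in> {0..1}" for t
    unfolding qz(2)[OF that, symmetric] g[of t] by (simp add: algebra_simps)
  have ew: "exp (qw t) = u * (\<zeta> t + \<epsilon>)" if "t \<in> {0..1}" for t
    unfolding qw(2)[OF that, symmetric] g[of t] by (simp add: algebra_simps)
  define D where "D t = qz t - qw t" for t
  define M where "M t = (\<zeta> t - \<epsilon>) / (\<zeta> t + \<epsilon>)" for t
  have contD: "continuous_on {0..1} D" unfolding D_def by (intro continuous_intros qz qw)
  have contM: "continuous_on {0..1} M" unfolding M_def by (intro continuous_intros cont) (use ne in auto)
  have eD: "exp (D t) = 1 * M t" if "t \<in> {0..1}" for t
    using ez[OF that] ew[OF that] using u unfolding D_def M_def by (simp add: exp_diff)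
  have Mout: "M t \<notin> \<real>\<^sub>\<le>\<^sub>0" if "t \<in> {0..\<alpha>} \<union> {\<beta>..1}" for t
    using mobius_nonpos[OF eps, of "\<zeta> t"] out[OF that] unfolding M_def by blast
  have D1: "D \<alpha> - D 0 = Ln (M \<alpha>) - Ln (M 0)"
    by (rule Ln_increment[where c=1]) (use ab Mout eD in \<open>auto intro: continuous_on_subset[OF contM] continuous_on_subset[OF contD]\<close>)
  have D3: "D 1 - D \<beta> = Ln (M 1) - Ln (M \<beta>)"
    by (rule Ln_increment[where c=1]) (use ab Mout eD in \<open>auto intro: continuous_on_subset[OF contM] continuous_on_subset[OF contD]\<close>)
  have in1: "of_real \<epsilon> - \<zeta> t \<notin> \<real>\<^sub>\<le>\<^sub>0" "\<zeta> t + \<epsilon> \<notin> \<real>\<^sub>\<le>\<^sub>0" if "t \<in> {\<alpha>..\<beta>}" for t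
  proof -
    show "of_real \<epsilon> - \<zeta> t \<notin> \<real>\<^sub>\<le>\<^sub>0"
      using inn[OF that] eps by (auto simp: complex_nonpos_Reals_iff)
    show "\<zeta> t + \<epsilon> \<notin> \<real>\<^sub>\<le>\<^sub>0"
      using inn[OF that] eps by (auto simp: complex_nonpos_Reals_iff)
  qed
  have c\<zeta>: "continuous_on {\<alpha>..\<beta>} \<zeta>" by (rule continuous_on_subset[OF cont]) (use ab in auto)
  have Z2: "qz \<beta> - qz \<alpha> = Ln (of_real \<epsilon> - \<zeta> \<beta>) - Ln (of_real \<epsilon> - \<zeta> \<alpha>)"
  proof (rule Ln_increment[where c="- u"])
    show "exp (qz t) = - u * (of_real \<epsilon> - \<zeta> t)" if "t \<in> {\<alpha>..\<beta>}" for t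
      using ez[of t] that ab by (simp add: algebra_simps)
    show "continuous_on {\<alpha>..\<beta>} (\<lambda>t. of_real \<epsilon> - \<zeta> t)" by (intro continuous_intros c\<zeta>)
    show "continuous_on {\<alpha>..\<beta>} qz" by (rule continuous_on_subset[OF qz(1)]) (use ab in auto)
  qed (use ab in1 u in auto)
  have W2: "qw \<beta> - qw \<alpha> = Ln (\<zeta> \<beta> + \<epsilon>) - Ln (\<zeta> \<alpha> + \<epsilon>)"
  proof (rule Ln_increment[where c=u])
    show "exp (qw t) = u * (\<zeta> t + \<epsilon>)" if "t \<in> {\<alpha>..\<beta>}" for t
      using ew[of t] that ab by simp
    show "continuous_on {\<alpha>..\<beta>} (\<lambda>t. \<zeta> t + of_real \<epsilon>)" by (intro continuous_intros c\<zeta>)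
    show "continuous_on {\<alpha>..\<beta>} qw" by (rule continuous_on_subset[OF qw(1)]) (use ab in auto)
  qed (use ab in1 u in auto)
  have M01: "M 1 = M 0" using path(2) unfolding M_def \<zeta>_def pathfinish_def pathstart_def by simp
  \<comment> \<open>The mismatch of the two branches; the outer increments join up at the closing
    point because \<open>M 1 = M 0\<close>.\<close>
  define \<Psi> where "\<Psi> t = Ln (of_real \<epsilon> - \<zeta> t) - Ln (\<zeta> t + \<epsilon>) - Ln (M t)" for t
  have "D 1 - D 0 = \<Psi> \<beta> - \<Psi> \<alpha>"
    proof -
    have "D 1 - D 0 = (D 1 - D \<beta>) + ((qz \<beta> - qz \<alpha>) - (qw \<beta> - qw \<alpha>)) + (D \<alpha> - D 0)"
      unfolding D_def by simp
    then show ?thesis unfolding D1 D3 Z2 W2 M01 \<Psi>_def by simp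
  qed
  moreover have "D 1 - D 0 = - 2 * pi * \<i>"
  proof -
    have "D 1 - D 0 = 2 * pi * \<i> * (winding_number \<gamma> (e + \<epsilon> * u) - winding_number \<gamma> (e - \<epsilon> * u))"
      using qz(3) qw(3) unfolding D_def by (simp add: algebra_simps)
    then show ?thesis unfolding wind by simp
  qed
  ultimately have key: "Im (\<Psi> \<beta>) - Im (\<Psi> \<alpha>) = - 2 * pi" by (metis minus_complex.sel(2) Im_i_times Re_complex_of_real mult.commute of_real_minus of_real_mult of_real_numeral)
  \<comment> \<open>Both conditions hold at the junction times: a real \<open>\<zeta>\<close> would
    be 0 by \<open>inn\<close>, and 0 is excluded by \<open>out\<close>.\<close>
  have nz: "Im (\<zeta> \<alpha>) \<noteq> 0" "Im (\<zeta> \<beta>) \<noteq> 0"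
    using inn[of \<alpha>] inn[of \<beta>] out[of \<alpha>] out[of \<beta>] ab eps by force+
  have "Im (\<Psi> \<alpha>) = - sgn (Im (\<zeta> \<alpha>)) * pi" "Im (\<Psi> \<beta>) = - sgn (Im (\<zeta> \<beta>)) * pi"
    unfolding \<Psi>_def M_def by (intro crossing_phase eps nz)+
  with key nz have "Im (\<zeta> \<alpha>) < 0 \<and> 0 < Im (\<zeta> \<beta>)"
    by (cases "Im (\<zeta> \<alpha>) > 0"; cases "Im (\<zeta> \<beta>) > 0") (auto simp: sgn_if split: if_splits)
  then show ?thesis by (simp add: \<zeta>_def)
qed

section \<open>Holes between supported boxes\<close>

definition side :: "bool \<Rightarrow> real \<Rightarrow> real \<Rightarrow> real set" where
  "side s a e = (if s then {a<..<a+e} else {a-e<..<a})"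

text \<open>The Booleans name a quadrant at \<open>p\<close>, with \<open>True\<close> for right and
  for up. Quadrants describe the hole near a point even where several boxes meet in corners.\<close>

definition sector :: "point set \<Rightarrow> bool \<Rightarrow> bool \<Rightarrow> point \<Rightarrow> bool" where
  "sector U sx sy p \<longleftrightarrow> (\<exists>e>0. side sx (fst p) e \<times> side sy (snd p) e \<subseteq> U)"

lemma side_mono: "d \<le> e \<Longrightarrow> side s a d \<subseteq> side s a e"
  by (auto simp: side_def)

lemma side_interval:
  assumes "e > 0"
  obtains x1 x2 where "side s a e = {x1<..<x2}" "x1 < x2"
    "if s then x1 = a \<and> x2 = a + e else x1 = a - e \<and> x2 = a"
  using that[of a "a + e"] that[of "a - e" a] assms by (cases s) (auto simp: side_def)

text \<open>Neighbourhoods are axis-parallel squares, to fit the inequalities between coordinates of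
  boxes.\<close>

lemma connected_locally_constant:
  assumes "connected S"
    and "\<And>z. z \<in> S \<Longrightarrow> \<exists>e>0. \<forall>z'\<in>S. \<bar>fst z' - fst z\<bar> < e \<and> \<bar>snd z' - snd z\<bar> < e \<longrightarrow> (G z' \<longleftrightarrow> G z)"
    and "z0 \<in> S" "G z0" "z \<in> S"
  shows "G (z :: point)"
proof (rule connected_induction_simple[where P = G and a = z0 and S = S])
  show "connected S" "z0 \<in> S" "z \<in> S" "G z0" by fact+
next
  fix a assume a: "a \<in> S"
  obtain e where e: "e > 0" "\<And>z'. z' \<in> S \<Longrightarrow> \<bar>fst z' - fst a\<bar> < e \<Longrightarrow> \<bar>snd z' - snd a\<bar> < e \<Longrightarrow> (G z' \<longleftrightarrow> G a)"
    using assms(2)[OF a] by blast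
  let ?T = "S \<inter> ({fst a - e<..<fst a + e} \<times> {snd a - e<..<snd a + e})"
  have "openin (top_of_set S) ?T" by (intro openin_open_Int open_Times) auto
  moreover have "a \<in> ?T" using a e(1) by (cases a) auto
  moreover have "\<forall>x\<in>?T. \<forall>y\<in>?T. G x \<longrightarrow> G y"
  proof (intro ballI impI)
    fix x y assume "x \<in> ?T" "y \<in> ?T" "G x"
    then show "G y" using e(2)[of x] e(2)[of y] by (cases x; cases y) (auto simp: abs_less_iff)
  qed
  ultimately show "\<exists>T. openin (top_of_set S) T \<and> a \<in> T \<and> (\<forall>x\<in>T. \<forall>y\<in>T. G x \<longrightarrow> G y)" by blast
qed

lemma finite_gap:
  fixes a :: real
  assumes "finite F"
  obtains e where "e > 0" "\<And>c. c \<in> F \<Longrightarrow> c = a \<or> e \<le> \<bar>c - a\<bar>"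
proof -
  obtain d where "d > 0" "\<forall>x\<in>F. x \<noteq> a \<longrightarrow> d \<le> dist a x"
    using finite_set_avoid[OF assms] by blast
  then show ?thesis using that[of d] by (auto simp: dist_real_def abs_minus_commute)
qed

text \<open>The exemption in the support assumptions is stated for \<open>closure U\<close>, so that
  a single boundary point of the hole at or beyond the level of a side already provides a support of
  that side.\<close>

locale hole =
  fixes I :: "'i set" and l r b t :: "'i \<Rightarrow> real" and U :: "point set"
  assumes fin: "finite I"
    and lr: "i \<in> I \<Longrightarrow> l i < r i" and bt: "i \<in> I \<Longrightarrow> b i < t i"
    and disj: "i \<in> I \<Longrightarrow> j \<in> I \<Longrightarrow> i \<noteq> j \<Longrightarrow> r i \<le> l j \<or> r j \<le> l i \<or> t i \<le> b j \<or> t j \<le> b i"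
    and left_support: "i \<in> I \<Longrightarrow> (\<forall>z\<in>closure U. l i < fst z) \<or> (\<exists>j\<in>I. r j = l i \<and> b j < t i \<and> b i < t j)"
    and bottom_support: "i \<in> I \<Longrightarrow> (\<forall>z\<in>closure U. b i < snd z) \<or> (\<exists>j\<in>I. t j = b i \<and> l j < r i \<and> l i < r j)"
    and opU: "open U" and conU: "connected U" and neU: "U \<noteq> {}" and bdU: "bounded U"
    and free: "i \<in> I \<Longrightarrow> z \<in> U \<Longrightarrow> \<not> (l i \<le> fst z \<and> fst z \<le> r i \<and> b i \<le> snd z \<and> snd z \<le> t i)"
    and boundary: "z \<in> closure U \<Longrightarrow> z \<notin> U \<Longrightarrow> \<exists>i\<in>I. l i \<le> fst z \<and> fst z \<le> r i \<and> b i \<le> snd z \<and> snd z \<le> t i"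
begin

definition box_of :: "'i \<Rightarrow> point set" where
  "box_of i = {l i..r i} \<times> {b i..t i}"

text \<open>The counterpart of \<open>sector\<close> for a box: it fills the quadrant near
  \<open>p\<close>, where \<open>p\<close> may be a corner or lie on a side of the box.\<close>

definition covers :: "bool \<Rightarrow> bool \<Rightarrow> point \<Rightarrow> 'i \<Rightarrow> bool" where
  "covers sx sy p i \<longleftrightarrow> i \<in> I \<and> p \<in> box_of i \<and>
     (if sx then fst p < r i else l i < fst p) \<and> (if sy then snd p < t i else b i < snd p)"

text \<open>\<open>Q\<close> pokes its lower left corner into the hole: \<open>K\<close> touches its
  left side, \<open>Y\<close> its bottom side, and the hole fills the other three quadrants at that
  corner. This is the exceptional shape with two upper right corners, one under \<open>K\<close> and
  one left of \<open>Y\<close>. No support of \<open>Q\<close> is nearer to its corner than these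
  two, and the last clause records that the hole is closed off.\<close>

definition notch :: "'i \<Rightarrow> 'i \<Rightarrow> 'i \<Rightarrow> bool" where
  "notch K Q Y \<longleftrightarrow> K \<in> I \<and> Q \<in> I \<and> Y \<in> I \<and> r K = l Q \<and> b Q < b K \<and> b K < t Q \<and>
     t Y = b Q \<and> l Q < l Y \<and> l Y < r Q \<and>
     sector U False False (l Q, b K) \<and> sector U False False (l Y, b Q) \<and>
     sector U False True (l Q, b Q) \<and> sector U False False (l Q, b Q) \<and> sector U True False (l Q, b Q) \<and>
     (\<forall>j\<in>I. r j = l Q \<longrightarrow> b j < b K \<longrightarrow> t j \<le> b Q) \<and> (\<forall>j\<in>I. t j = b Q \<longrightarrow> l j < l Y \<longrightarrow> r j \<le> l Q) \<and>
     (\<forall>z\<in>U. fst z < l Y \<and> snd z < b K)"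

lemma mem_box_of: "p \<in> box_of i \<longleftrightarrow> l i \<le> fst p \<and> fst p \<le> r i \<and> b i \<le> snd p \<and> snd p \<le> t i"
  by (cases p) (auto simp: box_of_def)

text \<open>To leave \<open>U\<close> the set would have to meet the frontier, which the boxes
  cover. Together with the rectangle version below, this is how regions are shown to belong to the
  hole from one point in it.\<close>

lemma connected_subset_U:
  assumes "connected S" "S \<inter> U \<noteq> {}" "\<And>z i. z \<in> S \<Longrightarrow> i \<in> I \<Longrightarrow> z \<notin> box_of i"
  shows "S \<subseteq> U"
proof (rule ccontr)
  assume "\<not> S \<subseteq> U"
  then have "S \<inter> frontier U \<noteq> {}" using connected_Int_frontier[OF assms(1), of U] assms(2) by blast
  then obtain z where "z \<in> S" "z \<in> closure U" "z \<notin> U"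
    using opU by (auto simp: frontier_def interior_open)
  then show False using boundary[of z] assms(3)[of z] by (auto simp: mem_box_of)
qed

lemma rectangle_subset_U:
  assumes "z \<in> U" "z \<in> {x1<..<x2} \<times> {y1<..<y2}"
    "\<And>i. i \<in> I \<Longrightarrow> l i < x2 \<Longrightarrow> x1 < r i \<Longrightarrow> b i < y2 \<Longrightarrow> y1 < t i \<Longrightarrow> False"
  shows "{x1<..<x2} \<times> {y1<..<y2} \<subseteq> U"
proof (rule connected_subset_U)
  show "connected ({x1<..<x2} \<times> {y1<..<y2})" by (intro connected_Times) auto
  show "{x1<..<x2} \<times> {y1<..<y2} \<inter> U \<noteq> {}" using assms(1,2) by blast
  fix z i assume "z \<in> {x1<..<x2} \<times> {y1<..<y2}" "i \<in> I"
  then show "z \<notin> box_of i" using assms(3)[of i] by (cases z) (auto simp: mem_box_of)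
qed

text \<open>Within distance \<open>e\<close> of \<open>x\<close> and of \<open>y\<close> no other
  coordinate of a box occurs, so whether a box reaches a nearby point is decided at
  \<open>(x, y)\<close>.\<close>

definition gap :: "real \<Rightarrow> real \<Rightarrow> real \<Rightarrow> bool" where
  "gap e x y \<longleftrightarrow> (\<forall>i\<in>I. (l i = x \<or> e \<le> \<bar>l i - x\<bar>) \<and> (r i = x \<or> e \<le> \<bar>r i - x\<bar>) \<and>
     (b i = y \<or> e \<le> \<bar>b i - y\<bar>) \<and> (t i = y \<or> e \<le> \<bar>t i - y\<bar>))"

lemma gapD:
  assumes "gap e x y" "i \<in> I"
  shows "l i = x \<or> e \<le> \<bar>l i - x\<bar>" "r i = x \<or> e \<le> \<bar>r i - x\<bar>"
    "b i = y \<or> e \<le> \<bar>b i - y\<bar>" "t i = y \<or> e \<le> \<bar>t i - y\<bar>"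
  using assms unfolding gap_def by blast+

lemma gap_exists:
  obtains e where "e > 0" "gap e x y"
proof -
  obtain e where e: "e > 0" "\<And>c. c \<in> l ` I \<union> r ` I \<Longrightarrow> c = x \<or> e \<le> \<bar>c - x\<bar>"
    using finite_gap[of "l ` I \<union> r ` I" x] fin by blast
  obtain d where d: "d > 0" "\<And>c. c \<in> b ` I \<union> t ` I \<Longrightarrow> c = y \<or> d \<le> \<bar>c - y\<bar>"
    using finite_gap[of "b ` I \<union> t ` I" y] fin by blast
  have "gap (min e d) x y" unfolding gap_def
  proof
    fix i assume "i \<in> I"
    then show "(l i = x \<or> min e d \<le> \<bar>l i - x\<bar>) \<and> (r i = x \<or> min e d \<le> \<bar>r i - x\<bar>) \<and>
                (b i = y \<or> min e d \<le> \<bar>b i - y\<bar>) \<and> (t i = y \<or> min e d \<le> \<bar>t i - y\<bar>)"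
      using e(2)[of "l i"] e(2)[of "r i"] d(2)[of "b i"] d(2)[of "t i"] by (auto simp: min_def)
  qed
  then show ?thesis using that[of "min e d"] e(1) d(1) by simp
qed

lemma sector_closure:
  assumes "sector U sx sy p" shows "p \<in> closure U"
proof -
  obtain e where e: "e > 0" "side sx (fst p) e \<times> side sy (snd p) e \<subseteq> U"
    using assms by (auto simp: sector_def)
  have "fst p \<in> closure (side sx (fst p) e)" "snd p \<in> closure (side sy (snd p) e)"
    using e(1) by (auto simp: side_def closure_greaterThanLessThan)
  then have "p \<in> closure (side sx (fst p) e \<times> side sy (snd p) e)"
    by (cases p) (auto simp: closure_Times)
  then show ?thesis using closure_mono[OF e(2)] by blast
qed

lemma sector_not_covered:
  assumes "sector U sx sy p" shows "\<not> covers sx sy p i"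
proof
  assume c: "covers sx sy p i"
  obtain e where e: "e > 0" "side sx (fst p) e \<times> side sy (snd p) e \<subseteq> U"
    using assms by (auto simp: sector_def)
  \<comment> \<open>Halfway to the nearer end, be it that of the quadrant or that of the
    box.\<close>
  define x where "x = (if sx then (fst p + min (fst p + e) (r i)) / 2 else (fst p + max (fst p - e) (l i)) / 2)"
  define y where "y = (if sy then (snd p + min (snd p + e) (t i)) / 2 else (snd p + max (snd p - e) (b i)) / 2)"
  have x: "x \<in> side sx (fst p) e \<and> l i \<le> x \<and> x \<le> r i"
    using c e(1) lr[of i] unfolding x_def covers_def side_def mem_box_of
    by (cases sx) (auto simp: min_def max_def field_simps)
  have y: "y \<in> side sy (snd p) e \<and> b i \<le> y \<and> y \<le> t i"
    using c e(1) bt[of i] unfolding y_def covers_def side_def mem_box_of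
    by (cases sy) (auto simp: min_def max_def field_simps)
  from x y e(2) have "(x, y) \<in> U" by blast
  then show False using free[of i "(x,y)"] x y c by (auto simp: covers_def)
qed

lemma covers_unique:
  assumes "covers sx sy p i" "covers sx sy p j" shows "i = j"
proof (rule ccontr)
  assume "i \<noteq> j"
  then have "r i \<le> l j \<or> r j \<le> l i \<or> t i \<le> b j \<or> t j \<le> b i"
    using disj[of i j] assms by (auto simp: covers_def)
  then show False using assms by (auto simp: covers_def mem_box_of split: if_splits)
qed

text \<open>Since \<open>U\<close> is open, a point of \<open>U\<close> near \<open>p\<close> can be
  moved off both axes through \<open>p\<close>. A box meeting its quadrant cell of gap size would
  contain the whole cell, and hence this point.\<close>

lemma sector_exists:
  assumes "p \<in> closure U" shows "\<exists>sx sy. sector U sx sy p"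
proof -
  obtain e where e: "e > 0" "gap e (fst p) (snd p)"
    using gap_exists by blast
  let ?R = "{fst p - e<..<fst p + e} \<times> {snd p - e<..<snd p + e}"
  have "open ?R" "p \<in> ?R" using e(1) by (auto intro: open_Times simp: mem_Times_iff)
  then obtain z where z: "z \<in> ?R" "z \<in> U" using assms by (meson closure_iff_nhds_not_empty disjoint_iff open_subset order_refl)
  define W where "W = ?R \<inter> U"
  have "open W" "z \<in> W" unfolding W_def using opU \<open>open ?R\<close> z by auto
  then obtain d where d: "d > 0" "ball z d \<subseteq> W" by (meson open_contains_ball)
  obtain x where x: "x \<noteq> fst p" "\<bar>x - fst z\<bar> < d/2"
    using d(1) that[of "fst z"] that[of "fst z + d/4"] by (cases "fst z = fst p") auto
  obtain y where y: "y \<noteq> snd p" "\<bar>y - snd z\<bar> < d/2"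
    using d(1) that[of "snd z"] that[of "snd z + d/4"] by (cases "snd z = snd p") auto
  have "dist z (x, y) \<le> \<bar>fst z - x\<bar> + \<bar>snd z - y\<bar>"
    by (cases z) (simp add: dist_Pair_Pair dist_real_def sqrt_sum_squares_le_sum_abs)
  also have "\<dots> < d" using x y by (simp add: abs_minus_commute)
  finally have "(x, y) \<in> W" using d by auto
  then have xyU: "(x, y) \<in> U" and xyR: "\<bar>x - fst p\<bar> < e" "\<bar>y - snd p\<bar> < e" by (auto simp: W_def abs_less_iff)
  define sx where "sx \<longleftrightarrow> fst p < x"
  define sy where "sy \<longleftrightarrow> snd p < y"
  obtain x1 x2 where X: "side sx (fst p) e = {x1<..<x2}" "x1 < x2" "if sx then x1 = fst p \<and> x2 = fst p + e else x1 = fst p - e \<and> x2 = fst p"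
    using side_interval[OF e(1)] by metis
  obtain y1 y2 where Y: "side sy (snd p) e = {y1<..<y2}" "y1 < y2" "if sy then y1 = snd p \<and> y2 = snd p + e else y1 = snd p - e \<and> y2 = snd p"
    using side_interval[OF e(1)] by metis
  have "{x1<..<x2} \<times> {y1<..<y2} \<subseteq> U"
  proof (rule rectangle_subset_U[OF xyU])
    show "(x, y) \<in> {x1<..<x2} \<times> {y1<..<y2}"
      using X Y xyR x(1) y(1) by (auto simp: sx_def sy_def abs_less_iff split: if_splits)
    fix i assume i: "i \<in> I" "l i < x2" "x1 < r i" "b i < y2" "y1 < t i"
    have "l i \<le> x \<and> x \<le> r i" "b i \<le> y \<and> y \<le> t i"
      using i gapD[OF e(2) i(1)] X(3) Y(3) xyR x(1) y(1) by (auto simp: sx_def sy_def abs_less_iff split: if_splits)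
    then show False using free[OF i(1) xyU] by auto
  qed
  then have "sector U sx sy p" unfolding sector_def using e(1) X(1) Y(1) by metis
  then show ?thesis by blast
qed

text \<open>If no box filled the adjacent quadrant, no box would meet the common edge of the two
  quadrants either, and the hole would continue across it.\<close>

lemma sector_or_covers_vertical:
  assumes "sector U sx sy p" "\<not> sector U sx (\<not> sy) p" shows "\<exists>i. covers sx (\<not> sy) p i"
proof (rule ccontr)
  assume no: "\<not> ?thesis"
  obtain d where d: "d > 0" "gap d (fst p) (snd p)"
    using gap_exists by blast
  obtain e0 where e0: "e0 > 0" "side sx (fst p) e0 \<times> side sy (snd p) e0 \<subseteq> U"
    using assms by (auto simp: sector_def)
  define e where "e = min d e0"
  have e: "e > 0" "e \<le> d" "side sx (fst p) e \<times> side sy (snd p) e \<subseteq> U"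
    using d(1) e0 Sigma_mono[OF side_mono[of e e0 sx "fst p"] side_mono[of e e0 sy "snd p"]] by (auto simp: e_def)
  obtain x1 x2 where X: "side sx (fst p) e = {x1<..<x2}" "x1 < x2" "if sx then x1 = fst p \<and> x2 = fst p + e else x1 = fst p - e \<and> x2 = fst p"
    using side_interval[OF e(1)] by metis
  define y where "y = (if sy then snd p + e/2 else snd p - e/2)"
  have "((x1+x2)/2, y) \<in> side sx (fst p) e \<times> side sy (snd p) e" using X(1,2) e(1) by (auto simp: y_def side_def[of sy])
  then have yU: "((x1+x2)/2, y) \<in> U" using e(3) by blast
  have "{x1<..<x2} \<times> {snd p - e<..<snd p + e} \<subseteq> U"
  proof (rule rectangle_subset_U[OF yU])
    show "((x1+x2)/2, y) \<in> {x1<..<x2} \<times> {snd p - e<..<snd p + e}" using X(2) e(1) by (auto simp: y_def)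
    fix i assume i: "i \<in> I" "l i < x2" "x1 < r i" "b i < snd p + e" "snd p - e < t i"
    have pb: "p \<in> box_of i" and cx: "if sx then fst p < r i else l i < fst p"
      using i gapD[OF d(2) i(1)] X(2,3) e(2) by (auto simp: mem_box_of split: if_splits)
    have "\<not> covers sx sy p i" "\<not> covers sx (\<not> sy) p i" using sector_not_covered[OF assms(1)] no by auto
    then show False using pb cx i(1) bt[OF i(1)] by (auto simp: covers_def mem_box_of split: if_splits)
  qed
  then have "side sx (fst p) e \<times> side (\<not> sy) (snd p) e \<subseteq> U"
    using X(1) by (auto simp: side_def[of "\<not> sy"])
  then show False using assms(2) e(1) by (auto simp: sector_def)
qed

lemma closure_swap: "closure (prod.swap ` S) = prod.swap ` closure (S :: point set)"
proof -
  have "linear (prod.swap :: point \<Rightarrow> point)" by (rule linearI) (auto simp: prod.swap_def)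
  then show ?thesis using closure_injective_linear_image[of "prod.swap :: point \<Rightarrow> point" S] by (auto simp: inj_swap)
qed

text \<open>Transfers statements about left sides to bottom sides instead of proving them
  twice.\<close>

lemma swap_hole: "hole I b t l r (prod.swap ` U)"
proof
  show "open (prod.swap ` U)"
  proof -
    have "prod.swap ` U = prod.swap -` U" by force
    moreover have "continuous_on UNIV (prod.swap :: point \<Rightarrow> point)" by (auto simp: prod.swap_def intro!: continuous_intros)
    ultimately show ?thesis using opU open_vimage by metis
  qed
  have c: "continuous_on A (prod.swap :: point \<Rightarrow> point)" for A by (auto simp: prod.swap_def intro!: continuous_intros)
  show "connected (prod.swap ` U)" using connected_continuous_image[OF c conU] .
  show "bounded (prod.swap ` U)"
    using bounded_subset[OF compact_imp_bounded[OF compact_continuous_image[OF c]], of "closure U"] bdU closure_subset[of U]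
    by (simp add: compact_closure image_mono)
  show "finite I" by (rule fin)
  show "l i < r i" "b i < t i" if "i \<in> I" for i using lr bt that by auto
  show "t i \<le> b j \<or> t j \<le> b i \<or> r i \<le> l j \<or> r j \<le> l i" if "i \<in> I" "j \<in> I" "i \<noteq> j" for i j
    using disj[OF that] by auto
  show "(\<forall>z\<in>closure (prod.swap ` U). b i < fst z) \<or> (\<exists>j\<in>I. t j = b i \<and> l j < r i \<and> l i < r j)" if "i \<in> I" for i
    using bottom_support[OF that] by (auto simp: closure_swap)
  show "(\<forall>z\<in>closure (prod.swap ` U). l i < snd z) \<or> (\<exists>j\<in>I. r j = l i \<and> b j < t i \<and> b i < t j)" if "i \<in> I" for i
    using left_support[OF that] by (auto simp: closure_swap)
  show "prod.swap ` U \<noteq> {}" using neU by auto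
  show "\<not> (b i \<le> fst z \<and> fst z \<le> t i \<and> l i \<le> snd z \<and> snd z \<le> r i)" if "i \<in> I" "z \<in> prod.swap ` U" for i z
    using free[OF that(1), of "prod.swap z"] that(2) by auto
  show "\<exists>i\<in>I. b i \<le> fst z \<and> fst z \<le> t i \<and> l i \<le> snd z \<and> snd z \<le> r i"
    if "z \<in> closure (prod.swap ` U)" "z \<notin> prod.swap ` U" for z
  proof -
    have "prod.swap z \<in> closure U" "prod.swap z \<notin> U" using that by (auto simp: closure_swap image_iff) 
    then show ?thesis using boundary[of "prod.swap z"] by auto
  qed
qed

lemma sector_swap: "sector (prod.swap ` U) sx sy (x, y) \<longleftrightarrow> sector U sy sx (y, x)"
proof -
  have "A \<times> B \<subseteq> prod.swap ` U \<longleftrightarrow> B \<times> A \<subseteq> U" for A B :: "real set" by force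
  then show ?thesis by (simp add: sector_def)
qed

lemma sector_or_covers_horizontal:
  assumes "sector U sx sy p" "\<not> sector U (\<not> sx) sy p" shows "\<exists>i. covers (\<not> sx) sy p i"
proof -
  interpret T: hole I b t l r "prod.swap ` U" by (rule swap_hole)
  have "\<exists>i. T.covers sy (\<not> sx) (prod.swap p) i"
    by (rule T.sector_or_covers_vertical) (use assms in \<open>cases p; simp add: sector_swap\<close>)+
  then obtain i where "T.covers sy (\<not> sx) (prod.swap p) i" by blast
  then have "covers (\<not> sx) sy p i" by (auto simp: covers_def T.covers_def mem_box_of T.mem_box_of)
  then show ?thesis by blast
qed


text \<open>\<open>H\<close> stands for the points to the right of the chain of bottom supports
  leading down from \<open>i\<close>. The chain is not formed as a set; only two properties are
  kept: below the top of \<open>i\<close> membership is locally constant on the hole, and beside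
  \<open>i\<close> it means lying to the right of \<open>i\<close>. \<open>above_chain\<close> is
  the mirror image.\<close>

definition right_of_chain :: "'i \<Rightarrow> point set \<Rightarrow> bool" where
  "right_of_chain i H \<longleftrightarrow>
     (\<forall>z\<in>U. snd z < t i \<longrightarrow> (\<exists>e>0. \<forall>z'\<in>U. \<bar>fst z' - fst z\<bar> < e \<longrightarrow> \<bar>snd z' - snd z\<bar> < e \<longrightarrow> snd z' < t i \<longrightarrow> (z' \<in> H \<longleftrightarrow> z \<in> H))) \<and>
     (\<forall>z\<in>U. b i \<le> snd z \<longrightarrow> snd z < t i \<longrightarrow> (z \<in> H \<longleftrightarrow> r i < fst z))"

definition above_chain :: "'i \<Rightarrow> point set \<Rightarrow> bool" where
  "above_chain i V \<longleftrightarrow>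
     (\<forall>z\<in>U. fst z < r i \<longrightarrow> (\<exists>e>0. \<forall>z'\<in>U. \<bar>fst z' - fst z\<bar> < e \<longrightarrow> \<bar>snd z' - snd z\<bar> < e \<longrightarrow> fst z' < r i \<longrightarrow> (z' \<in> V \<longleftrightarrow> z \<in> V))) \<and>
     (\<forall>z\<in>U. l i \<le> fst z \<longrightarrow> fst z < r i \<longrightarrow> (z \<in> V \<longleftrightarrow> t i < snd z))"

text \<open>Induction on the number of boxes with a lower bottom side. Below the bottom of
  \<open>i\<close> the set of its support \<open>j\<close> is used, beside \<open>i\<close> the half
  plane right of \<open>i\<close>. They agree at the common level because the contact has positive
  length: a free point there is to the left of both boxes or to the right of both.\<close>

lemma right_of_chain_exists:
  assumes "i \<in> I" shows "\<exists>H. right_of_chain i H"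
  using assms
proof (induction "card {j\<in>I. b j < b i}" arbitrary: i rule: less_induct)
  case less
  show ?case
  proof (cases "\<forall>z\<in>closure U. b i < snd z")
    case True
    have "right_of_chain i {z. r i < fst z}"
      unfolding right_of_chain_def
    proof (intro conjI ballI impI)
      fix z assume z: "z \<in> U" "snd z < t i"
      have "b i < snd z" using True z(1) closure_subset[of U] by blast
      then have "fst z < l i \<or> r i < fst z" using free[OF less.prems z(1)] z(2) by auto
      then show "\<exists>e>0. \<forall>z'\<in>U. \<bar>fst z' - fst z\<bar> < e \<longrightarrow> \<bar>snd z' - snd z\<bar> < e \<longrightarrow> snd z' < t i \<longrightarrow> (z' \<in> {z. r i < fst z}) = (z \<in> {z. r i < fst z})"
      proof
        assume "fst z < l i"
        then show ?thesis using lr[OF less.prems] by (intro exI[of _ "l i - fst z"]) auto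
      next
        assume "r i < fst z"
        then show ?thesis by (intro exI[of _ "fst z - r i"]) auto
      qed
    qed auto
    then show ?thesis by blast
  next
    case False
    then obtain j where j: "j \<in> I" "t j = b i" "l j < r i" "l i < r j"
      using bottom_support[OF less.prems] by blast
    have "card {k\<in>I. b k < b j} < card {k\<in>I. b k < b i}"
      by (rule psubset_card_mono) (use fin j bt[OF j(1)] in auto)
    then obtain H where H: "right_of_chain j H" using less.hyps[of j] j(1) by blast
    have H2: "\<And>z. z \<in> U \<Longrightarrow> b j \<le> snd z \<Longrightarrow> snd z < b i \<Longrightarrow> (z \<in> H \<longleftrightarrow> r j < fst z)"
      using H j(2) by (auto simp: right_of_chain_def)
    let ?H = "{z. if snd z < b i then z \<in> H else r i < fst z}"
    have "right_of_chain i ?H"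
      unfolding right_of_chain_def
    proof (intro conjI ballI impI)
      fix z assume z: "z \<in> U" "snd z < t i"
      show "\<exists>e>0. \<forall>z'\<in>U. \<bar>fst z' - fst z\<bar> < e \<longrightarrow> \<bar>snd z' - snd z\<bar> < e \<longrightarrow> snd z' < t i \<longrightarrow> (z' \<in> ?H) = (z \<in> ?H)"
      proof (cases "snd z < b i")
        case True
        then obtain e where e: "e > 0" "\<And>z'. z' \<in> U \<Longrightarrow> \<bar>fst z' - fst z\<bar> < e \<Longrightarrow> \<bar>snd z' - snd z\<bar> < e \<Longrightarrow> snd z' < b i \<Longrightarrow> (z' \<in> H \<longleftrightarrow> z \<in> H)"
          using H z(1) j(2) unfolding right_of_chain_def by metis
        show ?thesis
        proof (intro exI conjI ballI impI)
          show "0 < min e (b i - snd z)" using e(1) True by simp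
          fix z' assume z': "z' \<in> U" "\<bar>fst z' - fst z\<bar> < min e (b i - snd z)" "\<bar>snd z' - snd z\<bar> < min e (b i - snd z)"
          then have "snd z' < b i" by linarith
          then show "(z' \<in> ?H) = (z \<in> ?H)" using e(2)[OF z'(1)] z'(2,3) True by simp
        qed
      next
        case nb: False
        have sep: "fst z < l i \<or> r i < fst z" using free[OF less.prems z(1)] z(2) nb by auto
        have li: "l i < r i" using lr[OF less.prems] .
        show ?thesis
        proof (cases "b i < snd z")
          case True
          define e where "e = min (snd z - b i) (if fst z < l i then l i - fst z else fst z - r i)"
          have ez: "e > 0" "e \<le> snd z - b i" "fst z < l i \<Longrightarrow> e \<le> l i - fst z" "r i < fst z \<Longrightarrow> e \<le> fst z - r i"
            using sep True li by (auto simp: e_def)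
          show ?thesis
          proof (intro exI conjI ballI impI)
            show "0 < e" by fact
            fix z' assume z': "z' \<in> U" "\<bar>fst z' - fst z\<bar> < e" "\<bar>snd z' - snd z\<bar> < e"
            have "\<not> snd z' < b i" using z' ez(2) by linarith
            moreover have "r i < fst z' \<longleftrightarrow> r i < fst z" using z'(2) ez(3,4) sep li by linarith
            ultimately show "(z' \<in> ?H) = (z \<in> ?H)" using nb by simp
          qed
        next
          case False
          then have eq: "snd z = b i" using nb by auto
          have "fst z < l j \<or> r j < fst z" using free[OF j(1) z(1)] bt[OF j(1)] j(2) eq by auto
          with sep have sep2: "(fst z < l i \<and> fst z < l j) \<or> (r i < fst z \<and> r j < fst z)"
            using j(3,4) by auto
          have lj: "l j < r j" "b j < b i" using lr[OF j(1)] bt[OF j(1)] j(2) by auto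
          define e where "e = min (b i - b j) (if fst z < l i then min (l i - fst z) (l j - fst z) else min (fst z - r i) (fst z - r j))"
          have ez: "e > 0" "e \<le> b i - b j" "fst z < l i \<Longrightarrow> e \<le> l i - fst z \<and> e \<le> l j - fst z"
            "r i < fst z \<Longrightarrow> e \<le> fst z - r i \<and> e \<le> fst z - r j"
            using sep2 li lj by (auto simp: e_def)
          show ?thesis
          proof (intro exI conjI ballI impI)
            show "0 < e" by fact
            fix z' assume z': "z' \<in> U" "\<bar>fst z' - fst z\<bar> < e" "\<bar>snd z' - snd z\<bar> < e"
            have "r i < fst z' \<longleftrightarrow> r i < fst z" "r j < fst z' \<longleftrightarrow> r i < fst z"
              using z'(2) ez(3,4) sep2 li lj by linarith+
            moreover have "snd z' < b i \<Longrightarrow> (z' \<in> H \<longleftrightarrow> r j < fst z')"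
              using H2[OF z'(1)] z'(3) ez(2) eq by linarith
            ultimately show "(z' \<in> ?H) = (z \<in> ?H)" using eq by simp
          qed
        qed
      qed
    qed auto
    then show ?thesis by blast
  qed
qed

lemma above_chain_exists:
  assumes "i \<in> I" shows "\<exists>V. above_chain i V"
proof -
  interpret T: hole I b t l r "prod.swap ` U" by (rule swap_hole)
  obtain H where "T.right_of_chain i H" using T.right_of_chain_exists[OF assms] by blast
  note H = this[unfolded T.right_of_chain_def]
  have "above_chain i (prod.swap -` H)"
    unfolding above_chain_def
  proof (intro conjI ballI impI)
    fix z assume z: "z \<in> U" "fst z < r i"
    then have "prod.swap z \<in> prod.swap ` U" "snd (prod.swap z) < r i" by auto
    with H obtain e where e: "e > 0" "\<And>w. w \<in> prod.swap ` U \<Longrightarrow> \<bar>fst w - snd z\<bar> < e \<Longrightarrow> \<bar>snd w - fst z\<bar> < e \<Longrightarrow> snd w < r i \<Longrightarrow> (w \<in> H \<longleftrightarrow> prod.swap z \<in> H)"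
      by (metis fst_swap snd_swap)
    show "\<exists>e>0. \<forall>z'\<in>U. \<bar>fst z' - fst z\<bar> < e \<longrightarrow> \<bar>snd z' - snd z\<bar> < e \<longrightarrow> fst z' < r i \<longrightarrow> (z' \<in> prod.swap -` H) = (z \<in> prod.swap -` H)"
      using e(1) e(2)[OF imageI] by (intro exI[of _ e]) auto
  next
    fix z assume z: "z \<in> U" "l i \<le> fst z" "fst z < r i"
    then show "(z \<in> prod.swap -` H) = (t i < snd z)"
      using bspec[OF conjunct2[OF H], of "prod.swap z"] by auto
  qed
  then show ?thesis by blast
qed

text \<open>The region left of \<open>X0\<close>, below \<open>Y0\<close>, right of the chain under
  \<open>X\<close> and above the chain left of \<open>Z\<close> is open and closed in
  \<open>U\<close>. Points of \<open>U\<close> on its upper edge are not right of \<open>X\<close>,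
  and those on its right edge are not above \<open>Z\<close>, so points just inside these edges fail
  a chain condition.\<close>

lemma barrier:
  assumes X: "X \<in> I" "b X < Y0" "Y0 \<le> t X" and Z: "Z \<in> I" "l Z < X0" "X0 \<le> r Z"
    and H: "right_of_chain X H" and V: "above_chain Z V"
    and top: "\<And>z. z \<in> U \<Longrightarrow> snd z = Y0 \<Longrightarrow> fst z \<le> X0 \<Longrightarrow> fst z < r X"
    and right: "\<And>z. z \<in> U \<Longrightarrow> fst z = X0 \<Longrightarrow> snd z \<le> Y0 \<Longrightarrow> snd z < t Z"
    and z0: "z0 \<in> U" "fst z0 < X0" "snd z0 < Y0" "z0 \<in> H" "z0 \<in> V"
  shows "\<forall>z\<in>U. fst z < X0 \<and> snd z < Y0"
proof
  fix w assume w: "w \<in> U"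
  let ?G = "\<lambda>z. fst z < X0 \<and> snd z < Y0 \<and> z \<in> H \<and> z \<in> V"
  have "?G w"
  proof (rule connected_locally_constant[OF conU _ z0(1) _ w])
    show "?G z0" using z0 by auto
    fix z assume z: "z \<in> U"
    consider "Y0 < snd z \<or> X0 < fst z" | "snd z < Y0" "fst z < X0" | "snd z = Y0" "fst z \<le> X0" | "snd z < Y0" "fst z = X0"
      by linarith
    then show "\<exists>e>0. \<forall>z'\<in>U. \<bar>fst z' - fst z\<bar> < e \<and> \<bar>snd z' - snd z\<bar> < e \<longrightarrow> ?G z' = ?G z"
    proof cases
      case 1
      define e where "e = (if Y0 < snd z then snd z - Y0 else fst z - X0)"
      have e: "e > 0" "Y0 < snd z \<and> e = snd z - Y0 \<or> X0 < fst z \<and> e = fst z - X0" using 1 by (auto simp: e_def)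
      have "\<not> ?G z'" if "\<bar>fst z' - fst z\<bar> < e" "\<bar>snd z' - snd z\<bar> < e" for z'
        using that e(2) by linarith
      moreover have "\<not> ?G z" using 1 by linarith
      ultimately show ?thesis using e(1) by blast
    next
      case 2
      obtain e1 where e1: "e1 > 0" "\<And>z'. z' \<in> U \<Longrightarrow> \<bar>fst z' - fst z\<bar> < e1 \<Longrightarrow> \<bar>snd z' - snd z\<bar> < e1 \<Longrightarrow> snd z' < t X \<Longrightarrow> (z' \<in> H \<longleftrightarrow> z \<in> H)"
        using bspec[OF conjunct1[OF H[unfolded right_of_chain_def]] z] less_le_trans[OF 2(1) X(3)] by blast
      obtain e2 where e2: "e2 > 0" "\<And>z'. z' \<in> U \<Longrightarrow> \<bar>fst z' - fst z\<bar> < e2 \<Longrightarrow> \<bar>snd z' - snd z\<bar> < e2 \<Longrightarrow> fst z' < r Z \<Longrightarrow> (z' \<in> V \<longleftrightarrow> z \<in> V)"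
        using bspec[OF conjunct1[OF V[unfolded above_chain_def]] z] less_le_trans[OF 2(2) Z(3)] by blast
      show ?thesis
      proof (intro exI conjI ballI impI)
        show "0 < min (min e1 e2) (min (Y0 - snd z) (X0 - fst z))" using e1(1) e2(1) 2 by simp
        fix z' assume z': "z' \<in> U" "\<bar>fst z' - fst z\<bar> < min (min e1 e2) (min (Y0 - snd z) (X0 - fst z)) \<and> \<bar>snd z' - snd z\<bar> < min (min e1 e2) (min (Y0 - snd z) (X0 - fst z))"
        then have "fst z' < X0" "snd z' < Y0" by linarith+
        then show "?G z' = ?G z" using e1(2)[OF z'(1)] e2(2)[OF z'(1)] z'(2) 2 X Z by auto
      qed
    next
      \<comment> \<open>Just under the upper edge a point is beside \<open>X\<close>, where
        membership in \<open>H\<close> would put it to the right of \<open>X\<close>.\<close>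
      case 3
      have x: "fst z < r X" using top[OF z 3] .
      have "\<not> ?G z'" if "z' \<in> U" "\<bar>fst z' - fst z\<bar> < r X - fst z" "\<bar>snd z' - snd z\<bar> < Y0 - b X" for z'
      proof
        assume G: "?G z'"
        have "b X \<le> snd z'" "snd z' < t X" using that(3) 3(1) G X(3) by linarith+
        then have "r X < fst z'" using conjunct2[OF H[unfolded right_of_chain_def]] that(1) G by blast
        then show False using that(2) by linarith
      qed
      moreover have "\<not> ?G z" using 3(1) by simp
      ultimately show ?thesis using x X(2) by (intro exI[of _ "min (r X - fst z) (Y0 - b X)"]) auto
    next
      case 4
      have y: "snd z < t Z" using right[OF z] 4 by auto
      have "\<not> ?G z'" if "z' \<in> U" "\<bar>snd z' - snd z\<bar> < t Z - snd z" "\<bar>fst z' - fst z\<bar> < X0 - l Z" for z'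
      proof
        assume G: "?G z'"
        have "l Z \<le> fst z'" "fst z' < r Z" using that(3) 4(2) G Z(3) by linarith+
        then have "t Z < snd z'" using conjunct2[OF V[unfolded above_chain_def]] that(1) G by blast
        then show False using that(2) by linarith
      qed
      moreover have "\<not> ?G z" using 4(2) by simp
      ultimately show ?thesis using y Z(2) by (intro exI[of _ "min (t Z - snd z) (X0 - l Z)"]) auto
    qed
  qed
  then show "fst w < X0 \<and> snd w < Y0" by blast
qed

lemma barrier_at_corner:
  assumes X: "X \<in> I" "t X = Y0" "r X < X0" and Z: "Z \<in> I" "l Z < X0" "X0 \<le> r Z" "t Z < Y0"
    and sw: "sector U False False (X0, Y0)"
    and top: "\<And>z. z \<in> U \<Longrightarrow> snd z = Y0 \<Longrightarrow> fst z \<le> X0 \<Longrightarrow> fst z < r X"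
    and right: "\<And>z. z \<in> U \<Longrightarrow> fst z = X0 \<Longrightarrow> snd z \<le> Y0 \<Longrightarrow> snd z < t Z"
  shows "\<forall>z\<in>U. fst z < X0 \<and> snd z < Y0"
proof -
  obtain H where H: "right_of_chain X H" using right_of_chain_exists[OF X(1)] by blast
  obtain V where V: "above_chain Z V" using above_chain_exists[OF Z(1)] by blast
  obtain e where e: "e > 0" "{X0 - e<..<X0} \<times> {Y0 - e<..<Y0} \<subseteq> U"
    using sw by (auto simp: sector_def side_def)
  \<comment> \<open>Small enough for the starting point to lie beside \<open>X\<close> on its right
    and over \<open>Z\<close>.\<close>
  define d where "d = min (min (e/2) ((X0 - r X)/2)) (min ((X0 - l Z)/2) (min ((Y0 - t Z)/2) ((Y0 - b X)/2)))"
  have d: "0 < d" "d < e" "d < X0 - r X" "d < X0 - l Z" "d < Y0 - t Z" "d < Y0 - b X"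
    using e(1) X Z bt[OF X(1)] unfolding d_def by (auto simp: min_def)
  have z0: "(X0 - d, Y0 - d) \<in> U" using e(2) d by auto
  have "(X0 - d, Y0 - d) \<in> H" using H z0 d X unfolding right_of_chain_def by force
  moreover have "(X0 - d, Y0 - d) \<in> V" using V z0 d Z unfolding above_chain_def by force
  ultimately show ?thesis
    using barrier[of X Y0 Z X0 H V "(X0 - d, Y0 - d)"] X Z bt[OF X(1)] H V top right z0 d by auto
qed


section \<open>Upper right corners of the hole and the pockets behind them\<close>

lemma covers_iff:
  "covers sx sy p i \<longleftrightarrow> i \<in> I \<and> l i \<le> fst p \<and> fst p \<le> r i \<and> b i \<le> snd p \<and> snd p \<le> t i \<and>
     (if sx then fst p < r i else l i < fst p) \<and> (if sy then snd p < t i else b i < snd p)"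
  by (simp add: covers_def mem_box_of conj_assoc)

lemma left_supportE:
  assumes "i \<in> I" "z \<in> closure U" "fst z \<le> l i"
  obtains j where "j \<in> I" "r j = l i" "b j < t i" "b i < t j"
proof -
  have "\<not> (\<forall>z\<in>closure U. l i < fst z)" using bspec[OF _ assms(2)] assms(3) not_le by blast
  then show ?thesis using left_support[OF assms(1)] that by blast
qed

lemma bottom_supportE:
  assumes "i \<in> I" "z \<in> closure U" "snd z \<le> b i"
  obtains j where "j \<in> I" "t j = b i" "l j < r i" "l i < r j"
proof -
  have "\<not> (\<forall>z\<in>closure U. b i < snd z)" using bspec[OF _ assms(2)] assms(3) not_le by blast
  then show ?thesis using bottom_support[OF assms(1)] that by blast
qed

lemma rectangle_sectorI:
  assumes "{x1<..<x2} \<times> {y1<..<y2} \<subseteq> U"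
  shows "x1 < x2 \<Longrightarrow> y1 < y2 \<Longrightarrow> sector U False False (x2, y2)"
    "x1 < x2 \<Longrightarrow> y1 < y2 \<Longrightarrow> sector U False True (x2, y1)"
proof -
  show "sector U False False (x2, y2)" if "x1 < x2" "y1 < y2"
    unfolding sector_def side_def using that assms
    by (intro exI[of _ "min (x2 - x1) (y2 - y1)"]) fastforce
  show "sector U False True (x2, y1)" if "x1 < x2" "y1 < y2"
    unfolding sector_def side_def using that assms
    by (intro exI[of _ "min (x2 - x1) (y2 - y1)"]) fastforce
qed

lemma sector_meets:
  assumes "sector U sx sy p" "e > 0"
  obtains x y where "(x, y) \<in> U" "x \<in> side sx (fst p) e" "y \<in> side sy (snd p) e"
proof -
  obtain d where d: "d > 0" "side sx (fst p) d \<times> side sy (snd p) d \<subseteq> U" using assms by (auto simp: sector_def)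
  define c where "c = min d e / 2"
  have c: "0 < c" "c < d" "c < e" using d(1) assms(2) by (auto simp: c_def min_def)
  let ?x = "if sx then fst p + c else fst p - c" and ?y = "if sy then snd p + c else snd p - c"
  have "?x \<in> side sx (fst p) d" "?y \<in> side sy (snd p) d" "?x \<in> side sx (fst p) e" "?y \<in> side sy (snd p) e"
    using c by (auto simp: side_def)
  then show ?thesis using that[of ?x ?y] d(2) by blast
qed

text \<open>\<open>K\<close> is the lowest left support of \<open>Q\<close>. The hole runs down along the left side of \<open>Q\<close>
  to its lower left corner; either it ends there, or it continues below \<open>Q\<close>.\<close>

lemma left_pocket:
  assumes K: "K \<in> I" and Q: "Q \<in> I" and KQ: "r K = l Q" "b Q < b K" "b K < t Q"
    and sw: "sector U False False (l Q, b K)"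
    and lowest: "\<And>j. j \<in> I \<Longrightarrow> r j = l Q \<Longrightarrow> b j < b K \<Longrightarrow> t j \<le> b Q"
  shows "(\<forall>z\<in>U. fst z < l Q \<and> snd z < b K) \<or> (\<exists>Y. notch K Q Y)"
proof -
  let ?p = "(l Q, b K)" and ?c = "(l Q, b Q)"
  have lrQ: "l Q < r Q" and btQ: "b Q < t Q" and lrK: "l K < l Q" and btK: "b K < t K"
    using lr[OF Q] bt[OF Q] lr[OF K] bt[OF K] KQ by auto
  have pcl: "?p \<in> closure U" using sector_closure[OF sw] .
  \<comment> \<open>\<open>X\<close> starts the vertical chain. It ends left of \<open>Q\<close>, as
    otherwise it would fill the free quadrant under \<open>K\<close>.\<close>
  obtain X where X: "X \<in> I" "t X = b K" "l X < r K" "l K < r X"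
    using bottom_supportE[OF K pcl] by auto
  have rX: "r X < l Q"
    using sector_not_covered[OF sw, of X] X KQ(1) bt[OF X(1)] by (auto simp: covers_iff)
  have top: "fst z < r X" if "z \<in> U" "snd z = b K" "fst z \<le> l Q" for z
    using free[OF K that(1)] that X(4) KQ btK by (cases "fst z < r X") auto
  obtain e where e: "e > 0" and gap: "gap e (l Q) (b Q)"
    using gap_exists by blast
  \<comment> \<open>A box within the gap width left of \<open>Q\<close> and below \<open>K\<close>
    reaches the line of the left side of \<open>Q\<close>; since \<open>K\<close> is the lowest left
    support, it lies no higher than the bottom of \<open>Q\<close>.\<close>
  have beside: "t j \<le> b Q \<and> l j < l Q \<and> l Q \<le> r j" if "j \<in> I" "l j < l Q" "l Q - e < r j" "b j < b K" for j
  proof -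
    have rj: "l Q \<le> r j" using gapD[OF gap that(1)] that(3) by linarith
    have "t j \<le> b Q"
    proof (cases "r j = l Q")
      case True then show ?thesis using lowest that by blast
    next
      case False
      then show ?thesis using disj[OF that(1) Q] that(2,4) rj KQ lrQ by force
    qed
    then show ?thesis using that rj by auto
  qed
  have R1: "{l Q - e<..<l Q} \<times> {b Q<..<b K} \<subseteq> U"
  proof -
    obtain x y where xy: "(x, y) \<in> U" "x \<in> side False (l Q) (min e (b K - b Q))" "y \<in> side False (b K) (min e (b K - b Q))"
      using sector_meets[OF sw, of "min e (b K - b Q)"] e KQ(2) by auto
    show ?thesis
      by (rule rectangle_subset_U[OF xy(1)]) (use xy beside in \<open>force simp: side_def\<close>)+
  qed
  then have nw: "sector U False True ?c" using rectangle_sectorI(2)[of "l Q - e" "l Q" "b Q" "b K"] e KQ(2) by auto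
  have ccl: "?c \<in> closure U" using sector_closure[OF nw] .
  show ?thesis
  proof (cases "sector U False False ?c")
    \<comment> \<open>The hole ends at the corner: a box \<open>Z\<close> whose top is level with
      the bottom of \<open>Q\<close> starts the horizontal chain.\<close>
    case False
    then obtain Z where Z: "covers False False ?c Z"
      using sector_or_covers_vertical[of False True ?c] nw by auto
    then have "\<not> covers False True ?c Z" using sector_not_covered[OF nw] by blast
    with Z have Z2: "Z \<in> I" "t Z = b Q" "l Z < l Q" "l Q \<le> r Z" by (auto simp: covers_iff)
    have "\<forall>z\<in>U. fst z < l Q \<and> snd z < b K"
    proof (rule barrier_at_corner[of X "b K" "l Q" Z])
      fix z assume "z \<in> U" "fst z = l Q" "snd z \<le> b K"
      then show "snd z < t Z" using free[OF Q, of z] Z2 KQ lrQ by (cases "snd z < b Q") auto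
    qed (use X rX Z2 KQ sw top in auto)
    then show ?thesis by blast
  next
    case swc: True
    have beside': "t j < b Q" if "j \<in> I" "l j < l Q" "l Q - e < r j" "b j < b K" for j
    proof -
      have "t j \<noteq> b Q" using sector_not_covered[OF swc, of j] beside[OF that] that bt[OF that(1)] by (auto simp: covers_iff)
      then show ?thesis using beside[OF that] by auto
    qed
    show ?thesis
    proof (cases "sector U True False ?c")
      \<comment> \<open>Below \<open>Q\<close> lies a box \<open>Y\<close> flush with its left side.
        The left support of \<open>Y\<close> ends lower than \<open>Q\<close> and starts the
        horizontal chain.\<close>
      case False
      then obtain Y where "covers True False ?c Y"
        using sector_or_covers_horizontal[of False False ?c] swc by auto
      moreover then have "\<not> covers False False ?c Y" using sector_not_covered[OF swc] by blast
      ultimately have Y: "Y \<in> I" "l Y = l Q" "b Y < b Q" "b Q \<le> t Y" "l Q < r Y" by (auto simp: covers_iff)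
      have tY: "t Y = b Q" using disj[OF Y(1) Q] Y lrQ btQ by force
      obtain Z where Z: "Z \<in> I" "r Z = l Q" "b Z < b Q" "b Y < t Z"
        using left_supportE[OF Y(1) ccl] Y tY by auto
      have tZ: "t Z < b Q"
        using sector_not_covered[OF swc, of Z] Z lr[OF Z(1)] by (auto simp: covers_iff)
      have "\<forall>z\<in>U. fst z < l Q \<and> snd z < b K"
      proof (rule barrier_at_corner[of X "b K" "l Q" Z])
        fix z assume "z \<in> U" "fst z = l Q" "snd z \<le> b K"
        then show "snd z < t Z" using free[OF Q, of z] free[OF Y(1), of z] Y tY Z KQ lrQ lr[OF Y(1)]
          by (cases "snd z < t Z") auto
      qed (use X rX Z lr[OF Z(1)] tZ KQ sw top in auto)
      then show ?thesis by blast
    next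
      \<comment> \<open>The hole continues under \<open>Q\<close> up to the leftmost bottom support
        \<open>Y\<close>. The barrier is placed at \<open>l Y\<close> and \<open>b K\<close>, so as
        to enclose both corners of the notch.\<close>
      case se: True
      let ?B = "{j\<in>I. t j = b Q \<and> l j < r Q \<and> l Q < r j}"
      obtain Y0 where "Y0 \<in> ?B" using bottom_supportE[OF Q ccl] by auto
      then have "finite ?B" "?B \<noteq> {}" using fin by auto
      then obtain Y where "is_arg_min l (\<lambda>j. j \<in> ?B) Y" using ex_is_arg_min_if_finite by blast
      then have "Y \<in> ?B" "\<And>j. j \<in> ?B \<Longrightarrow> l Y \<le> l j" unfolding is_arg_min_linorder by blast+
      then have Y: "Y \<in> I" "t Y = b Q" "l Y < r Q" "l Q < r Y"
        and Ymin: "\<And>j. j \<in> I \<Longrightarrow> t j = b Q \<Longrightarrow> l j < r Q \<Longrightarrow> l Q < r j \<Longrightarrow> l Y \<le> l j" by auto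
      have lY: "l Q < l Y" using sector_not_covered[OF se, of Y] Y bt[OF Y(1)] by (auto simp: covers_iff)
      have bY: "b Y < b Q" "l Y < r Y" using bt[OF Y(1)] Y(2) lr[OF Y(1)] by auto
      have below: "t j < b Q" if "j \<in> I" "l j < l Y" "l Q - e < r j" "b j < b Q" for j
      proof (cases "l j < l Q")
        case True then show ?thesis using beside'[OF that(1)] that KQ by auto
      next
        case False
        then have "l Q < r j" using lr[OF that(1)] by auto
        moreover have "t j \<le> b Q"
          using disj[OF that(1) Q] that(2,4) calculation Y(3) btQ by force
        ultimately show ?thesis using Ymin[OF that(1)] that(2) Y(3) by force
      qed
      have gapt: "\<not> b Q - e < t j" if "j \<in> I" "t j < b Q" for j using gapD[OF gap that(1)] that(2) by linarith
      obtain x y where xy: "(x, y) \<in> U" "x \<in> side False (l Q) e" "y \<in> side False (b Q) e"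
        using sector_meets[OF swc e] by auto
      let ?R = "{l Q - e<..<l Q} \<times> {b Q - e<..<b K}" and ?S = "{l Q - e<..<l Y} \<times> {b Q - e<..<b Q}"
      have R: "?R \<subseteq> U"
        by (rule rectangle_subset_U[OF xy(1)]) (use xy beside' gapt KQ in \<open>auto simp: side_def\<close>)
      have S: "?S \<subseteq> U"
        by (rule rectangle_subset_U[OF xy(1)]) (use xy below gapt lY in \<open>auto simp: side_def\<close>)
      have swY: "sector U False False (l Y, b Q)" using rectangle_sectorI(1)[OF S] e lY by auto
      obtain Z where Z: "Z \<in> I" "r Z = l Y" "b Z < b Q" "b Y < t Z"
        using left_supportE[OF Y(1) sector_closure[OF swY]] Y(2) by auto
      have lrZ: "l Z < r Z" using lr[OF Z(1)] .
      have tZ: "t Z < b Q"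
        using sector_not_covered[OF swY, of Z] Z lrZ by (auto simp: covers_iff)
      obtain H where H: "right_of_chain X H" using right_of_chain_exists[OF X(1)] by blast
      obtain V where V: "above_chain Z V" using above_chain_exists[OF Z(1)] by blast
      define a where "a = min e (min (b K - b X) (l Q - r X)) / 2"
      have a: "0 < a" "a < e" "a < b K - b X" "a < l Q - r X"
        using e rX bt[OF X(1)] X(2) by (auto simp: a_def min_def)
      define y0 where "y0 = max (b K - a) (b Q)"
      have y0: "b Q \<le> y0" "y0 < b K" "b X \<le> y0" "y0 < t X" using a KQ(2) X(2) by (auto simp: y0_def)
      let ?z0 = "(l Q - a, y0)"
      have z0R: "?z0 \<in> ?R" using a y0 e by auto
      define c where "c = min e (min (l Y - l Z) (b Q - t Z)) / 2"
      have c: "0 < c" "c < e" "c < l Y - l Z" "c < b Q - t Z"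
        using e lrZ Z(2) tZ by (auto simp: c_def min_def)
      let ?z1 = "(l Y - c, b Q - c)"
      have z1S: "?z1 \<in> ?S" using c lY by auto
      have z1V: "?z1 \<in> V"
        using conjunct2[OF V[unfolded above_chain_def]] S z1S c Z(2) by force
      \<comment> \<open>Lying above the chain of \<open>Z\<close> is known near the corner at
        \<open>Y\<close>; it is carried to the corner at \<open>K\<close> through the bent corridor
        around the lower left corner of \<open>Q\<close>.\<close>
      have z0V: "?z0 \<in> V"
      proof (rule connected_locally_constant[where S = "?R \<union> ?S" and ?z0.0 = ?z1 and z = ?z0 and G = "\<lambda>z. z \<in> V"])
        have "(l Q - e/2, b Q - e/2) \<in> ?R \<inter> ?S" using e KQ(2) lY by auto
        then have "?R \<inter> ?S \<noteq> {}" by blast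
        then show "connected (?R \<union> ?S)"
          by (rule connected_Un[rotated 2]) (intro connected_Times connected_Ioo)+
        fix z assume z: "z \<in> ?R \<union> ?S"
        then have "z \<in> U" "fst z < r Z" using R S lY Z(2) by auto
        then obtain d where d: "d > 0" "\<And>z'. z' \<in> U \<Longrightarrow> \<bar>fst z' - fst z\<bar> < d \<Longrightarrow> \<bar>snd z' - snd z\<bar> < d \<Longrightarrow> fst z' < r Z \<Longrightarrow> (z' \<in> V \<longleftrightarrow> z \<in> V)"
          using bspec[OF conjunct1[OF V[unfolded above_chain_def]]] by blast
        have "\<And>z'. z' \<in> ?R \<union> ?S \<Longrightarrow> z' \<in> U \<and> fst z' < r Z" using R S lY Z(2) by auto
        with d show "\<exists>e>0. \<forall>z'\<in>?R \<union> ?S. \<bar>fst z' - fst z\<bar> < e \<and> \<bar>snd z' - snd z\<bar> < e \<longrightarrow> (z' \<in> V) = (z \<in> V)"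
          by blast
      qed (use z1S z1V z0R in auto)
      have z0H: "?z0 \<in> H"
        using conjunct2[OF H[unfolded right_of_chain_def]] R z0R a y0 by force
      have "\<forall>z\<in>U. fst z < l Y \<and> snd z < b K"
      proof (rule barrier[OF X(1) _ _ Z(1) _ _ H V])
        show "?z0 \<in> U" using R z0R by blast
        fix z assume z: "z \<in> U"
        show "fst z < r X" if "snd z = b K" "fst z \<le> l Y"
        proof (rule ccontr)
          assume n: "\<not> fst z < r X"
          then have "l Q < fst z" using free[OF K z] that(1) X(4) KQ btK by auto
          then show False using free[OF Q z] that Y(3) KQ by auto
        qed
        show "snd z < t Z" if "fst z = l Y" "snd z \<le> b K"
        proof (rule ccontr)
          assume n: "\<not> snd z < t Z"
          then have "b Q < snd z" using free[OF Y(1) z] that(1) Z(4) Y(2) bY by auto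
          then show False using free[OF Q z] that lY Y(3) KQ by auto
        qed
      qed (use X bt[OF X(1)] Z lrZ z0V z0H y0 a lY in auto)
      then have "notch K Q Y"
        using K Q Y KQ lY swY sw swc se nw lowest Ymin by (force simp: notch_def)
      then show ?thesis by blast
    qed
  qed
qed

text \<open>The shape is symmetric under exchanging the coordinates, with \<open>K\<close> and
  \<open>Y\<close> trading places.\<close>

lemma notch_swap: "hole.notch I b t l r (prod.swap ` U) Y Q K \<Longrightarrow> notch K Q Y"
proof -
  interpret T: hole I b t l r "prod.swap ` U" by (rule swap_hole)
  assume "T.notch Y Q K"
  then show "notch K Q Y" by (auto simp: T.notch_def notch_def sector_swap)
qed

lemma bottom_pocket:
  assumes Y: "Y \<in> I" and Q: "Q \<in> I" and YQ: "t Y = b Q" "l Q < l Y" "l Y < r Q"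
    and sw: "sector U False False (l Y, b Q)"
    and leftmost: "\<And>j. j \<in> I \<Longrightarrow> t j = b Q \<Longrightarrow> l j < l Y \<Longrightarrow> r j \<le> l Q"
  shows "(\<forall>z\<in>U. fst z < l Y \<and> snd z < b Q) \<or> (\<exists>K. notch K Q Y)"
proof -
  interpret T: hole I b t l r "prod.swap ` U" by (rule swap_hole)
  have "(\<forall>z\<in>prod.swap ` U. fst z < b Q \<and> snd z < l Y) \<or> (\<exists>K. T.notch Y Q K)"
    by (rule T.left_pocket[OF Y Q YQ]) (use sw leftmost in \<open>auto simp: sector_swap\<close>)
  then show ?thesis using notch_swap by fastforce
qed

text \<open>If \<open>T\<close> has a bottom support ending left of \<open>p\<close> and
  \<open>E\<close> a left support ending below \<open>p\<close>, these start the two chains.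
  Otherwise one of the two boxes has all its supports on that side beyond \<open>p\<close>. It then
  extends past \<open>p\<close> while the other box ends flush at its side, and
  \<open>left_pocket\<close> or \<open>bottom_pocket\<close> applies.\<close>

lemma corner:
  assumes sw: "sector U False False p" and T: "covers False True p T" and E: "covers True False p E"
  shows "(\<forall>z\<in>U. fst z < fst p \<and> snd z < snd p) \<or>
    (\<exists>K Q Y. notch K Q Y \<and> (p = (l Q, b K) \<or> p = (l Y, b Q)))"
proof -
  obtain px py where p: "p = (px, py)" by (cases p)
  note nc = sector_not_covered[OF sw, unfolded p covers_iff]
  have T': "T \<in> I" "l T < px" "px \<le> r T" "b T = py" "py < t T"
    using T nc[of T] by (auto simp: covers_iff p)
  have E': "E \<in> I" "b E < py" "py \<le> t E" "l E = px" "px < r E"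
    using E nc[of E] by (auto simp: covers_iff p)
  have pcl: "p \<in> closure U" using sector_closure[OF sw] .
  have bsupp: "px \<le> l X \<or> r X < px" if "X \<in> I" "t X = py" for X
    using nc[of X] that bt[OF that(1)] by auto
  have lsupp: "py \<le> b Z \<or> t Z < py" if "Z \<in> I" "r Z = px" for Z
    using nc[of Z] that lr[OF that(1)] by auto
  consider (anchored) X Z where "X \<in> I" "t X = py" "l X < r T" "l T < r X" "r X < px"
      "Z \<in> I" "r Z = px" "b Z < t E" "b E < t Z" "t Z < py"
    | (bot) "\<And>X. X \<in> I \<Longrightarrow> t X = py \<Longrightarrow> l X < r T \<Longrightarrow> l T < r X \<Longrightarrow> px \<le> l X"
    | (lft) "\<And>Z. Z \<in> I \<Longrightarrow> r Z = px \<Longrightarrow> b Z < t E \<Longrightarrow> b E < t Z \<Longrightarrow> py \<le> b Z"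
    using bsupp lsupp by blast
  then show ?thesis
  proof cases
    case (anchored X Z)
    have "\<forall>z\<in>U. fst z < px \<and> snd z < py"
    proof (rule barrier_at_corner[of X py px Z])
      fix z assume z: "z \<in> U"
      show "fst z < r X" if "snd z = py" "fst z \<le> px"
        using free[OF T'(1) z] that T' anchored by (cases "fst z < r X") auto
      show "snd z < t Z" if "fst z = px" "snd z \<le> py"
        using free[OF E'(1) z] that E' anchored by (cases "snd z < t Z") auto
    qed (use anchored sw p lr[of Z] in auto)
    then show ?thesis using p by auto
  next
    case lft
    obtain Z where Z: "Z \<in> I" "r Z = px" "b Z < t E" "b E < t Z"
      using left_supportE[OF E'(1) pcl] E' p by auto
    have tE: "py < t E" using lft[OF Z] Z by auto
    have rT: "r T = px" using disj[OF T'(1) E'(1)] T' E' tE by force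
    have "(\<forall>z\<in>U. fst z < l E \<and> snd z < b T) \<or> (\<exists>Y. notch T E Y)"
    proof (rule left_pocket[OF T'(1) E'(1)])
      fix j assume "j \<in> I" "r j = l E" "b j < b T"
      then show "t j \<le> b E" using lft[of j] E' T' tE by force
    qed (use T' E' tE rT sw p in auto)
    then show ?thesis using p T' E' by auto
  next
    case bot
    obtain X where X: "X \<in> I" "t X = py" "l X < r T" "l T < r X"
      using bottom_supportE[OF T'(1) pcl] T' p by auto
    have rT: "px < r T" using bot[OF X] X by auto
    have tE: "t E = py" using disj[OF T'(1) E'(1)] T' E' rT by force
    have "(\<forall>z\<in>U. fst z < l E \<and> snd z < b T) \<or> (\<exists>K. notch K T E)"
    proof (rule bottom_pocket[OF E'(1) T'(1)])
      fix j assume "j \<in> I" "t j = b T" "l j < l E"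
      then show "r j \<le> l T" using bot[of j] E' T' rT by force
    qed (use T' E' tE rT sw p in auto)
    then show ?thesis using p T' E' by auto
  qed
qed

text \<open>Turns an exposed lower left corner of a box into an upper right corner of the hole:
  going up along the left side of \<open>Q\<close>, the hole is stopped by the lowest left
  support.\<close>

lemma left_exposed_corner:
  assumes Q: "Q \<in> I" and nw: "sector U False True (l Q, b Q)"
  obtains K where "K \<in> I" "r K = l Q" "b Q < b K" "b K < t Q" "sector U False False (l Q, b K)"
    "(\<forall>z\<in>U. fst z < l Q \<and> snd z < b K) \<or> (\<exists>Y. notch K Q Y)"
proof -
  let ?c = "(l Q, b Q)"
  have ccl: "?c \<in> closure U" using sector_closure[OF nw] .
  let ?B = "{j\<in>I. r j = l Q \<and> b j < t Q \<and> b Q < t j}"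
  obtain K0 where "K0 \<in> ?B" using left_supportE[OF Q ccl] by auto
  then have "finite ?B" "?B \<noteq> {}" using fin by auto
  then obtain K where "is_arg_min b (\<lambda>j. j \<in> ?B) K" using ex_is_arg_min_if_finite by blast
  then have "K \<in> ?B" "\<And>j. j \<in> ?B \<Longrightarrow> b K \<le> b j" unfolding is_arg_min_linorder by blast+
  then have K: "K \<in> I" "r K = l Q" "b K < t Q" "b Q < t K"
    and Kmin: "\<And>j. j \<in> I \<Longrightarrow> r j = l Q \<Longrightarrow> b j < t Q \<Longrightarrow> b Q < t j \<Longrightarrow> b K \<le> b j" by auto
  have bK: "b Q < b K" using sector_not_covered[OF nw, of K] K lr[OF K(1)] by (auto simp: covers_iff)
  obtain e where e: "e > 0" and gap: "gap e (l Q) (b Q)"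
    using gap_exists by blast
  obtain x y where xy: "(x, y) \<in> U" "x \<in> side False (l Q) (min e (b K - b Q))" "y \<in> side True (b Q) (min e (b K - b Q))"
    using sector_meets[OF nw, of "min e (b K - b Q)"] e bK by auto
  have "{l Q - e<..<l Q} \<times> {b Q<..<b K} \<subseteq> U"
  proof (rule rectangle_subset_U[OF xy(1)])
    fix j assume j: "j \<in> I" "l j < l Q" "l Q - e < r j" "b j < b K" "b Q < t j"
    have rj: "l Q \<le> r j" using gapD[OF gap j(1)] j(3) by linarith
    show False
    proof (cases "r j = l Q")
      case True then show ?thesis using Kmin[of j] j K by auto
    next
      case False then show ?thesis using disj[OF j(1) Q] j rj K lr[OF Q] by force
    qed
  qed (use xy in \<open>auto simp: side_def\<close>)
  then have sw: "sector U False False (l Q, b K)" using rectangle_sectorI(1) e bK by force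
  have "(\<forall>z\<in>U. fst z < l Q \<and> snd z < b K) \<or> (\<exists>Y. notch K Q Y)"
    by (rule left_pocket[OF K(1) Q K(2) bK K(3) sw]) (use Kmin K in force)
  then show ?thesis using that K bK sw by blast
qed

lemma bottom_exposed_corner:
  assumes Q: "Q \<in> I" and se: "sector U True False (l Q, b Q)"
  obtains Y where "Y \<in> I" "t Y = b Q" "l Q < l Y" "l Y < r Q" "sector U False False (l Y, b Q)"
    "(\<forall>z\<in>U. fst z < l Y \<and> snd z < b Q) \<or> (\<exists>K. notch K Q Y)"
proof -
  interpret T: hole I b t l r "prod.swap ` U" by (rule swap_hole)
  obtain Y where Y: "Y \<in> I" "t Y = b Q" "l Q < l Y" "l Y < r Q" "sector (prod.swap ` U) False False (b Q, l Y)"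
    "(\<forall>z\<in>prod.swap ` U. fst z < b Q \<and> snd z < l Y) \<or> (\<exists>K. T.notch Y Q K)"
    using T.left_exposed_corner[OF Q] se by (auto simp: sector_swap)
  show ?thesis using that[OF Y(1-4)] Y(5,6) notch_swap by (fastforce simp: sector_swap)
qed

text \<open>A point of the closure that maximizes the sum of the coordinates has only its lower left
  quadrant free.\<close>

lemma upper_right_corner_exists:
  obtains p T E where "sector U False False p" "covers False True p T" "covers True False p E"
proof -
  have "compact (closure U)" using bdU by (simp add: compact_closure)
  moreover have "continuous_on (closure U) (\<lambda>z. fst z + snd z)" by (intro continuous_intros)
  ultimately obtain p where p: "p \<in> closure U" "\<And>z. z \<in> closure U \<Longrightarrow> fst z + snd z \<le> fst p + snd p"
    using continuous_attains_sup[of "closure U" "\<lambda>z. fst z + snd z"] neU by auto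
  have only: "\<not> sx \<and> \<not> sy" if s: "sector U sx sy p" for sx sy
  proof (rule ccontr)
    assume n: "\<not> (\<not> sx \<and> \<not> sy)"
    obtain d where d: "d > 0" "side sx (fst p) d \<times> side sy (snd p) d \<subseteq> U" using s by (auto simp: sector_def)
    \<comment> \<open>The unequal steps make the sum grow in the two mixed quadrants as
      well.\<close>
    let ?x = "if sx then fst p + d/2 else fst p - d/4" and ?y = "if sy then snd p + d/2 else snd p - d/4"
    have "?x \<in> side sx (fst p) d" "?y \<in> side sy (snd p) d" using d by (auto simp: side_def)
    then have "(?x, ?y) \<in> closure U" using d closure_subset[of U] by blast
    from p(2)[OF this] show False using n d(1) by (auto split: if_splits)
  qed
  then have sw: "sector U False False p" using sector_exists[OF p(1)] by (metis (full_types))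
  obtain T where "covers False True p T" using sector_or_covers_vertical[OF sw] only by auto
  moreover obtain E where "covers True False p E" using sector_or_covers_horizontal[OF sw] only by auto
  ultimately show ?thesis using that sw by blast
qed

end

section \<open>Orientation of the boundary circuit\<close>

text \<open>The cross product tells to which side of the direction \<open>u\<close> the vector
  \<open>v\<close> points.\<close>

lemma Im_divide_sign:
  "u \<noteq> 0 \<Longrightarrow> (Im (v / u) < 0 \<longleftrightarrow> Re u * Im v - Im u * Re v < 0) \<and> (0 < Im (v / u) \<longleftrightarrow> 0 < Re u * Im v - Im u * Re v)"
proof -
  assume u: "u \<noteq> 0"
  have "Im (v / u) = (Re u * Im v - Im u * Re v) / (cmod u)\<^sup>2"
    by (simp add: Im_divide cmod_power2 algebra_simps diff_divide_distrib)
  then show ?thesis using u by (simp add: divide_less_0_iff zero_less_divide_iff)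
qed

lemma subdivision_covers:
  fixes a :: "nat \<Rightarrow> real"
  assumes "a i \<le> t" "t \<le> a k" "i < k"
  shows "\<exists>j\<ge>i. j < k \<and> a j \<le> t \<and> t \<le> a (Suc j)"
  using assms
proof (induction k)
  case (Suc k)
  show ?case
  proof (cases "t \<le> a k \<and> i < k")
    case True
    then show ?thesis using Suc by (meson less_SucI)
  next
    case False
    then show ?thesis using Suc.prems by (cases "i < k") (auto intro!: exI[of _ k] simp: less_Suc_eq)
  qed
qed auto

lemma to_cplx_simps [simp]: "Re (to_cplx p) = fst p" "Im (to_cplx p) = snd p"
  by (simp_all add: to_cplx_def)

lemma to_cplx_eq_iff [simp]: "to_cplx p = to_cplx q \<longleftrightarrow> p = q"
  by (simp add: complex_eq_iff prod_eq_iff)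

lemma continuous_on_to_cplx: "continuous_on A to_cplx"
proof -
  have eq: "to_cplx = (\<lambda>p. of_real (fst p) + \<i> * of_real (snd p))"
    by (auto simp: complex_eq_iff)
  show ?thesis unfolding eq by (intro continuous_intros)
qed

context hole begin

section \<open>Points of a box out of reach of the hole, and points exposed to it\<close>

lemma interior_not_in_closure:
  assumes "i \<in> I" "l i < x" "x < r i" "b i < y" "y < t i"
  shows "(x, y) \<notin> closure U"
proof -
  have "({l i<..<r i} \<times> {b i<..<t i}) \<inter> U = {}" using free[OF assms(1)] by force
  then have "({l i<..<r i} \<times> {b i<..<t i}) \<inter> closure U = {}"
    by (subst open_Int_closure_eq_empty) (auto intro: open_Times)
  moreover have "(x, y) \<in> {l i<..<r i} \<times> {b i<..<t i}" using assms by simp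
  ultimately show ?thesis by blast
qed

text \<open>An open rectangle reaching from one box into the other contains the inner part of their
  contact and misses the hole.\<close>

lemma contact_not_in_closure:
  assumes ij: "i \<in> I" "j \<in> I" and c: "t j = b i" and x: "l i < x" "x < r i" "l j < x" "x < r j" and y: "b j < y" "y < t i"
  shows "(x, y) \<notin> closure U"
proof -
  let ?R = "{max (l i) (l j)<..<min (r i) (r j)} \<times> {b j<..<t i}"
  have "?R \<inter> U = {}" 
  proof -
    have False if "z \<in> ?R" "z \<in> U" for z
      using that free[OF ij(1) that(2)] free[OF ij(2) that(2)] c by (cases "b i \<le> snd z") auto
    then show ?thesis by blast
  qed
  then have "?R \<inter> closure U = {}" by (subst open_Int_closure_eq_empty) (auto intro: open_Times)
  moreover have "(x, y) \<in> ?R" using assms by simp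
  ultimately show ?thesis by blast
qed

text \<open>Either the hole stays strictly above the bottom side, or the middle of the contact with
  a support is out of its reach. Such points anchor the lines used in
  \<open>orientation\<close>.\<close>

lemma bottom_anchor:
  assumes "i \<in> I" obtains x where "l i < x" "x < r i" "(x, b i) \<notin> closure U"
proof (cases "\<forall>z\<in>closure U. b i < snd z")
  case True
  then have "((l i + r i)/2, b i) \<notin> closure U" by fastforce
  then show ?thesis using that[of "(l i + r i)/2"] lr[OF assms] by (simp add: field_simps)
next
  case False
  then obtain j where j: "j \<in> I" "t j = b i" "l j < r i" "l i < r j" using bottom_support[OF assms] by blast
  define x where "x = (max (l i) (l j) + min (r i) (r j)) / 2"
  have "max (l i) (l j) < min (r i) (r j)" using j lr[OF assms] lr[OF j(1)] by auto
  then have x: "l i < x" "x < r i" "l j < x" "x < r j" by (auto simp: x_def)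
  then show ?thesis using that[of x] contact_not_in_closure[OF assms j(1,2) x, of "b i"] bt[OF assms] bt[OF j(1)] j(2) by auto
qed

lemma left_anchor:
  assumes "i \<in> I" obtains y where "b i < y" "y < t i" "(l i, y) \<notin> closure U"
proof -
  interpret T: hole I b t l r "prod.swap ` U" by (rule swap_hole)
  obtain y where "b i < y" "y < t i" "(y, l i) \<notin> closure (prod.swap ` U)" using T.bottom_anchor[OF assms] .
  then show ?thesis using that[of y] by (force simp: closure_swap)
qed

text \<open>Crossing the boundary of the box at such a point leads directly into the hole, and no
  other box takes part.\<close>

definition exposed :: "'i \<Rightarrow> point \<Rightarrow> bool" where
  "exposed i z \<longleftrightarrow> z \<in> box_of i \<and> (\<forall>j\<in>I. z \<in> box_of j \<longrightarrow> j = i) \<and>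
     (\<exists>\<rho>>0. \<forall>w. \<bar>fst w - fst z\<bar> < \<rho> \<longrightarrow> \<bar>snd w - snd z\<bar> < \<rho> \<longrightarrow> w \<notin> box_of i \<longrightarrow> w \<in> U)"

text \<open>Moving from \<open>p\<close> a little along the edge between the free quadrant and the
  box reaches an exposed point: another box there would reach back to \<open>p\<close> and fill one
  of the two quadrants.\<close>

lemma exposed_vertical:
  assumes s: "sector U sx sy p" and c: "covers sx (\<not> sy) p i" and d: "d > 0"
  obtains x where "x \<in> side sx (fst p) d" "l i < x" "x < r i" "exposed i (x, snd p)"
proof -
  obtain e0 where e0: "e0 > 0" "side sx (fst p) e0 \<times> side sy (snd p) e0 \<subseteq> U" using s by (auto simp: sector_def)
  obtain e1 where e1: "e1 > 0" and gap: "gap e1 (fst p) (snd p)" using gap_exists by blast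
  \<comment> \<open>Halving leaves room of size \<open>\<rho>\<close> on both sides of the new
    point, also towards \<open>p\<close>.\<close>
  define \<rho> where "\<rho> = min e0 (min e1 d) / 2"
  have \<rho>: "\<rho> > 0" "2 * \<rho> \<le> e0" "2 * \<rho> \<le> e1" "\<rho> < d" using e0 e1 d by (auto simp: \<rho>_def min_def)
  define x where "x = (if sx then fst p + \<rho> else fst p - \<rho>)"
  have ic: "i \<in> I" "l i \<le> fst p" "fst p \<le> r i" "b i \<le> snd p" "snd p \<le> t i" "if sx then fst p < r i else l i < fst p"
    using c by (auto simp: covers_iff)
  have edge: "if sy then snd p = t i \<and> b i \<le> snd p - \<rho> else snd p = b i \<and> snd p + \<rho> \<le> t i"
    using c sector_not_covered[OF s, of i] gapD(3,4)[OF gap ic(1)] \<rho> by (cases sy) (auto simp: covers_iff)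
  have x: "l i \<le> x - \<rho>" "x + \<rho> \<le> r i" using ic gapD(1,2)[OF gap ic(1)] \<rho> by (auto simp: x_def split: if_splits)
  have "exposed i (x, snd p)" unfolding exposed_def
  proof (intro conjI exI[of _ \<rho>] ballI allI impI)
    show "(x, snd p) \<in> box_of i" using ic x \<rho>(1) by (simp add: mem_box_of)
    fix j assume j: "j \<in> I" "(x, snd p) \<in> box_of j"
    have "l j \<le> fst p \<and> fst p \<le> r j \<and> (if sx then fst p < r j else l j < fst p)"
      using j(2) gapD(1,2)[OF gap j(1)] \<rho> by (auto simp: x_def mem_box_of split: if_splits)
    then have "covers sx sy p j \<or> covers sx (\<not> sy) p j"
      using j bt[OF j(1)] by (auto simp: covers_iff mem_box_of)
    then show "j = i" using sector_not_covered[OF s] covers_unique[OF c] by blast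
  next
    fix w assume w: "\<bar>fst w - fst (x, snd p)\<bar> < \<rho>" "\<bar>snd w - snd (x, snd p)\<bar> < \<rho>" "w \<notin> box_of i"
    have "fst w \<in> side sx (fst p) e0" using w(1) \<rho> by (auto simp: x_def side_def abs_less_iff)
    moreover have "snd w \<in> side sy (snd p) e0"
      using w x edge \<rho> by (auto simp: side_def mem_box_of abs_less_iff split: if_splits)
    ultimately show "w \<in> U" using e0(2) by (auto simp: mem_Times_iff)
  qed (fact \<rho>(1))
  then show ?thesis using that[of x] x \<rho> by (auto simp: x_def side_def)
qed

lemma exposed_horizontal:
  assumes s: "sector U sx sy p" and c: "covers (\<not> sx) sy p i" and d: "d > 0"
  obtains y where "y \<in> side sy (snd p) d" "b i < y" "y < t i" "exposed i (fst p, y)"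
proof -
  interpret T: hole I b t l r "prod.swap ` U" by (rule swap_hole)
  have "T.covers sy (\<not> sx) (prod.swap p) i" using c by (auto simp: covers_iff T.covers_iff)
  moreover have "sector (prod.swap ` U) sy sx (prod.swap p)" using s by (cases p) (simp add: sector_swap)
  ultimately obtain y where *: "y \<in> side sy (fst (prod.swap p)) d" "b i < y" "y < t i" "T.exposed i (y, snd (prod.swap p))"
    using T.exposed_vertical[OF _ _ d] by metis
  have "exposed i (fst p, y)"
    using *(4) unfolding exposed_def T.exposed_def by (auto simp: mem_box_of T.mem_box_of)
  then show ?thesis using that * by simp
qed

end

section \<open>Winding numbers along the circuit\<close>

locale hole_circuit = hole I l r b t U
  for I :: "'i set" and l r b t :: "'i \<Rightarrow> real" and U :: "point set" +
  fixes C :: "'i list" and g :: "real \<Rightarrow> point" and a :: "nat \<Rightarrow> real"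
  assumes dist_C: "distinct C" and set_C: "set C = {i\<in>I. closure U \<inter> box_of i \<noteq> {}}"
    and path_g: "path g" "pathfinish g = pathstart g" "path_image g = closure U - U"
    and wind_g: "z \<in> U \<Longrightarrow> winding_number (to_cplx \<circ> g) (to_cplx z) = -1"
    and a_0: "a 0 = 0" and a_1: "a (length C) = 1"
    and a_step: "k < length C \<Longrightarrow> a k \<le> a (Suc k)"
    and g_step: "k < length C \<Longrightarrow> g ` {a k..a (Suc k)} \<subseteq> box_of (C ! k)"
begin

abbreviation pt :: "nat \<Rightarrow> point" where "pt k \<equiv> g (a k)"

lemma C_mem: "k < length C \<Longrightarrow> C ! k \<in> I"
  using set_C nth_mem[of k C] by blast

lemma a_mono: "i \<le> j \<Longrightarrow> j \<le> length C \<Longrightarrow> a i \<le> a j"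
proof (induction j rule: dec_induct)
  case (step m)
  then show ?case using a_step[of m] by linarith
qed simp

lemma a_range: "k \<le> length C \<Longrightarrow> 0 \<le> a k \<and> a k \<le> 1"
  using a_mono[of 0 k] a_mono[of k "length C"] unfolding a_0 a_1 by simp

lemma pt_closure: "k \<le> length C \<Longrightarrow> pt k \<in> closure U"
proof -
  assume "k \<le> length C"
  then have "pt k \<in> path_image g" using a_range[of k] by (simp add: path_image_def)
  then show ?thesis unfolding path_g(3) by blast
qed

lemma pt_in: "k < length C \<Longrightarrow> pt k \<in> box_of (C ! k)"
  using subsetD[OF g_step imageI] a_step[of k] by simp

lemma pt_out: "k < length C \<Longrightarrow> pt (Suc k) \<in> box_of (C ! k)"
  using subsetD[OF g_step imageI] a_step[of k] by simp

lemma pt_wrap: "pt (length C) = pt 0"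
  using path_g(2) unfolding a_0 a_1 pathfinish_def pathstart_def .

text \<open>At an upper right corner of the hole the boxes above and to the right are different.
  Hence cyclic successors are distinct, and the closing point of the curve belongs to two
  boxes.\<close>

lemma two_boxes: "2 \<le> length C"
proof -
  obtain p T E where p: "sector U False False p" "covers False True p T" "covers True False p E"
    using upper_right_corner_exists .
  have "T \<noteq> E" using p sector_not_covered[OF p(1), of T] by (auto simp: covers_iff)
  moreover have "T \<in> set C" "E \<in> set C" using p sector_closure[OF p(1)] by (auto simp: set_C covers_def)
  ultimately have "card {T, E} \<le> card (set C)" by (intro card_mono) auto
  then show ?thesis using \<open>T \<noteq> E\<close> card_length[of C] by simp
qed

lemma path_cplx: "path (to_cplx \<circ> g)" "pathfinish (to_cplx \<circ> g) = pathstart (to_cplx \<circ> g)"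
  "path_image (to_cplx \<circ> g) = to_cplx ` (closure U - U)"
proof -
  show "path (to_cplx \<circ> g)" by (rule path_continuous_image[OF path_g(1) continuous_on_to_cplx])
  show "pathfinish (to_cplx \<circ> g) = pathstart (to_cplx \<circ> g)"
    unfolding pathfinish_compose pathstart_compose path_g(2) ..
  show "path_image (to_cplx \<circ> g) = to_cplx ` (closure U - U)"
    unfolding path_image_compose path_g(3) ..
qed

lemma winding_number_rectangle_eq:
  assumes "z \<in> {x1<..<x2} \<times> {y1<..<y2}" "w \<in> {x1<..<x2} \<times> {y1<..<y2}" "({x1<..<x2} \<times> {y1<..<y2}) \<inter> closure U = {}"
  shows "winding_number (to_cplx \<circ> g) (to_cplx z) = winding_number (to_cplx \<circ> g) (to_cplx w)"
proof (rule winding_number_eq[OF path_cplx(1,2)])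
  let ?R = "{x1<..<x2} \<times> {y1<..<y2}"
  show "connected (to_cplx ` ?R)"
    by (intro connected_continuous_image continuous_on_to_cplx connected_Times connected_Ioo)
  show "to_cplx ` ?R \<inter> path_image (to_cplx \<circ> g) = {}"
    using assms(3) unfolding path_cplx(3) by auto
qed (use assms in auto)

text \<open>The interior of a box is joined to the outside of the curve through the chain of its
  bottom supports.\<close>

lemma winding_number_box:
  assumes "i \<in> I" "z \<in> {l i<..<r i} \<times> {b i<..<t i}"
  shows "winding_number (to_cplx \<circ> g) (to_cplx z) = 0"
  using assms
proof (induction "card {j\<in>I. b j < b i}" arbitrary: i z rule: less_induct)
  case less
  have int: "({l i<..<r i} \<times> {b i<..<t i}) \<inter> closure U = {}"
    using interior_not_in_closure[OF less.prems(1)] by auto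
  show ?case
  proof (cases "\<forall>w\<in>closure U. b i < snd w")
    case True
    have "compact (closure U)" "closure U \<noteq> {}" using bdU neU by (auto simp: compact_closure)
    moreover have "continuous_on (closure U) snd" by (intro continuous_intros)
    ultimately obtain q where q: "q \<in> closure U" "\<And>w. w \<in> closure U \<Longrightarrow> snd q \<le> snd w"
      using continuous_attains_inf[of "closure U" snd] by blast
    \<comment> \<open>This height gives a point of the box below the entire curve, which stays in a
      half plane missing it.\<close>
    define y where "y = (b i + min (t i) (snd q)) / 2"
    have y: "b i < y" "y < t i" "y < snd q" using True q(1) bt[OF less.prems(1)] by (auto simp: y_def min_def)
    let ?w = "((l i + r i) / 2, y)"
    have "?w \<in> {l i<..<r i} \<times> {b i<..<t i}" using y lr[OF less.prems(1)] by (auto simp: field_simps)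
    then have "winding_number (to_cplx \<circ> g) (to_cplx z) = winding_number (to_cplx \<circ> g) (to_cplx ?w)"
      using winding_number_rectangle_eq[OF less.prems(2) _ int] by blast
    also have "\<dots> = 0"
    proof (rule winding_number_zero_outside[OF path_cplx(1) _ path_cplx(2)])
      show "convex {c. snd q \<le> Im c}" by (rule convex_halfspace_Im_ge)
    qed (use y q in \<open>auto simp: path_cplx(3)\<close>)
    finally show ?thesis .
  next
    case False
    then obtain j where j: "j \<in> I" "t j = b i" "l j < r i" "l i < r j"
      using bottom_support[OF less.prems(1)] by blast
    have "card {k\<in>I. b k < b j} < card {k\<in>I. b k < b i}"
      by (rule psubset_card_mono) (use fin j bt[OF j(1)] in auto)
    note IH = less.hyps[OF this j(1)]
    define x where "x = (max (l i) (l j) + min (r i) (r j)) / 2"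
    have "max (l i) (l j) < min (r i) (r j)" using j lr[OF less.prems(1)] lr[OF j(1)] by auto
    then have x: "l i < x" "x < r i" "l j < x" "x < r j" by (auto simp: x_def)
    let ?M = "{max (l i) (l j)<..<min (r i) (r j)} \<times> {b j<..<t i}"
    let ?u = "(x, (b i + t i)/2)" and ?v = "(x, (b j + t j)/2)"
    have M: "?M \<inter> closure U = {}"
      using contact_not_in_closure[OF less.prems(1) j(1,2)] by auto
    have b: "b i < t i" "b j < t j" using bt less.prems(1) j(1) by auto
    have "winding_number (to_cplx \<circ> g) (to_cplx z) = winding_number (to_cplx \<circ> g) (to_cplx ?u)"
      using winding_number_rectangle_eq[OF less.prems(2) _ int, of ?u] x b by auto
    also have "\<dots> = winding_number (to_cplx \<circ> g) (to_cplx ?v)"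
      using winding_number_rectangle_eq[OF _ _ M, of ?u ?v] x b j(2) by auto
    also have "\<dots> = 0" using IH[of ?v] x b by auto
    finally show ?thesis .
  qed
qed

text \<open>The end points of the \<open>k\<close>-th interval are included: they belong to the
  neighbouring intervals too, and cyclically so because the curve is closed.\<close>

lemma other_box:
  assumes "k < length C" "s \<in> {0..a k} \<union> {a (Suc k)..1}"
  shows "\<exists>j<length C. j \<noteq> k \<and> g s \<in> box_of (C ! j)"
proof (cases "s \<le> a k")
  case True
  then have s: "0 \<le> s" using assms a_range[of "Suc k"] by auto
  show ?thesis
  proof (cases "k = 0")
    case True
    then have "s = 0" using s \<open>s \<le> a k\<close> a_0 by auto
    moreover have "Suc (length C - 1) = length C" using two_boxes by simp
    ultimately have "g s = pt (Suc (length C - 1))" using pt_wrap a_0 by simp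
    then show ?thesis using pt_out[of "length C - 1"] two_boxes True by (intro exI[of _ "length C - 1"]) auto
  next
    case False
    then obtain j where "j < k" "a j \<le> s" "s \<le> a (Suc j)"
      using subdivision_covers[of a 0 s k] s True a_0 by auto
    then show ?thesis using g_step[of j] assms(1) by (intro exI[of _ j]) auto
  qed
next
  case False
  then have s: "a (Suc k) \<le> s" "s \<le> 1" using assms by auto
  show ?thesis
  proof (cases "Suc k = length C")
    case True
    then have "s = 1" using s a_1 by auto
    then have "g s = pt 0" using pt_wrap a_1 by simp
    moreover have "0 < length C" "0 \<noteq> k" using two_boxes True by linarith+
    ultimately show ?thesis using pt_in[of 0] by metis
  next
    case False
    then obtain j where "j \<ge> Suc k" "j < length C" "a j \<le> s" "s \<le> a (Suc j)"
      using subdivision_covers[of a "Suc k" s "length C"] s a_1 assms(1) by auto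
    then show ?thesis using g_step[of j] by (intro exI[of _ j]) auto
  qed
qed

text \<open>\<open>e\<close> is a boundary point met by no box but \<open>C ! k\<close>, and \<open>o\<close> a point of the boundary of that
  box off the closure of \<open>U\<close>. The line from \<open>o\<close> through \<open>e\<close> meets the part of the curve in the box
  at most in \<open>e\<close>, where the winding number jumps from \<open>0\<close> to \<open>-1\<close>: so this part of the curve enters
  on the right of the line and leaves on its left.\<close>

lemma orientation:
  assumes k: "k < length C"
    and o: "(ox, oy) \<notin> closure U"
    and only: "\<And>j. j \<in> I \<Longrightarrow> (ex, ey) \<in> box_of j \<Longrightarrow> j = C ! k"
    and beyond: "\<And>s. s > 0 \<Longrightarrow> (ex + s * (ex - ox), ey + s * (ey - oy)) \<notin> box_of (C ! k)"
    and inU: "s0 > 0" "\<And>s. 0 < s \<Longrightarrow> s < s0 \<Longrightarrow> (ex + s * (ex - ox), ey + s * (ey - oy)) \<in> U"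
    and inside: "\<And>s. 0 < s \<Longrightarrow> s < 1 \<Longrightarrow> (ex - s * (ex - ox), ey - s * (ey - oy)) \<in> {l (C!k)<..<r (C!k)} \<times> {b (C!k)<..<t (C!k)}"
    and before: "\<And>s. s > 1 \<Longrightarrow> (ex - s * (ex - ox), ey - s * (ey - oy)) \<notin> box_of (C ! k)"
  shows "(ex - ox) * (snd (pt k) - ey) - (ey - oy) * (fst (pt k) - ex) < 0 \<and>
    0 < (ex - ox) * (snd (pt (Suc k)) - ey) - (ey - oy) * (fst (pt (Suc k)) - ex)"
proof -
  let ?F = "C ! k"
  have F: "?F \<in> I" using C_mem k by blast
  let ?e = "to_cplx (ex, ey)" and ?u = "to_cplx (ex - ox, ey - oy)" and ?\<gamma> = "to_cplx \<circ> g"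
  have eq: "?e + of_real s * ?u = to_cplx (ex + s * (ex - ox), ey + s * (ey - oy))" for s
    by (simp add: complex_eq_iff)
  have eq': "?e - of_real s * ?u = to_cplx (ex - s * (ex - ox), ey - s * (ey - oy))" for s
    by (simp add: complex_eq_iff)
  have u: "?u \<noteq> 0"
  proof
    assume "?u = 0"
    then have "ex = ox" "ey = oy" by (auto simp: complex_eq_iff)
    then have 1: "(ex, ey) \<in> {l (C!k)<..<r (C!k)} \<times> {b (C!k)<..<t (C!k)}" using inside[of "1/2"] by simp
    then show False using beyond[of 1] \<open>ex = ox\<close> \<open>ey = oy\<close> by (auto simp: mem_box_of)
  qed
  \<comment> \<open>The other boxes form a closed set missing \<open>?e\<close>, so a short segment
    through \<open>?e\<close> avoids them all.\<close>
  let ?W = "\<Union>j\<in>I - {?F}. to_cplx ` box_of j"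
  have "closed ?W"
  proof (intro closed_UN ballI)
    fix j
    have "compact (box_of j)" by (auto simp: box_of_def intro: compact_Times)
    then show "closed (to_cplx ` box_of j)" by (intro compact_imp_closed compact_continuous_image continuous_on_to_cplx)
  qed (use fin in auto)
  moreover have "?e \<notin> ?W" using only by auto
  ultimately obtain d where d: "d > 0" "\<And>w. dist w ?e < d \<Longrightarrow> w \<notin> ?W"
    using separate_point_closed[of ?W ?e] by (metis dist_commute not_le)
  \<comment> \<open>The three bounds put the outer end into the hole and the inner end into the
    interior of the box, and keep the segment away from the other boxes.\<close>
  define \<epsilon> where "\<epsilon> = min (min (s0/2) (1/2)) (d / (2 * norm ?u))"
  have nu: "norm ?u > 0" using u by simp
  have \<epsilon>: "\<epsilon> > 0" "\<epsilon> < s0" "\<epsilon> < 1" "\<epsilon> * norm ?u < d"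
  proof -
    have "\<epsilon> \<le> s0 / 2" "\<epsilon> \<le> 1 / 2" by (auto simp: \<epsilon>_def)
    then show "\<epsilon> < s0" "\<epsilon> < 1" using inU(1) by auto
    show "\<epsilon> > 0" using inU(1) d(1) nu by (simp add: \<epsilon>_def)
    have "\<epsilon> * norm ?u \<le> d / (2 * norm ?u) * norm ?u" by (rule mult_right_mono) (auto simp: \<epsilon>_def)
    also have "\<dots> < d" using d(1) nu by simp
    finally show "\<epsilon> * norm ?u < d" .
  qed
  have zU: "(ex + \<epsilon> * (ex - ox), ey + \<epsilon> * (ey - oy)) \<in> U" using inU(2) \<epsilon> by blast
  have wI: "(ex - \<epsilon> * (ex - ox), ey - \<epsilon> * (ey - oy)) \<in> {l ?F<..<r ?F} \<times> {b ?F<..<t ?F}" using inside \<epsilon> by blast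
  have "Im ((?\<gamma> (a k) - ?e) / ?u) < 0 \<and> 0 < Im ((?\<gamma> (a (Suc k)) - ?e) / ?u)"
  proof (rule winding_number_crossing[OF path_cplx(1,2) _ _ _ u \<epsilon>(1)])
    show "0 \<le> a k" "a k \<le> a (Suc k)" "a (Suc k) \<le> 1" using a_range[of k] a_range[of "Suc k"] a_step[of k] k by auto
    show "?e + \<epsilon> * ?u \<notin> path_image ?\<gamma>" using zU unfolding eq path_cplx(3) by auto
    show "?e - \<epsilon> * ?u \<notin> path_image ?\<gamma>" using wI interior_not_in_closure[OF F] unfolding eq' path_cplx(3) by auto
    show "winding_number ?\<gamma> (?e + \<epsilon> * ?u) - winding_number ?\<gamma> (?e - \<epsilon> * ?u) = - 1"
      unfolding eq eq' winding_number_box[OF F wI] using wind_g[OF zU] by simp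
    show "?\<gamma> s \<noteq> ?e + of_real x * ?u" if s: "s \<in> {0..a k} \<union> {a (Suc k)..1}" and x: "\<bar>x\<bar> \<le> \<epsilon>" for s x
    proof -
      obtain j where j: "j < length C" "j \<noteq> k" "g s \<in> box_of (C ! j)" using other_box[OF k s] by blast
      then have "C ! j \<in> I - {?F}" using C_mem dist_C k by (auto simp: nth_eq_iff_index_eq)
      then have "?\<gamma> s \<in> ?W" using j(3) by auto
      moreover have "dist (?e + of_real x * ?u) ?e < d"
      proof -
        have "dist (?e + of_real x * ?u) ?e = \<bar>x\<bar> * norm ?u" by (simp add: dist_norm norm_mult)
        also have "\<dots> \<le> \<epsilon> * norm ?u" using x by (intro mult_right_mono) auto
        finally show ?thesis using \<epsilon>(4) by simp
      qed
      ultimately show ?thesis using d(2) by metis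
    qed
    show "x = 0" if s: "s \<in> {a k..a (Suc k)}" and gs: "?\<gamma> s = ?e + of_real x * ?u" for s x
    proof (rule ccontr)
      assume "x \<noteq> 0"
      have g: "g s = (ex + x * (ex - ox), ey + x * (ey - oy))" using gs unfolding eq by simp
      have "s \<in> {0..1}" using s a_range[of k] a_range[of "Suc k"] k by auto
      then have gc: "g s \<in> closure U" using path_g(3) by (auto simp: path_image_def)
      have gb: "g s \<in> box_of ?F" using g_step[OF k] s by blast
      \<comment> \<open>Measured from \<open>?e\<close> in units of \<open>?u\<close>, the anchor is
        at -1: the line is outside the box after 0 and before -1, and in its interior in
        between.\<close>
      consider "x > 0" | "-1 < x" "x < 0" | "x = -1" | "x < -1" using \<open>x \<noteq> 0\<close> by linarith
      then show False
      proof cases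
        case 1 then show ?thesis using beyond gb g by simp
      next
        case 2 then show ?thesis using inside[of "-x"] gc g interior_not_in_closure[OF F] by auto
      next
        case 3 then show ?thesis using gc g o by simp
      next
        case 4 then show ?thesis using before[of "-x"] gb g by simp
      qed
    qed
  qed
  then show ?thesis
    using Im_divide_sign[OF u, of "?\<gamma> (a k) - ?e"] Im_divide_sign[OF u, of "?\<gamma> (a (Suc k)) - ?e"] by auto
qed

end

section \<open>Counterclockwise traversal of the sides of a box\<close>

lemma convex_comb_greater:
  fixes s :: real
  assumes "0 < s" "s < 1" "lo \<le> a" "lo \<le> b" "lo < a \<or> lo < b" shows "lo < a - s * (a - b)"
proof -
  have "a - s * (a - b) - lo = (1 - s) * (a - lo) + s * (b - lo)" by (simp add: algebra_simps)
  moreover have "0 \<le> (1 - s) * (a - lo)" "0 \<le> s * (b - lo)" using assms by auto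
  moreover have "0 < (1 - s) * (a - lo) \<or> 0 < s * (b - lo)" using assms by auto
  ultimately show ?thesis by linarith
qed

lemma convex_comb_less:
  fixes s :: real
  assumes "0 < s" "s < 1" "a \<le> hi" "b \<le> hi" "a < hi \<or> b < hi" shows "a - s * (a - b) < hi"
  using convex_comb_greater[of s "-hi" "-a" "-b"] assms by (simp add: algebra_simps)

lemma small_multiples:
  fixes dx dy \<rho> :: real
  assumes "\<rho> > 0" obtains s0 where "s0 > 0" "\<And>s. 0 < s \<Longrightarrow> s < s0 \<Longrightarrow> \<bar>s * dx\<bar> < \<rho> \<and> \<bar>s * dy\<bar> < \<rho>"
proof
  let ?D = "1 + \<bar>dx\<bar> + \<bar>dy\<bar>"
  show "\<rho> / ?D > 0" using assms by (auto intro!: divide_pos_pos)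
  fix s assume s: "0 < s" "s < \<rho> / ?D"
  then have "s * ?D < \<rho>" by (simp add: pos_less_divide_eq)
  moreover have "s * \<bar>dx\<bar> \<le> s * ?D" "s * \<bar>dy\<bar> \<le> s * ?D" using s by (auto intro!: mult_left_mono)
  ultimately show "\<bar>s * dx\<bar> < \<rho> \<and> \<bar>s * dy\<bar> < \<rho>" unfolding abs_mult abs_of_pos[OF s(1)] by linarith
qed

lemma extrapolation_less:
  fixes s :: real
  assumes "1 < s" "b < a" shows "a - s * (a - b) < b"
proof -
  have "a - s * (a - b) - b = - ((s - 1) * (a - b))" by (simp add: algebra_simps)
  moreover have "0 < (s - 1) * (a - b)" using assms by (intro mult_pos_pos) auto
  ultimately show ?thesis by linarith
qed

context hole begin

lemma closure_bounds:
  assumes "\<forall>z\<in>U. fst z < x \<and> snd z < y" "z \<in> closure U" shows "fst z \<le> x" "snd z \<le> y"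
proof -
  have "closed {z::point. fst z \<le> x \<and> snd z \<le> y}"
    by (intro closed_Collect_conj closed_Collect_le continuous_intros)
  then have "closure U \<subseteq> {z. fst z \<le> x \<and> snd z \<le> y}" using assms(1) by (intro closure_minimal) auto
  then show "fst z \<le> x" "snd z \<le> y" using assms(2) by auto
qed

lemma covers_edge_vertical:
  assumes "sector U sx sy p" "covers sx (\<not> sy) p i"
  shows "snd p = (if sy then t i else b i)"
  using assms(2) sector_not_covered[OF assms(1), of i] by (cases sy) (auto simp: covers_iff)

lemma covers_edge_horizontal:
  assumes "sector U sx sy p" "covers (\<not> sx) sy p i"
  shows "fst p = (if sx then r i else l i)"
  using assms(2) sector_not_covered[OF assms(1), of i] by (cases sx) (auto simp: covers_iff)

end

context hole_circuit begin

text \<open>The boundary of a box is oriented counterclockwise, starting from an anchor \<open>o\<close> on its left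
  or bottom side.\<close>

lemma exposed_orientation:
  assumes k: "k < length C" and e: "exposed (C!k) (ex, ey)"
    and o: "(ox, oy) \<notin> closure U" "(ox, oy) \<in> box_of (C!k)"
    and behind: "ox = l (C!k) \<and> ox < ex \<or> oy = b (C!k) \<and> oy < ey"
    and ahead: "ex = r (C!k) \<and> ox < ex \<or> ex = l (C!k) \<and> ex < ox \<or> ey = t (C!k) \<and> oy < ey \<or> ey = b (C!k) \<and> ey < oy"
    and across: "l (C!k) < ex \<or> l (C!k) < ox" "ex < r (C!k) \<or> ox < r (C!k)" "b (C!k) < ey \<or> b (C!k) < oy" "ey < t (C!k) \<or> oy < t (C!k)"
  shows "(ex - ox) * (snd (pt k) - ey) - (ey - oy) * (fst (pt k) - ex) < 0 \<and>
    0 < (ex - ox) * (snd (pt (Suc k)) - ey) - (ey - oy) * (fst (pt (Suc k)) - ex)"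
proof -
  let ?F = "C ! k"
  from e obtain \<rho> where e': "(ex, ey) \<in> box_of ?F" "\<And>j. j \<in> I \<Longrightarrow> (ex, ey) \<in> box_of j \<Longrightarrow> j = ?F"
    and \<rho>: "\<rho> > 0" "\<And>w. \<bar>fst w - ex\<bar> < \<rho> \<Longrightarrow> \<bar>snd w - ey\<bar> < \<rho> \<Longrightarrow> w \<notin> box_of ?F \<Longrightarrow> w \<in> U"
    unfolding exposed_def by auto
  obtain s0 where s0: "s0 > 0" "\<And>s. 0 < s \<Longrightarrow> s < s0 \<Longrightarrow> \<bar>s * (ex - ox)\<bar> < \<rho> \<and> \<bar>s * (ey - oy)\<bar> < \<rho>"
    using small_multiples[OF \<rho>(1)] by metis
  have outside: "(ex + s * (ex - ox), ey + s * (ey - oy)) \<notin> box_of ?F" if "s > 0" for s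
    using ahead mult_pos_pos[OF that, of "ex - ox"] mult_pos_neg[OF that, of "ex - ox"]
      mult_pos_pos[OF that, of "ey - oy"] mult_pos_neg[OF that, of "ey - oy"] by (auto simp: mem_box_of)
  show ?thesis
  \<comment> \<open>\<open>ahead\<close> keeps the line out of the box after the exposed point,
    \<open>behind\<close> before the anchor, and \<open>across\<close> puts the open segment between
    them into the interior.\<close>
  proof (rule orientation[OF k o(1) e'(2) outside s0(1)])
    fix s :: real
    show "(ex + s * (ex - ox), ey + s * (ey - oy)) \<in> U" if s: "0 < s" "s < s0"
      using \<rho>(2)[OF _ _ outside[OF s(1)]] s0(2)[OF s] by simp
    show "(ex - s * (ex - ox), ey - s * (ey - oy)) \<in> {l ?F<..<r ?F} \<times> {b ?F<..<t ?F}" if s: "0 < s" "s < 1"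
      using convex_comb_greater[OF s] convex_comb_less[OF s] across o(2) e'(1) by (simp add: mem_box_of)
    show "(ex - s * (ex - ox), ey - s * (ey - oy)) \<notin> box_of ?F" if s: "1 < s"
      using behind extrapolation_less[OF s, of ox ex] extrapolation_less[OF s, of oy ey] by (auto simp: mem_box_of)
  qed
qed

text \<open>With the anchor on the bottom side, the cross product for a point on the top side
  reduces to comparing abscissas: the top side is traversed to the left.\<close>

lemma top_edge:
  assumes k: "k < length C" and v: "l (C!k) < x" "x < r (C!k)" and e: "exposed (C!k) (x, t (C!k))"
  shows "snd (pt k) = t (C!k) \<Longrightarrow> x < fst (pt k)" "snd (pt (Suc k)) = t (C!k) \<Longrightarrow> fst (pt (Suc k)) < x"
proof -
  obtain u where u: "l (C!k) < u" "u < r (C!k)" "(u, b (C!k)) \<notin> closure U" using bottom_anchor[OF C_mem[OF k]] .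
  note F = bt[OF C_mem[OF k]] lr[OF C_mem[OF k]]
  note or = exposed_orientation[OF k e u(3)]
  show "x < fst (pt k)" if "snd (pt k) = t (C!k)"
    using conjunct1[OF or] that u v F by (simp add: mem_box_of mult_less_0_iff zero_less_mult_iff)
  show "fst (pt (Suc k)) < x" if "snd (pt (Suc k)) = t (C!k)"
    using conjunct2[OF or] that u v F by (simp add: mem_box_of mult_less_0_iff zero_less_mult_iff)
qed

text \<open>An anchor on the bottom side would lie on the line of the edge itself, so one on the
  left side is used.\<close>

lemma bottom_edge:
  assumes k: "k < length C" and v: "l (C!k) < x" "x < r (C!k)" and e: "exposed (C!k) (x, b (C!k))"
  shows "snd (pt k) = b (C!k) \<Longrightarrow> fst (pt k) < x" "snd (pt (Suc k)) = b (C!k) \<Longrightarrow> x < fst (pt (Suc k))"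
proof -
  obtain u where u: "b (C!k) < u" "u < t (C!k)" "(l (C!k), u) \<notin> closure U" using left_anchor[OF C_mem[OF k]] .
  note F = bt[OF C_mem[OF k]] lr[OF C_mem[OF k]]
  note or = exposed_orientation[OF k e u(3)]
  show "fst (pt k) < x" if "snd (pt k) = b (C!k)"
    using conjunct1[OF or] that u v F by (simp add: mem_box_of mult_less_0_iff zero_less_mult_iff)
  show "x < fst (pt (Suc k))" if "snd (pt (Suc k)) = b (C!k)"
    using conjunct2[OF or] that u v F by (simp add: mem_box_of mult_less_0_iff zero_less_mult_iff)
qed

lemma right_edge:
  assumes k: "k < length C" and v: "b (C!k) < y" "y < t (C!k)" and e: "exposed (C!k) (r (C!k), y)"
  shows "fst (pt k) = r (C!k) \<Longrightarrow> snd (pt k) < y" "fst (pt (Suc k)) = r (C!k) \<Longrightarrow> y < snd (pt (Suc k))"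
proof -
  obtain u where u: "l (C!k) < u" "u < r (C!k)" "(u, b (C!k)) \<notin> closure U" using bottom_anchor[OF C_mem[OF k]] .
  note F = bt[OF C_mem[OF k]] lr[OF C_mem[OF k]]
  note or = exposed_orientation[OF k e u(3)]
  show "snd (pt k) < y" if "fst (pt k) = r (C!k)"
    using conjunct1[OF or] that u v F by (simp add: mem_box_of mult_less_0_iff zero_less_mult_iff)
  show "y < snd (pt (Suc k))" if "fst (pt (Suc k)) = r (C!k)"
    using conjunct2[OF or] that u v F by (simp add: mem_box_of mult_less_0_iff zero_less_mult_iff)
qed

lemma left_edge:
  assumes k: "k < length C" and v: "b (C!k) < y" "y < t (C!k)" and e: "exposed (C!k) (l (C!k), y)"
  shows "fst (pt k) = l (C!k) \<Longrightarrow> y < snd (pt k)" "fst (pt (Suc k)) = l (C!k) \<Longrightarrow> snd (pt (Suc k)) < y"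
proof -
  obtain u where u: "l (C!k) < u" "u < r (C!k)" "(u, b (C!k)) \<notin> closure U" using bottom_anchor[OF C_mem[OF k]] .
  note F = bt[OF C_mem[OF k]] lr[OF C_mem[OF k]]
  note or = exposed_orientation[OF k e u(3)]
  show "y < snd (pt k)" if "fst (pt k) = l (C!k)"
    using conjunct1[OF or] that u v F by (simp add: mem_box_of mult_less_0_iff zero_less_mult_iff)
  show "snd (pt (Suc k)) < y" if "fst (pt (Suc k)) = l (C!k)"
    using conjunct2[OF or] that u v F by (simp add: mem_box_of mult_less_0_iff zero_less_mult_iff)
qed

text \<open>The edge between the free quadrant and the box has exposed points near \<open>p\<close>.
  Counterclockwise order puts them after \<open>p\<close> if the curve enters the box there, and
  before \<open>p\<close> if it leaves there; the quadrants tell which of the two is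
  possible.\<close>

lemma vertical_rule:
  assumes k: "k < length C" and s: "sector U sx sy p" and c: "covers sx (\<not> sy) p (C!k)"
  shows "p = pt k \<Longrightarrow> sx \<noteq> sy" "p = pt (Suc k) \<Longrightarrow> sx = sy"
proof -
  obtain x where e: "x \<in> side sx (fst p) 1" "l (C!k) < x" "x < r (C!k)" "exposed (C!k) (x, snd p)"
    using exposed_vertical[OF s c zero_less_one] by metis
  note edge = top_edge[OF k e(2,3)] bottom_edge[OF k e(2,3)]
  show "sx \<noteq> sy" if "p = pt k" using edge(1,3) e(1,4) covers_edge_vertical[OF s c] that
    by (cases sx; cases sy) (auto simp: side_def)
  show "sx = sy" if "p = pt (Suc k)" using edge(2,4) e(1,4) covers_edge_vertical[OF s c] that
    by (cases sx; cases sy) (auto simp: side_def)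
qed

lemma horizontal_rule:
  assumes k: "k < length C" and s: "sector U sx sy p" and c: "covers (\<not> sx) sy p (C!k)"
  shows "p = pt k \<Longrightarrow> sx = sy" "p = pt (Suc k) \<Longrightarrow> sx \<noteq> sy"
proof -
  obtain y where e: "y \<in> side sy (snd p) 1" "b (C!k) < y" "y < t (C!k)" "exposed (C!k) (fst p, y)"
    using exposed_horizontal[OF s c zero_less_one] by metis
  note edge = right_edge[OF k e(2,3)] left_edge[OF k e(2,3)]
  show "sx = sy" if "p = pt k" using edge(1,3) e(1,4) covers_edge_horizontal[OF s c] that
    by (cases sx; cases sy) (auto simp: side_def)
  show "sx \<noteq> sy" if "p = pt (Suc k)" using edge(2,4) e(1,4) covers_edge_horizontal[OF s c] that
    by (cases sx; cases sy) (auto simp: side_def)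
qed

end

section \<open>Arrows of the circuit\<close>

lemma add_mod_if: "x < 2 * m \<Longrightarrow> x mod m = (if x < m then x else x - (m::nat))"
  by (auto simp: not_less le_mod_geq)

context hole_circuit begin

abbreviation nx :: "nat \<Rightarrow> nat" where "nx k \<equiv> cnext (length C) k"

lemma nx_less: "k < length C \<Longrightarrow> nx k < length C"
proof -
  assume "k < length C"
  then have "0 < length C" by linarith
  then show ?thesis unfolding cnext_def by (rule mod_less_divisor)
qed

lemma nx_inject: "j < length C \<Longrightarrow> k < length C \<Longrightarrow> nx j = nx k \<longleftrightarrow> j = k"
  by (auto simp: cnext_def add_mod_if split: if_splits)

lemma nx_neq: "k < length C \<Longrightarrow> nx k \<noteq> k"
  using two_boxes by (auto simp: cnext_def add_mod_if)

lemma pt_nx: "k < length C \<Longrightarrow> pt (nx k) = pt (Suc k)"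
  using pt_wrap by (cases "Suc k = length C") (auto simp: cnext_def)

lemma C_eq_iff: "j < length C \<Longrightarrow> k < length C \<Longrightarrow> C ! j = C ! k \<longleftrightarrow> j = k"
  using dist_C by (simp add: nth_eq_iff_index_eq)

lemma covers_some:
  assumes "i \<in> I" "p \<in> box_of i" shows "\<exists>sx sy. covers sx sy p i"
proof -
  have "fst p < r i \<or> l i < fst p" "snd p < t i \<or> b i < snd p"
    using lr[OF assms(1)] bt[OF assms(1)] by linarith+
  then show ?thesis using assms unfolding covers_def by (metis (full_types))
qed

text \<open>The orientation rules, quadrant by quadrant: if a quadrant at the transition point is
  free, then \<open>B\<close> does not fill the next one clockwise and \<open>A\<close> does not
  fill the next one counterclockwise.\<close>

lemma arrow:
  assumes k: "k < length C" and A: "A = C ! k" and B: "B = C ! nx k" and p: "p = pt (Suc k)"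
  shows "A \<in> I" "B \<in> I" "A \<noteq> B" "p \<in> box_of A" "p \<in> box_of B" "p \<in> closure U"
    "sector U True True p \<Longrightarrow> \<not> covers True False p B \<and> \<not> covers False True p A"
    "sector U True False p \<Longrightarrow> \<not> covers False False p B \<and> \<not> covers True True p A"
    "sector U False False p \<Longrightarrow> \<not> covers False True p B \<and> \<not> covers True False p A"
    "sector U False True p \<Longrightarrow> \<not> covers True True p B \<and> \<not> covers False False p A"
proof -
  have n: "nx k < length C" and pn: "pt (nx k) = p" using nx_less[OF k] pt_nx[OF k] p by simp_all
  show "A \<in> I" "B \<in> I" using C_mem k n A B by simp_all
  show "A \<noteq> B" using C_eq_iff[OF k n] nx_neq[OF k] A B by simp
  show "p \<in> box_of A" "p \<in> box_of B" using pt_out[OF k] pt_in[OF n] pn A B p by simp_all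
  show "p \<in> closure U" using pt_closure[of "Suc k"] k p by simp
  note v = vertical_rule(1)[OF n _ _ pn[symmetric]] vertical_rule(2)[OF k _ _ p]
  note h = horizontal_rule(1)[OF n _ _ pn[symmetric]] horizontal_rule(2)[OF k _ _ p]
  show "sector U True True p \<Longrightarrow> \<not> covers True False p B \<and> \<not> covers False True p A"
    "sector U True False p \<Longrightarrow> \<not> covers False False p B \<and> \<not> covers True True p A"
    "sector U False False p \<Longrightarrow> \<not> covers False True p B \<and> \<not> covers True False p A"
    "sector U False True p \<Longrightarrow> \<not> covers True True p B \<and> \<not> covers False False p A"
    using v[of True True] v[of True False] v[of False True] v[of False False]
      h[of True True] h[of True False] h[of False True] h[of False False] unfolding A B by auto
qed

text \<open>The hole meets a neighbourhood of the transition point \<open>p\<close> in some of its four quadrants, and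
  \<open>A\<close> and \<open>B\<close> cover some of the others, so that only finitely many configurations are possible.\<close>

lemma arrow_types:
  assumes "k < length C" "A = C ! k" "B = C ! nx k" "p = pt (Suc k)"
  shows "l A = r B \<or> t A = b B \<or>
      sector U False False p \<and> \<not> sector U False True p \<and> \<not> sector U True False p \<or>
      sector U True False p \<and> p = (l B, b B) \<and> r A = l B \<or>
      sector U False True p \<and> p = (l A, b A) \<and> t B = b A"
    and "(\<And>sx. \<not> sector U sx True p) \<Longrightarrow> b B = snd p \<Longrightarrow> r A = l B \<or> t A = b B"
    and "(\<And>sx. \<not> sector U sx True p) \<Longrightarrow> b A = snd p \<Longrightarrow> r A = l B \<or> b A = t B"
    and "(\<And>sy. \<not> sector U True sy p) \<Longrightarrow> l A = fst p \<Longrightarrow> l A = r B \<or> b A = t B"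
proof -
  note ar = arrow[OF assms]
  \<comment> \<open>These Booleans say in which directions \<open>A\<close> and \<open>B\<close>
    extend from \<open>p\<close>. Together with the four quadrants of the hole they make the claim a
    propositional problem, whose axioms are collected in \<open>facts\<close>.\<close>
  define aw ae as an where A: "aw \<longleftrightarrow> l A < fst p" "ae \<longleftrightarrow> fst p < r A" "as \<longleftrightarrow> b A < snd p" "an \<longleftrightarrow> snd p < t A"
  define bw be bs bn where B: "bw \<longleftrightarrow> l B < fst p" "be \<longleftrightarrow> fst p < r B" "bs \<longleftrightarrow> b B < snd p" "bn \<longleftrightarrow> snd p < t B"
  have box: "l A \<le> fst p" "fst p \<le> r A" "b A \<le> snd p" "snd p \<le> t A" "l B \<le> fst p" "fst p \<le> r B" "b B \<le> snd p" "snd p \<le> t B"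
    using ar(4,5) by (auto simp: mem_box_of)
  have covA: "covers sx sy p A \<longleftrightarrow> (if sx then ae else aw) \<and> (if sy then an else as)" for sx sy
    using box ar(1) by (auto simp: covers_iff A)
  have covB: "covers sx sy p B \<longleftrightarrow> (if sx then be else bw) \<and> (if sy then bn else bs)" for sx sy
    using box ar(2) by (auto simp: covers_iff B)
  have eqs: "\<not> aw \<Longrightarrow> l A = fst p" "\<not> ae \<Longrightarrow> r A = fst p" "\<not> as \<Longrightarrow> b A = snd p" "\<not> an \<Longrightarrow> t A = snd p"
    "\<not> bw \<Longrightarrow> l B = fst p" "\<not> be \<Longrightarrow> r B = fst p" "\<not> bs \<Longrightarrow> b B = snd p" "\<not> bn \<Longrightarrow> t B = snd p"
    using box unfolding A B by linarith+
  have "\<not> (covers sx sy p A \<and> covers sx sy p B)" for sx sy using covers_unique ar(3) by blast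
  note dis = this[of True True] this[of True False] this[of False True] this[of False False]
  have "sector U sx sy p \<Longrightarrow> \<not> covers sx sy p A \<and> \<not> covers sx sy p B" for sx sy using sector_not_covered by blast
  note fr = this[of True True] this[of True False] this[of False True] this[of False False]
  have some: "sector U True True p \<or> sector U True False p \<or> sector U False True p \<or> sector U False False p"
    using sector_exists[OF ar(6)] by (metis (full_types))
  have pos: "aw \<or> ae" "as \<or> an" "bw \<or> be" "bs \<or> bn"
    using lr[OF ar(1)] bt[OF ar(1)] lr[OF ar(2)] bt[OF ar(2)] unfolding A B by linarith+
  note facts = some pos dis[unfolded covA covB, simplified] fr[unfolded covA covB, simplified] ar(7-10)[unfolded covA covB, simplified]
  have "\<not> aw \<and> \<not> be \<or> \<not> an \<and> \<not> bs \<or>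
    sector U False False p \<and> \<not> sector U False True p \<and> \<not> sector U True False p \<or>
    sector U True False p \<and> \<not> bw \<and> \<not> bs \<and> \<not> ae \<or> sector U False True p \<and> \<not> aw \<and> \<not> as \<and> \<not> bn"
    using facts by argo
  then show "l A = r B \<or> t A = b B \<or>
      sector U False False p \<and> \<not> sector U False True p \<and> \<not> sector U True False p \<or>
      sector U True False p \<and> p = (l B, b B) \<and> r A = l B \<or>
      sector U False True p \<and> p = (l A, b A) \<and> t B = b A"
    using eqs by (metis prod.collapse)
  show "r A = l B \<or> t A = b B" if n: "\<And>sx. \<not> sector U sx True p" and e: "b B = snd p"
  proof -
    have "\<not> bs" using e B by simp
    then have "\<not> ae \<and> \<not> bw \<or> \<not> an" using facts n[of True] n[of False] by argo
    then show ?thesis using eqs e by auto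
  qed
  show "r A = l B \<or> b A = t B" if n: "\<And>sx. \<not> sector U sx True p" and e: "b A = snd p"
  proof -
    have "\<not> as" using e A by simp
    then have "\<not> ae \<and> \<not> bw \<or> \<not> bn" using facts n[of True] n[of False] by argo
    then show ?thesis using eqs e by auto
  qed
  show "l A = r B \<or> b A = t B" if n: "\<And>sy. \<not> sector U True sy p" and e: "l A = fst p"
  proof -
    have "\<not> aw" using e A by simp
    then have "\<not> be \<or> \<not> as \<and> \<not> bn" using facts n[of True] n[of False] by argo
    then show ?thesis using eqs e by auto
  qed
qed

lemma arrow_cases:
  assumes "k < length C" "A = C ! k" "B = C ! nx k" "p = pt (Suc k)"
  obtains (regular) "l A = r B \<or> t A = b B"
    | (upper_right) "sector U False False p" "\<not> sector U False True p" "\<not> sector U True False p"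
    | (below) "sector U True False p" "p = (l B, b B)" "r A = l B"
    | (beside) "sector U False True p" "p = (l A, b A)" "t B = b A"
  using arrow_types(1)[OF assms] by blast


text \<open>Some quadrant at \<open>q\<close> is free, necessarily on the other side of the
  horizontal axis; the box across the axis from it has its edge at the level of
  \<open>q\<close>.\<close>

lemma level_box:
  assumes "q \<in> closure U" "\<And>sx. \<not> sector U sx sy q"
  obtains G where "G \<in> I" "q \<in> box_of G" "snd q = (if sy then b G else t G)"
proof -
  obtain sx sy' where s': "sector U sx sy' q" using sector_exists[OF assms(1)] by blast
  have "sy' \<noteq> sy" using s' assms(2) by blast
  then have "sy' = (\<not> sy)" by auto
  then have s: "sector U sx (\<not> sy) q" using s' by simp
  then obtain G where "covers sx (\<not> (\<not> sy)) q G" using sector_or_covers_vertical[OF s] assms(2) by auto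
  then show ?thesis using that[of G] covers_edge_vertical[OF s, of G] by (auto simp: covers_def split: if_splits)
qed

lemma extremal_closure:
  obtains p q where "p \<in> closure U" "q \<in> closure U" "\<And>z. z \<in> closure U \<Longrightarrow> snd p \<le> snd z \<and> snd z \<le> snd q"
proof -
  have "compact (closure U)" "closure U \<noteq> {}" using bdU neU by (auto simp: compact_closure)
  moreover have "continuous_on (closure U) snd" by (intro continuous_intros)
  ultimately show ?thesis
    using continuous_attains_sup[of "closure U" snd] continuous_attains_inf[of "closure U" snd] that by metis
qed

lemma ceiling_exists:
  obtains q G where "q \<in> closure U" "\<And>z. z \<in> closure U \<Longrightarrow> snd z \<le> snd q"
    "G \<in> I" "q \<in> box_of G" "b G = snd q"
proof -
  obtain q where q: "q \<in> closure U" "\<And>z. z \<in> closure U \<Longrightarrow> snd z \<le> snd q" using extremal_closure by metis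
  have "\<not> sector U sx True q" for sx
  proof
    assume s: "sector U sx True q"
    obtain x y where "(x, y) \<in> U" "y \<in> side True (snd q) 1" using sector_meets[OF s zero_less_one] by metis
    then show False using q(2)[of "(x, y)"] closure_subset[of U] by (auto simp: side_def)
  qed
  then show ?thesis using level_box[OF q(1), of True] that[OF q] by metis
qed

lemma floor_exists:
  obtains q G where "q \<in> closure U" "\<And>z. z \<in> closure U \<Longrightarrow> snd q \<le> snd z"
    "G \<in> I" "q \<in> box_of G" "t G = snd q"
proof -
  obtain q where q: "q \<in> closure U" "\<And>z. z \<in> closure U \<Longrightarrow> snd q \<le> snd z" using extremal_closure by metis
  have "\<not> sector U sx False q" for sx
  proof
    assume s: "sector U sx False q"
    obtain x y where "(x, y) \<in> U" "y \<in> side False (snd q) 1" using sector_meets[OF s zero_less_one] by metis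
    then show False using q(2)[of "(x, y)"] closure_subset[of U] by (auto simp: side_def)
  qed
  then show ?thesis using level_box[OF q(1), of False] that[OF q] by metis
qed

end

section \<open>The top square, the end square and the start square\<close>

locale top_circuit = hole_circuit I l r b t U C g a
  for I :: "'i set" and l r b t U and C :: "'i list" and g a +
  fixes tp st :: nat
  assumes tp: "tp < length C" and st: "st < length C"
    and top_highest: "G \<in> set C \<Longrightarrow> b G \<le> b (C ! tp)"
    and top_rightmost: "G \<in> set C \<Longrightarrow> b G = b (C ! tp) \<Longrightarrow> r G \<le> r (C ! tp)"
    and start_lowest: "G \<in> set C \<Longrightarrow> t (C ! st) \<le> t G"
begin

lemma mem_C: "i \<in> I \<Longrightarrow> z \<in> box_of i \<Longrightarrow> z \<in> closure U \<Longrightarrow> i \<in> set C"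
  by (auto simp: set_C)

lemma covers_C: "covers sx sy p i \<Longrightarrow> p \<in> closure U \<Longrightarrow> i \<in> set C"
  using mem_C[of i p] unfolding covers_def by blast

text \<open>The box over a highest point of the hole is adjacent to the hole, so the top square has
  a bottom side at least as high.\<close>

lemma below_top: "z \<in> closure U \<Longrightarrow> snd z \<le> b (C ! tp)"
proof -
  obtain q G where "q \<in> closure U" "\<And>z. z \<in> closure U \<Longrightarrow> snd z \<le> snd q" "G \<in> I" "q \<in> box_of G" "b G = snd q"
    using ceiling_exists by metis
  then show "z \<in> closure U \<Longrightarrow> snd z \<le> b (C ! tp)" using top_highest[OF mem_C] by fastforce
qed

lemma start_below: "z \<in> closure U \<Longrightarrow> t (C ! st) \<le> snd z"
proof -
  obtain q G where "q \<in> closure U" "\<And>z. z \<in> closure U \<Longrightarrow> snd q \<le> snd z" "G \<in> I" "q \<in> box_of G" "t G = snd q"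
    using floor_exists by metis
  then show "z \<in> closure U \<Longrightarrow> t (C ! st) \<le> snd z" using start_lowest[OF mem_C] by fastforce
qed

lemma top_exit:
  "pt (Suc tp) \<in> closure U" "snd (pt (Suc tp)) = b (C ! tp)" "l (C ! tp) \<le> fst (pt (Suc tp))" "fst (pt (Suc tp)) \<le> r (C ! tp)"
proof -
  show c: "pt (Suc tp) \<in> closure U" using pt_closure[of "Suc tp"] tp by simp
  have "pt (Suc tp) \<in> box_of (C ! tp)" using pt_out[OF tp] .
  then show "snd (pt (Suc tp)) = b (C ! tp)" "l (C ! tp) \<le> fst (pt (Suc tp))" "fst (pt (Suc tp)) \<le> r (C ! tp)"
    using below_top[OF c] by (auto simp: mem_box_of)
qed

text \<open>Two boxes with the same bottom level are side by side. \<open>G\<close> cannot be to the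
  right of the rightmost one, and to its left it would end before the exit point.\<close>

lemma top_unique:
  assumes G: "G \<in> set C" "b G = b (C ! tp)" and l: "fst (pt (Suc tp)) < r G" shows "C ! tp = G"
proof (rule ccontr)
  assume n: "C ! tp \<noteq> G"
  have GI: "G \<in> I" using G(1) by (auto simp: set_C)
  have T: "C ! tp \<in> I" using C_mem[OF tp] .
  show False using disj[OF T GI n] G(2) top_rightmost[OF G] top_exit(3) l lr[OF GI] lr[OF T] bt[OF GI] bt[OF T] by auto
qed

text \<open>A bottom side is traversed to the right, and the hole lies under it just left of
  \<open>p\<close>. An exit before \<open>p\<close> would leave an exposed point of the side
  behind.\<close>

lemma ceiling_exit:
  assumes k: "k < length C" and s: "sector U False False p" and c: "covers False True p (C ! k)"
    and w: "snd (pt (Suc k)) = snd p" "fst (pt (Suc k)) \<le> fst p"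
  shows "pt (Suc k) = p"
proof (rule ccontr)
  assume "pt (Suc k) \<noteq> p"
  then have "fst p - fst (pt (Suc k)) > 0" using w by (auto simp: prod_eq_iff)
  note d = this
  have c': "covers False (\<not> False) p (C ! k)" using c by simp
  obtain x where e: "x \<in> side False (fst p) (fst p - fst (pt (Suc k)))" "l (C!k) < x" "x < r (C!k)" "exposed (C!k) (x, snd p)"
    using exposed_vertical[OF s c' d] by metis
  have p: "snd p = b (C!k)" using covers_edge_vertical[OF s c'] by simp
  have "x < fst (pt (Suc k))" using bottom_edge(2)[OF k e(2,3)] e(4) w(1) unfolding p by blast
  then show False using e(1) by (auto simp: side_def)
qed

text \<open>As the hole is confined to the lower left, \<open>p\<close> is at the level of the
  ceiling. By the rule for ties the top square is \<open>T\<close> or a box with its lower left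
  corner at \<open>p\<close>; both are left at \<open>p\<close>. The next box fills neither quadrant
  on the left, and one filling only the upper right quadrant would be the top square again.\<close>

lemma end_at_corner:
  assumes s: "sector U False False p" and T: "covers False True p T" and E: "covers True False p E"
    and U: "\<forall>z\<in>U. fst z < fst p \<and> snd z < snd p"
  shows "C ! nx tp = E" "C ! tp = T \<or> covers True True p (C ! tp)" "b (C ! tp) = snd p" "pt (Suc tp) = p"
proof -
  let ?w = "pt (Suc tp)"
  have pcl: "p \<in> closure U" using sector_closure[OF s] .
  have "b T = snd p" using covers_edge_vertical[OF s, of T] T by simp
  have bT: "b T = b (C ! tp)" "b T = snd p"
    using below_top[OF pcl] top_exit(1,2) closure_bounds(2)[OF U, of ?w] top_highest[OF covers_C[OF T pcl]] \<open>b T = snd p\<close> by auto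
  then show bp: "b (C ! tp) = snd p" by simp
  have w: "snd ?w = snd p" "fst ?w \<le> fst p" using top_exit(1,2) bT closure_bounds(1)[OF U, of ?w] by auto
  have rT: "fst p \<le> r T" "T \<in> I" using T by (auto simp: covers_iff)
  have tpI: "C ! tp \<in> I" using C_mem[OF tp] .
  have rtp: "r T \<le> r (C ! tp)" using top_rightmost[OF covers_C[OF T pcl] bT(1)] .
  have ptp: "p \<in> box_of (C ! tp)" using top_exit(3) w rT rtp bp bt[OF tpI] by (auto simp: mem_box_of)
  have or: "C ! tp = T \<or> (l (C ! tp) = fst p \<and> covers True True p (C ! tp))"
  proof (cases "l (C ! tp) < fst p")
    case True
    then have "covers False True p (C ! tp)" using ptp tpI bp bt[OF tpI] by (auto simp: covers_def)
    then show ?thesis using covers_unique[OF _ T] by blast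
  next
    case False
    then have "l (C ! tp) = fst p" using ptp by (auto simp: mem_box_of)
    then show ?thesis using ptp tpI bp bt[OF tpI] lr[OF tpI] by (auto simp: covers_def)
  qed
  then show "C ! tp = T \<or> covers True True p (C ! tp)" by blast
  show wp: "?w = p"
    using or
  proof
    assume "C ! tp = T"
    then show ?thesis using ceiling_exit[OF tp s _ w] T by simp
  next
    assume "l (C ! tp) = fst p \<and> covers True True p (C ! tp)"
    then show ?thesis using top_exit(3) w by (auto simp: prod_eq_iff)
  qed
  note ar = arrow[OF tp refl refl refl, unfolded wp]
  let ?B = "C ! nx tp"
  obtain sx sy where B: "covers sx sy p ?B" using covers_some[OF ar(2,5)] by blast
  have "\<not> covers False False p ?B" "\<not> covers False True p ?B"
    using sector_not_covered[OF s] ar(9)[OF s] by auto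
  then have "covers True True p ?B \<or> covers True False p ?B" using B by (cases sx; cases sy) auto
  moreover have "covers True False p ?B" if NE: "covers True True p ?B"
  proof (rule ccontr)
    assume n: "\<not> covers True False p ?B"
    have bB: "b ?B = b (C ! tp)" using NE n bp by (auto simp: covers_iff)
    have "fst ?w < r ?B" using NE wp by (auto simp: covers_iff)
    then show False using top_unique[OF covers_C[OF NE pcl] bB] ar(3) by simp
  qed
  ultimately show "?B = E" using covers_unique E by blast
qed

lemma end_at_notch:
  assumes n: "notch K Q Y"
  shows "C ! tp = K" "C ! nx tp = Q" "pt (Suc tp) = (l Q, b K)"
proof -
  let ?w = "pt (Suc tp)" and ?p = "(l Q, b K)"
  have n': "K \<in> I" "Q \<in> I" "r K = l Q" "b Q < b K" "b K < t Q" "l Q < l Y" "l Y < r Q"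
    "sector U False False ?p" "\<forall>z\<in>U. fst z < l Y \<and> snd z < b K"
    using n by (auto simp: notch_def)
  have pcl: "?p \<in> closure U" using sector_closure[OF n'(8)] .
  have K: "covers False True ?p K" using n'(1,3) lr[OF n'(1)] bt[OF n'(1)] by (auto simp: covers_iff)
  have Q: "covers True False ?p Q" "covers True True ?p Q" using n' by (auto simp: covers_iff)
  have bK: "b K = b (C ! tp)"
    using top_exit(1,2) closure_bounds(2)[OF n'(9), of ?w] top_highest[OF covers_C[OF K pcl]] by auto
  have "fst ?w \<le> l Y" using closure_bounds(1)[OF n'(9)] top_exit(1) by blast
  \<comment> \<open>At the level \<open>b K\<close> the points strictly right of \<open>l Q\<close>
    and up to \<open>l Y\<close> are interior to \<open>Q\<close>, so the exit is not among
    them.\<close>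
  then have "\<not> l Q < fst ?w"
    using interior_not_in_closure[OF n'(2), of "fst ?w" "snd ?w", unfolded prod.collapse] top_exit(1,2) bK n'(4,5,7) by linarith
  then have w: "snd ?w = snd ?p" "fst ?w \<le> fst ?p" using top_exit(2) bK by auto
  have tpI: "C ! tp \<in> I" using C_mem[OF tp] .
  have rtp: "l Q \<le> r (C ! tp)" using top_rightmost[OF covers_C[OF K pcl] bK] n'(3) by simp
  show tpK: "C ! tp = K"
  proof (cases "l (C ! tp) < l Q")
    case True
    then have "covers False True ?p (C ! tp)" using rtp tpI bK bt[OF tpI] by (auto simp: covers_iff)
    then show ?thesis using covers_unique[OF _ K] by blast
  next
    case False
    then have "covers True True ?p (C ! tp)" using top_exit(3) w rtp tpI bK bt[OF tpI] lr[OF tpI] by (auto simp: covers_iff)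
    then have "C ! tp = Q" using covers_unique[OF _ Q(2)] by blast
    then show ?thesis using bK n'(4) by simp
  qed
  show wp: "?w = ?p" using ceiling_exit[OF tp n'(8) _ w] K tpK by simp
  note ar = arrow[OF tp refl refl refl, unfolded wp]
  let ?B = "C ! nx tp"
  obtain sx sy where B: "covers sx sy ?p ?B" using covers_some[OF ar(2,5)] by blast
  have "\<not> covers False False ?p ?B" "\<not> covers False True ?p ?B"
    using sector_not_covered[OF n'(8)] ar(9)[OF n'(8)] by auto
  then have "covers True True ?p ?B \<or> covers True False ?p ?B" using B by (cases sx; cases sy) auto
  then show "?B = Q" using covers_unique Q by blast
qed

lemma final_corner_cases:
  obtains (convex) p T E where "sector U False False p" "covers False True p T" "covers True False p E"
      "\<forall>z\<in>U. fst z < fst p \<and> snd z < snd p"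
    | (notched) K Q Y where "notch K Q Y"
proof -
  obtain p T E where p: "sector U False False p" "covers False True p T" "covers True False p E"
    using upper_right_corner_exists .
  from corner[OF p] show ?thesis using that p by blast
qed

lemma start_neq_top: "st \<noteq> tp"
proof
  assume "st = tp"
  then show False using start_below[OF top_exit(1)] top_exit(2) bt[OF C_mem[OF tp]] by simp
qed

text \<open>The hole lies above the top of the start square, while the end square reaches at least
  up to the ceiling.\<close>

lemma start_neq_end: "st \<noteq> nx tp"
proof
  assume e: "st = nx tp"
  obtain z where z: "z \<in> U" using neU by blast
  have zc: "z \<in> closure U" using z closure_subset by blast
  show False
  proof (cases rule: final_corner_cases)
    case (convex p T E)
    have "snd p \<le> t E" using convex(3) by (auto simp: covers_iff)
    then show False using start_below[OF zc] end_at_corner(1)[OF convex] convex(4) z e by fastforce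
  next
    case (notched K Q Y)
    then have "b K < t Q" "snd z < b K" using z by (auto simp: notch_def)
    then show False using start_below[OF zc] end_at_notch(2)[OF notched] e by simp
  qed
qed

text \<open>Every other configuration in \<open>arrow_cases\<close> leads to an upper right corner,
  at the transition point or by sliding along an exposed corner. Since the corner determines the top
  and the end square, \<open>A\<close> or \<open>B\<close> would be one of these, or
  \<open>A\<close> and \<open>B\<close> would coincide.\<close>

lemma regular_arrow:
  assumes k: "k < length C" and ne: "k \<noteq> tp" "k \<noteq> nx tp" "nx k \<noteq> tp"
  shows "l (C ! k) = r (C ! nx k) \<or> t (C ! k) = b (C ! nx k)"
proof -
  let ?A = "C ! k" and ?B = "C ! nx k" and ?p = "pt (Suc k)"
  note ar = arrow[OF k refl refl refl]
  have nk: "nx k < length C" and nt: "nx tp < length C" using nx_less k tp by auto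
  have neI: "?A \<noteq> C ! tp" "?A \<noteq> C ! nx tp" "?B \<noteq> C ! tp" "?B \<noteq> C ! nx tp"
    using ne C_eq_iff[OF k tp] C_eq_iff[OF k nt] C_eq_iff[OF nk tp] C_eq_iff[OF nk nt] nx_inject[OF k tp] by auto
  show ?thesis
  proof (cases rule: arrow_cases[OF k refl refl refl, case_names regular upper_right below beside])
    case regular then show ?thesis .
  next
    case s: upper_right
    obtain T where T: "covers False True ?p T" using sector_or_covers_vertical[OF s(1)] s(2) by auto
    obtain E where E: "covers True False ?p E" using sector_or_covers_horizontal[OF s(1)] s(3) by auto
    have B: "covers True True ?p ?B \<or> covers True False ?p ?B"
    proof -
      obtain sx sy where "covers sx sy ?p ?B" using covers_some[OF ar(2,5)] by blast
      then show ?thesis using sector_not_covered[OF s(1), of ?B] ar(9)[OF s(1)] by (cases sx; cases sy) auto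
    qed
    have A: "covers True True ?p ?A \<or> covers False True ?p ?A"
    proof -
      obtain sx sy where "covers sx sy ?p ?A" using covers_some[OF ar(1,4)] by blast
      then show ?thesis using sector_not_covered[OF s(1), of ?A] ar(9)[OF s(1)] by (cases sx; cases sy) auto
    qed
    from corner[OF s(1) T E] have False
    proof (elim disjE exE conjE)
      assume U: "\<forall>z\<in>U. fst z < fst ?p \<and> snd z < snd ?p"
      note e = end_at_corner[OF s(1) T E U]
      have "\<not> covers True False ?p ?B" using covers_unique[OF _ E] e(1) neI(4) by blast
      then have NE: "covers True True ?p ?B" and bB: "b ?B = b (C ! tp)"
        using B e(3) by (auto simp: covers_iff)
      have "fst (pt (Suc tp)) < r ?B" using NE unfolding e(4) by (auto simp: covers_iff)
      then show False using top_unique[OF covers_C[OF NE ar(6)] bB] neI(3) by simp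
    next
      fix K Q Y assume n: "notch K Q Y" and p: "?p = (l Q, b K)"
      have "covers True True ?p Q" "covers True False ?p Q" using n unfolding p by (auto simp: notch_def covers_iff)
      then have "?B = Q" using B covers_unique by blast
      then show False using end_at_notch(2)[OF n] neI(4) by simp
    next
      fix K Q Y assume n: "notch K Q Y" and p: "?p = (l Y, b Q)"
      have "b Q < t Q" using n bt by (auto simp: notch_def)
      then have "covers True True ?p Q" "covers False True ?p Q" using n unfolding p by (auto simp: notch_def covers_iff)
      then have "?A = Q" using A covers_unique by blast
      then show False using end_at_notch(2)[OF n] neI(2) by simp
    qed
    then show ?thesis ..
  next
    case s: below
    have q: "sector U True False (l ?B, b ?B)" using s(1,2) by simp
    obtain Y where Y: "Y \<in> I" "t Y = b ?B" "l ?B < l Y" "l Y < r ?B"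
      "(\<forall>z\<in>U. fst z < l Y \<and> snd z < b ?B) \<or> (\<exists>K. notch K ?B Y)"
      using bottom_exposed_corner[OF ar(2) q] by metis
    have Bp: "covers True True ?p ?B" using ar(2) lr[OF ar(2)] bt[OF ar(2)] unfolding s(2) by (auto simp: covers_iff)
    from Y(5) have False
    proof
      assume U: "\<forall>z\<in>U. fst z < l Y \<and> snd z < b ?B"
      have "b ?B = b (C ! tp)" using top_highest[OF covers_C[OF Bp ar(6)]] closure_bounds(2)[OF U top_exit(1)] top_exit(2) by simp
      moreover have "fst (pt (Suc tp)) < r ?B" using closure_bounds(1)[OF U top_exit(1)] Y(4) by simp
      ultimately show False using top_unique[OF covers_C[OF Bp ar(6)]] neI(3) by simp
    next
      assume "\<exists>K. notch K ?B Y"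
      then have n: "sector U False False ?p" "sector U True False ?p" "sector U False True ?p" unfolding s(2) by (auto simp: notch_def)
      \<comment> \<open>Three free quadrants leave only the upper right one to \<open>?A\<close>,
        and this one is filled by \<open>?B\<close>.\<close>
      obtain sx sy where "covers sx sy ?p ?A" using covers_some[OF ar(1,4)] by blast
      then have "covers True True ?p ?A" using n[THEN sector_not_covered, of ?A] by (cases sx; cases sy) auto
      then show False using covers_unique[OF Bp] ar(3) by simp
    qed
    then show ?thesis ..
  next
    case s: beside
    have q: "sector U False True (l ?A, b ?A)" using s(1,2) by simp
    obtain K where K: "K \<in> I" "r K = l ?A" "b ?A < b K" "b K < t ?A" "sector U False False (l ?A, b K)"
      "(\<forall>z\<in>U. fst z < l ?A \<and> snd z < b K) \<or> (\<exists>Y. notch K ?A Y)"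
      using left_exposed_corner[OF ar(1) q] by metis
    have Ap: "covers True True ?p ?A" using ar(1) lr[OF ar(1)] bt[OF ar(1)] unfolding s(2) by (auto simp: covers_iff)
    from K(6) have False
    proof
      assume U: "\<forall>z\<in>U. fst z < l ?A \<and> snd z < b K"
      have "covers False True (l ?A, b K) K" "covers True False (l ?A, b K) ?A"
        using K lr[OF K(1)] bt[OF K(1)] ar(1) lr[OF ar(1)] by (auto simp: covers_iff)
      from end_at_corner(1)[OF K(5) this] U show False using neI(2) by simp
    next
      assume "\<exists>Y. notch K ?A Y"
      then have n: "sector U False False ?p" "sector U True False ?p" "sector U False True ?p" unfolding s(2) by (auto simp: notch_def)
      obtain sx sy where "covers sx sy ?p ?B" using covers_some[OF ar(2,5)] by blast
      then have "covers True True ?p ?B" using n[THEN sector_not_covered, of ?B] by (cases sx; cases sy) auto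
      then show False using covers_unique[OF Ap] ar(3) by simp
    qed
    then show ?thesis ..
  qed
qed

lemma no_sector_above_top: "snd p = b (C ! tp) \<Longrightarrow> \<not> sector U sx True p"
proof
  assume p: "snd p = b (C ! tp)" and s: "sector U sx True p"
  obtain x y where "(x, y) \<in> U" "y \<in> side True (snd p) 1" using sector_meets[OF s zero_less_one] by metis
  then show False using below_top[of "(x, y)"] closure_subset[of U] p by (auto simp: side_def)
qed

lemma arrow_into_top:
  assumes k: "k < length C" and n: "nx k = tp"
  shows "r (C ! k) = l (C ! tp) \<or> t (C ! k) = b (C ! tp)"
proof -
  note ar = arrow[OF k refl refl refl, unfolded n]
  have p: "snd (pt (Suc k)) = b (C ! tp)" using below_top[OF ar(6)] ar(5) by (auto simp: mem_box_of)
  show ?thesis using arrow_types(2)[OF k refl refl refl] no_sector_above_top[OF p] p unfolding n by simp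
qed

lemma arrow_out_of_top: "r (C ! tp) = l (C ! nx tp) \<or> b (C ! tp) = t (C ! nx tp)"
  using arrow_types(3)[OF tp refl refl refl] no_sector_above_top[OF top_exit(2)] top_exit(2) by simp

text \<open>At a convex corner the hole lies left of the end square, so no quadrant to the right is
  free. At a notch the transition is not on the left side of \<open>Q\<close>, because
  \<open>K\<close> is its lowest left support and its corner is exposed; hence the next box touches
  its bottom side.\<close>

lemma arrow_out_of_end:
  assumes k: "k = nx tp" shows "l (C ! k) = r (C ! nx k) \<or> b (C ! k) = t (C ! nx k)"
proof -
  have kl: "k < length C" using k nx_less[OF tp] by simp
  let ?p = "pt (Suc k)"
  note ar = arrow[OF kl refl refl refl]
  show ?thesis
  proof (cases rule: final_corner_cases)
    case (convex q T E)
    have E: "C ! k = E" using end_at_corner(1)[OF convex] k by simp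
    have "l E = fst q" using covers_edge_horizontal[OF convex(1), of E] convex(3) by simp
    then have p: "l (C ! k) = fst ?p"
      using closure_bounds(1)[OF convex(4) ar(6)] ar(4) E by (auto simp: mem_box_of)
    have "\<not> sector U True sy ?p" for sy
    proof
      assume "sector U True sy ?p"
      then obtain x y where "(x, y) \<in> U" "x \<in> side True (fst ?p) 1" using sector_meets[OF _ zero_less_one] by metis
      then show False using convex(4) p E \<open>l E = fst q\<close> by (auto simp: side_def)
    qed
    then show ?thesis using arrow_types(4)[OF kl refl refl refl] p by simp
  next
    case (notched K Q Y)
    have Q: "C ! k = Q" using end_at_notch(2)[OF notched] k by simp
    have n: "Q \<in> I" "b Q < b K" "b K < t Q" "l Q < l Y" "l Y < r Q"
      "sector U False False (l Q, b K)" "sector U False True (l Q, b Q)" "sector U False False (l Q, b Q)" "sector U True False (l Q, b Q)"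
      "\<And>j. j \<in> I \<Longrightarrow> r j = l Q \<Longrightarrow> b j < b K \<Longrightarrow> t j \<le> b Q" "\<forall>z\<in>U. fst z < l Y \<and> snd z < b K"
      using notched by (auto simp: notch_def)
    let ?B = "C ! nx k"
    have pc: "fst ?p \<le> l Y" "snd ?p \<le> b K" using closure_bounds[OF n(11) ar(6)] .
    have pQ: "l Q \<le> fst ?p" "b Q \<le> snd ?p" using ar(4) by (auto simp: mem_box_of Q)
    have pB: "l ?B \<le> fst ?p" "fst ?p \<le> r ?B" "b ?B \<le> snd ?p" "snd ?p \<le> t ?B" using ar(5) by (auto simp: mem_box_of)
    have Bp: "l ?B < r ?B" "b ?B < t ?B" using lr[OF ar(2)] bt[OF ar(2)] .
    have dis: "r Q \<le> l ?B \<or> r ?B \<le> l Q \<or> t Q \<le> b ?B \<or> t ?B \<le> b Q" using disj[OF n(1) ar(2)] ar(3) Q by simp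
    have edge: "fst ?p = l Q \<or> snd ?p = b Q"
      using interior_not_in_closure[OF n(1), of "fst ?p" "snd ?p", unfolded prod.collapse] ar(6) pc pQ n(3,5)
      by linarith
    have "t ?B = b Q"
    proof (cases "snd ?p = b Q")
      case snd: True
      show ?thesis
      proof (cases "fst ?p = l Q")
        case True
        then have p: "?p = (l Q, b Q)" using snd by (simp add: prod_eq_iff)
        obtain sx sy where "covers sx sy ?p ?B" using covers_some[OF ar(2,5)] by blast
        then have "covers True True ?p ?B" using n(7-9)[THEN sector_not_covered, of ?B] unfolding p by (cases sx; cases sy) auto
        moreover have "covers True True ?p Q" using n unfolding p by (auto simp: covers_iff)
        ultimately show ?thesis using covers_unique[of True True ?p ?B Q] ar(3) Q by simp
      next
        case False
        then show ?thesis using dis pB Bp pc pQ n(3,5) snd n(2) by linarith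
      qed
    next
      case False
      then have x: "fst ?p = l Q" using edge by simp
      have y: "b Q < snd ?p" using False pQ by simp
      \<comment> \<open>The orientation rule forbids leaving \<open>Q\<close> at the corner under
        \<open>K\<close>.\<close>
      have "snd ?p \<noteq> b K"
      proof
        assume "snd ?p = b K"
        then have p: "?p = (l Q, b K)" using x by (simp add: prod_eq_iff)
        have "covers True False ?p Q" using n unfolding p by (auto simp: covers_iff)
        then show False using ar(9) n(6) Q unfolding p by simp
      qed
      then have yK: "snd ?p < b K" using pc by simp
      have "r ?B = l Q" using dis pB Bp pc pQ n(3,4,5) x y yK by linarith
      then show ?thesis using n(10)[OF ar(2)] pB y yK by linarith
    qed
    then show ?thesis using Q by simp
  qed
qed

text \<open>The top path and the reversed bottom path are the runs \<open>st, st + 1, \<dots>\<close> and \<open>\<dots>, st - 1, st\<close> of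
  the circuit between the end square and the top square.\<close>

theorem circuit_structure:
  defines "m \<equiv> length C" and "en \<equiv> nx tp" and "pre \<equiv> cprev (length C) tp" and "pen \<equiv> nx (nx tp)"
  shows "\<forall>j < cdist m st pre. l (C ! ((st + j) mod m)) = r (C ! ((st + j + 1) mod m)) \<or>
      t (C ! ((st + j) mod m)) = b (C ! ((st + j + 1) mod m))" (is ?top_path)
    and "r (C ! pre) = l (C ! tp) \<or> t (C ! pre) = b (C ! tp)"
    and "r (C ! tp) = l (C ! en) \<or> b (C ! tp) = t (C ! en)"
    and "\<forall>j < cdist m pen st. r (C ! ((st + m - j) mod m)) = l (C ! ((st + m - j - 1) mod m)) \<or>
      b (C ! ((st + m - j) mod m)) = t (C ! ((st + m - j - 1) mod m))" (is ?bottom_path)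
    and "r (C ! pen) = l (C ! en) \<or> t (C ! pen) = b (C ! en)"
proof -
  have m2: "2 \<le> m" using two_boxes by (simp add: m_def)
  have tpm: "tp < m" and stm: "st < m" using tp st by (auto simp: m_def)
  have en: "en = (if tp + 1 < m then tp + 1 else 0)"
    using tpm m2 by (auto simp: en_def cnext_def add_mod_if m_def)
  have enm: "en < m" using en m2 by auto
  have pen: "pen = (if en + 1 < m then en + 1 else 0)"
    using enm m2 unfolding pen_def en_def[symmetric] by (auto simp: cnext_def add_mod_if m_def)
  have pre: "pre = (if tp = 0 then m - 1 else tp - 1)"
    using tpm m2 unfolding pre_def cprev_def m_def[symmetric] by (auto simp: add_mod_if)
  have prem: "pre < m" and penm: "pen < m" using pre pen tpm m2 by auto
  have nxpre: "nx pre = tp" using pre tpm m2 by (auto simp: cnext_def m_def add_mod_if)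
  have ne: "st \<noteq> tp" "st \<noteq> en" using start_neq_top start_neq_end by (simp_all add: en_def)
  \<comment> \<open>Only the arrows out of \<open>pre\<close>, \<open>tp\<close> and
    \<open>en\<close> are exceptional.\<close>
  have reg: "l (C ! k) = r (C ! nx k) \<or> t (C ! k) = b (C ! nx k)" if "k < m" "k \<noteq> tp" "k \<noteq> en" "k \<noteq> pre" for k
  proof -
    have "nx k \<noteq> tp" using nxpre nx_inject[of k pre] that prem by (auto simp: m_def)
    then show ?thesis using regular_arrow[of k] that by (simp add: m_def en_def)
  qed
  show ?top_path
  proof (intro allI impI)
    fix j assume j: "j < cdist m st pre"
    have cd: "cdist m st pre = (if st \<le> pre then pre - st else pre + m - st)"
      using stm prem by (auto simp: cdist_def add_mod_if)
    let ?k = "(st + j) mod m"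
    have jm: "j < m" using j cd prem stm by (auto split: if_splits)
    have k: "?k = (if st + j < m then st + j else st + j - m)" using stm jm by (intro add_mod_if) simp
    have km: "?k < m" using m2 by simp
    have nk: "nx ?k = (st + j + 1) mod m" by (simp add: cnext_def m_def[symmetric] mod_Suc_eq)
    have "?k \<noteq> tp" "?k \<noteq> en" "?k \<noteq> pre"
      using j[unfolded cd] stm tpm ne m2 unfolding k en pre by (auto split: if_splits)
    from reg[OF km this] show "l (C ! ?k) = r (C ! ((st + j + 1) mod m)) \<or> t (C ! ?k) = b (C ! ((st + j + 1) mod m))"
      unfolding nk .
  qed
  show ?bottom_path
  proof (intro allI impI)
    fix j assume j: "j < cdist m pen st"
    have cd: "cdist m pen st = (if pen \<le> st then st - pen else st + m - pen)"
      using stm penm by (auto simp: cdist_def add_mod_if)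
    have jm: "j < m" using j cd penm stm by (auto split: if_splits)
    \<comment> \<open>The arrow of the bottom path is the reverse of the circuit arrow out of
      \<open>?k\<close>, which exchanges left with right and up with down.\<close>
    let ?k = "(st + m - j - 1) mod m"
    have k: "?k = (if st + m - j - 1 < m then st + m - j - 1 else st + m - j - 1 - m)" using stm jm by (intro add_mod_if) simp
    have km: "?k < m" using m2 by simp
    have "nx ?k = (st + m - j - 1 + 1) mod m" by (simp add: cnext_def m_def[symmetric] mod_Suc_eq)
    moreover have "st + m - j - 1 + 1 = st + m - j" using jm by simp
    ultimately have nk: "nx ?k = (st + m - j) mod m" by simp
    have kk: "(pen \<le> st \<and> pen \<le> ?k \<and> ?k < st) \<or> (st < pen \<and> (?k < st \<or> pen \<le> ?k))"
      using j[unfolded cd] stm jm unfolding k by (auto split: if_splits)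
    obtain k' where k': "k' = ?k" by simp
    have "k' \<noteq> tp" "k' \<noteq> en" "k' \<noteq> pre"
      using kk km stm tpm ne m2 unfolding pen en pre k'[symmetric] by (auto split: if_splits)
    then have "?k \<noteq> tp" "?k \<noteq> en" "?k \<noteq> pre" unfolding k' by auto
    from reg[OF km this] show "r (C ! ((st + m - j) mod m)) = l (C ! ?k) \<or> b (C ! ((st + m - j) mod m)) = t (C ! ?k)"
      unfolding nk by auto
  qed
  show "r (C ! pre) = l (C ! tp) \<or> t (C ! pre) = b (C ! tp)"
    using arrow_into_top nxpre prem by (simp add: m_def)
  show "r (C ! tp) = l (C ! en) \<or> b (C ! tp) = t (C ! en)" using arrow_out_of_top by (simp add: en_def)
  show "r (C ! pen) = l (C ! en) \<or> t (C ! pen) = b (C ! en)"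
    using arrow_out_of_end[OF refl] by (auto simp: en_def pen_def)
qed

end

section \<open>Bottom-left packings\<close>

lemma Inf_face:
  assumes "z \<in> A" "f z = m" "\<And>p. p \<in> A \<Longrightarrow> m \<le> f p"
  shows "Inf ((\<lambda>p. ereal (f p)) ` A) = ereal m"
proof (rule antisym)
  show "Inf ((\<lambda>p. ereal (f p)) ` A) \<le> ereal m" using INF_lower[OF assms(1), of "\<lambda>p. ereal (f p)"] assms(2) by simp
  show "ereal m \<le> Inf ((\<lambda>p. ereal (f p)) ` A)" by (rule INF_greatest) (simp add: assms(3))
qed

lemma Sup_face:
  assumes "z \<in> A" "f z = m" "\<And>p. p \<in> A \<Longrightarrow> f p \<le> m"
  shows "Sup ((\<lambda>p. ereal (f p)) ` A) = ereal m"
proof (rule antisym)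
  show "ereal m \<le> Sup ((\<lambda>p. ereal (f p)) ` A)" using SUP_upper[OF assms(1), of "\<lambda>p. ereal (f p)"] assms(2) by simp
  show "Sup ((\<lambda>p. ereal (f p)) ` A) \<le> ereal m" by (rule SUP_least) (simp add: assms(3))
qed

lemma mem_sq: "z \<in> sq p c \<longleftrightarrow> fst p \<le> fst z \<and> fst z \<le> fst p + c \<and> snd p \<le> snd z \<and> snd z \<le> snd p + c"
  by (simp add: sq_def mem_Times_iff conj_assoc)

lemma mem_strip: "z \<in> strip W \<longleftrightarrow> 0 \<le> fst z \<and> fst z \<le> W \<and> 0 \<le> snd z"
  by (simp add: strip_def mem_Times_iff conj_assoc)

lemma faces_sq:
  assumes "0 < c"
  shows "lf (sq p c) = ereal (fst p)" "rf (sq p c) = ereal (fst p + c)"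
    "bf (sq p c) = ereal (snd p)" "tf (sq p c) = ereal (snd p + c)"
proof -
  have "p \<in> sq p c" "(fst p + c, snd p + c) \<in> sq p c" using assms by (simp_all add: mem_sq)
  then show "lf (sq p c) = ereal (fst p)" "rf (sq p c) = ereal (fst p + c)"
    "bf (sq p c) = ereal (snd p)" "tf (sq p c) = ereal (snd p + c)"
    unfolding lf_def rf_def bf_def tf_def
    using Inf_face[of p "sq p c" fst] Inf_face[of p "sq p c" snd]
      Sup_face[of "(fst p + c, snd p + c)" "sq p c" fst] Sup_face[of "(fst p + c, snd p + c)" "sq p c" snd]
    by (simp_all add: mem_sq)
qed

lemma Sup_ray: "Sup ((\<lambda>p. ereal (snd p)) ` ({c} \<times> {0..})) = \<infinity>"
proof (rule SUP_PInfty)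
  show "\<exists>p\<in>{c} \<times> {0..}. ereal (real k) \<le> ereal (snd p)" for k
    by (rule bexI[of _ "(c, real k)"]) auto
qed

lemma interior_sq: "interior (sq p c) = {fst p<..<fst p + c} \<times> {snd p<..<snd p + c}"
  by (simp add: sq_def interior_Times)

lemma interior_sq_disjoint_iff:
  assumes "0 < c" "0 < d"
  shows "interior (sq p c) \<inter> interior (sq q d) = {} \<longleftrightarrow>
    fst p + c \<le> fst q \<or> fst q + d \<le> fst p \<or> snd p + c \<le> snd q \<or> snd q + d \<le> snd p"
proof -
  have "interior (sq p c) \<inter> interior (sq q d) =
      {max (fst p) (fst q)<..<min (fst p + c) (fst q + d)} \<times> {max (snd p) (snd q)<..<min (snd p + c) (snd q + d)}"
    unfolding interior_sq by auto
  then show ?thesis using assms by (auto simp: greaterThanLessThan_empty_iff)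
qed

text \<open>The coordinates are abstract so that the same argument moves a square to the left and
  downwards. The step is limited by the nearest different end coordinate and by the boundary of the
  strip.\<close>

lemma slide:
  fixes x y s :: "nat \<Rightarrow> real"
  assumes pos: "0 < x j"
    and no: "\<forall>k<j. x k + s k = x j \<longrightarrow> y j + s j \<le> y k \<or> y k + s k \<le> y j"
    and sep: "\<forall>k<j. x j + s j \<le> x k \<or> x k + s k \<le> x j \<or> y j + s j \<le> y k \<or> y k + s k \<le> y j"
  shows "\<exists>d>0. d \<le> x j \<and> (\<forall>k<j. x j - d + s j \<le> x k \<or> x k + s k \<le> x j - d \<or> y j + s j \<le> y k \<or> y k + s k \<le> y j)"
proof -
  obtain e where e: "e > 0" "\<And>c. c \<in> (\<lambda>k. x k + s k) ` {..<j} \<Longrightarrow> c = x j \<or> e \<le> \<bar>c - x j\<bar>"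
    using finite_gap[of "(\<lambda>k. x k + s k) ` {..<j}" "x j"] by blast
  define d where "d = min e (x j)"
  have d: "d > 0" "d \<le> e" "d \<le> x j" using e(1) pos by (auto simp: d_def)
  have "x j - d + s j \<le> x k \<or> x k + s k \<le> x j - d \<or> y j + s j \<le> y k \<or> y k + s k \<le> y j" if k: "k < j" for k
    using spec[OF no, of k] spec[OF sep, of k] e(2)[of "x k + s k"] d k by force
  then show ?thesis using d by blast
qed

section \<open>Supports of squares in a bottom-left packing\<close>

locale packing =
  fixes W :: real and n i :: nat and s :: "nat \<Rightarrow> real" and P :: "nat \<Rightarrow> point"
  assumes W_pos: "W > 0" and sizes: "j < n \<Longrightarrow> 0 < s j"
    and bl: "bl_packing W n s P" and i_le: "i \<le> n"
begin

lemma feasible_iff: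
  assumes "j < n"
  shows "feasible W s P j q \<longleftrightarrow> 0 \<le> fst q \<and> fst q + s j \<le> W \<and> 0 \<le> snd q \<and>
    (\<forall>k<j. fst q + s j \<le> fst (P k) \<or> fst (P k) + s k \<le> fst q \<or> snd q + s j \<le> snd (P k) \<or> snd (P k) + s k \<le> snd q)"
proof -
  have "sq q (s j) \<subseteq> strip W \<longleftrightarrow> 0 \<le> fst q \<and> fst q + s j \<le> W \<and> 0 \<le> snd q"
  proof
    assume "sq q (s j) \<subseteq> strip W"
    moreover have "q \<in> sq q (s j)" "(fst q + s j, snd q) \<in> sq q (s j)" using sizes[OF assms] by (auto simp: mem_sq)
    ultimately have "q \<in> strip W" "(fst q + s j, snd q) \<in> strip W" by blast+
    then show "0 \<le> fst q \<and> fst q + s j \<le> W \<and> 0 \<le> snd q" by (simp add: mem_strip)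
  next
    assume *: "0 \<le> fst q \<and> fst q + s j \<le> W \<and> 0 \<le> snd q"
    show "sq q (s j) \<subseteq> strip W"
    proof
      fix z assume "z \<in> sq q (s j)"
      then show "z \<in> strip W" using * unfolding mem_sq mem_strip by linarith
    qed
  qed
  moreover have "interior (sq q (s j)) \<inter> interior (sq (P k) (s k)) = {} \<longleftrightarrow>
      fst q + s j \<le> fst (P k) \<or> fst (P k) + s k \<le> fst q \<or> snd q + s j \<le> snd (P k) \<or> snd (P k) + s k \<le> snd q"
    if "k < j" for k
    using interior_sq_disjoint_iff[of "s j" "s k"] sizes assms that by simp
  ultimately show ?thesis by (simp add: feasible_def)
qed

lemma placed: "j < n \<Longrightarrow> feasible W s P j (P j)"
  and minimal: "j < n \<Longrightarrow> feasible W s P j q \<Longrightarrow> yx_le (P j) q"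
  using bl unfolding bl_packing_def by blast+

lemma in_strip:
  assumes "j < n" shows "0 \<le> fst (P j)" "fst (P j) + s j \<le> W" "0 \<le> snd (P j)"
  using placed[OF assms, unfolded feasible_iff[OF assms]] by blast+

lemma apart:
  assumes "j < n" "k < n" "j \<noteq> k"
  shows "fst (P j) + s j \<le> fst (P k) \<or> fst (P k) + s k \<le> fst (P j) \<or> snd (P j) + s j \<le> snd (P k) \<or> snd (P k) + s k \<le> snd (P j)"
proof (cases "k < j")
  case True
  then show ?thesis using placed[OF assms(1)] feasible_iff[OF assms(1)] by blast
next
  case False
  then have "j < k" using assms(3) by simp
  then show ?thesis using placed[OF assms(2)] feasible_iff[OF assms(2)] by blast
qed

text \<open>Without a support the square could be moved left, to a feasible position that comes
  earlier in the placement order.\<close>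

lemma square_left_support:
  assumes "j < n"
  shows "fst (P j) = 0 \<or> (\<exists>k<j. fst (P k) + s k = fst (P j) \<and> snd (P k) < snd (P j) + s j \<and> snd (P j) < snd (P k) + s k)"
proof (rule ccontr)
  assume no: "\<not> ?thesis"
  note feas = placed[OF assms, unfolded feasible_iff[OF assms]]
  have "0 < fst (P j)" using no feas by auto
  moreover have "\<forall>k<j. fst (P k) + s k = fst (P j) \<longrightarrow> snd (P j) + s j \<le> snd (P k) \<or> snd (P k) + s k \<le> snd (P j)"
    using no by (auto simp: not_less)
  ultimately obtain d where d: "0 < d" "d \<le> fst (P j)" "\<forall>k<j. fst (P j) - d + s j \<le> fst (P k) \<or> fst (P k) + s k \<le> fst (P j) - d \<or>
      snd (P j) + s j \<le> snd (P k) \<or> snd (P k) + s k \<le> snd (P j)"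
    using slide[of "\<lambda>k. fst (P k)" j s "\<lambda>k. snd (P k)"] feas by blast
  then have "feasible W s P j (fst (P j) - d, snd (P j))" using feas unfolding feasible_iff[OF assms] by simp
  from minimal[OF assms this] show False using d(1) by (simp add: yx_le_def)
qed

lemma square_bottom_support:
  assumes "j < n"
  shows "snd (P j) = 0 \<or> (\<exists>k<j. snd (P k) + s k = snd (P j) \<and> fst (P k) < fst (P j) + s j \<and> fst (P j) < fst (P k) + s k)"
proof (rule ccontr)
  assume no: "\<not> ?thesis"
  note feas = placed[OF assms, unfolded feasible_iff[OF assms]]
  have "0 < snd (P j)" using no feas by auto
  moreover have "\<forall>k<j. snd (P k) + s k = snd (P j) \<longrightarrow> fst (P j) + s j \<le> fst (P k) \<or> fst (P k) + s k \<le> fst (P j)"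
    using no by (auto simp: not_less)
  ultimately obtain d where d: "0 < d" "d \<le> snd (P j)" "\<forall>k<j. snd (P j) - d + s j \<le> snd (P k) \<or> snd (P k) + s k \<le> snd (P j) - d \<or>
      fst (P j) + s j \<le> fst (P k) \<or> fst (P k) + s k \<le> fst (P j)"
    using slide[of "\<lambda>k. snd (P k)" j s "\<lambda>k. fst (P k)"] feas by blast
  then have "feasible W s P j (fst (P j), snd (P j) - d)" using feas unfolding feasible_iff[OF assms] by auto
  from minimal[OF assms this] show False using d(1) by (simp add: yx_le_def)
qed

abbreviation free_region :: "point set" where
  "free_region \<equiv> strip W - (\<Union>j<i. sq (P j) (s j))"

abbreviation nbhd :: "point \<Rightarrow> real \<Rightarrow> point set" where
  "nbhd z e \<equiv> {fst z - e<..<fst z + e} \<times> {snd z - e<..<snd z + e}"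

abbreviation open_strip :: "point set" where
  "open_strip \<equiv> {0<..<W} \<times> {0<..}"

text \<open>Free space only shrinks as squares are added, so \<open>B\<close> is free at every stage
  up to \<open>i\<close>. At each stage it lies in one component of what remains, unless it is
  already contained in older pieces. Hence removing older pieces never cuts a connected free
  set.\<close>

lemma old_pieces_dichotomy:
  assumes "connected B" "B \<subseteq> free_region" "k \<le> i"
  shows "B \<subseteq> \<Union>(old_pieces W s P k) \<or> B \<inter> \<Union>(old_pieces W s P k) = {}"
  using assms(3)
proof (induction k)
  case (Suc k)
  let ?V = "strip W - (\<Union>j<k. sq (P j) (s j)) - \<Union>(old_pieces W s P k)"
  show ?case
  proof (cases "B \<subseteq> \<Union>(old_pieces W s P k)")
    case True then show ?thesis by auto
  next
    case False
    then have dis: "B \<inter> \<Union>(old_pieces W s P k) = {}" using Suc by auto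
    have BV: "B \<subseteq> ?V" using assms(2) dis Suc.prems by fastforce
    show ?thesis
    proof (cases "\<exists>D\<in>new_pieces W s P k (old_pieces W s P k). B \<inter> D \<noteq> {}")
      case True
      then obtain D where D: "D \<in> new_pieces W s P k (old_pieces W s P k)" "B \<inter> D \<noteq> {}" by blast
      then have "D \<in> components ?V" by (simp add: new_pieces_def)
      then have "B \<subseteq> D" using components_maximal[OF _ assms(1) BV] D(2) by (metis inf_commute)
      then show ?thesis using D(1) by auto
    next
      case False
      then show ?thesis using dis by auto
    qed
  qed
qed auto

end

section \<open>Topology of an unoccupied piece\<close>

locale piece = packing +
  fixes U :: "point set"
  assumes U_piece: "U \<in> pieces W s P i"
begin

lemma U_component: "U \<in> components (free_region - \<Union>(old_pieces W s P i))"
  and bounded_U: "bounded U"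
  using U_piece unfolding pieces_def new_pieces_def by blast+

lemma U_free: "U \<subseteq> free_region"
  using in_components_subset[OF U_component] by blast

text \<open>So \<open>U\<close> behaves like a component of the free region itself.\<close>

lemma connected_subset_piece:
  assumes "connected B" "B \<subseteq> free_region" "B \<inter> U \<noteq> {}" shows "B \<subseteq> U"
proof -
  have "\<not> B \<subseteq> \<Union>(old_pieces W s P i)" using assms(3) in_components_subset[OF U_component] by blast
  then have "B \<subseteq> free_region - \<Union>(old_pieces W s P i)"
    using old_pieces_dichotomy[OF assms(1,2) order_refl] assms(2) by blast
  then show ?thesis using components_maximal[OF U_component assms(1)] assms(3) by (metis inf_commute)
qed

lemma nbhd_subset:
  assumes "open S" "z \<in> S" obtains e where "e > 0" "nbhd z e \<subseteq> S"
proof -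
  obtain A B where AB: "open A" "open B" "fst z \<in> A" "snd z \<in> B" "A \<times> B \<subseteq> S"
    using open_prod_elim[OF assms] by (metis mem_Times_iff)
  obtain d1 where d1: "d1 > 0" "ball (fst z) d1 \<subseteq> A" using AB(1,3) open_contains_ball by blast
  obtain d2 where d2: "d2 > 0" "ball (snd z) d2 \<subseteq> B" using AB(2,4) open_contains_ball by blast
  define m where "m = min d1 d2"
  have m: "0 < m" "m \<le> d1" "m \<le> d2" using d1(1) d2(1) by (auto simp: m_def)
  have "nbhd z m \<subseteq> A \<times> B"
  proof
    fix w assume w: "w \<in> nbhd z m"
    then have "fst w \<in> ball (fst z) d1" "snd w \<in> ball (snd z) d2"
      using m by (auto simp: mem_Times_iff dist_real_def abs_less_iff)
    then show "w \<in> A \<times> B" using d1(2) d2(2) by (auto simp: mem_Times_iff)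
  qed
  then show ?thesis using that[OF m(1)] AB(5) by blast
qed

text \<open>Off the squares, a small square around \<open>z\<close> meets the strip in a set that is
  convex, free and in contact with \<open>U\<close>.\<close>

lemma nbhd_piece:
  assumes "z \<in> closure U" "\<And>j. j < i \<Longrightarrow> z \<notin> sq (P j) (s j)"
  obtains e where "e > 0" "nbhd z e \<inter> strip W \<subseteq> U"
proof -
  have "closed (\<Union>j<i. sq (P j) (s j))" by (intro closed_UN) (auto simp: sq_def closed_Times)
  then have "open (- (\<Union>j<i. sq (P j) (s j)))" by (rule open_Compl)
  moreover have "z \<in> - (\<Union>j<i. sq (P j) (s j))" using assms(2) by blast
  ultimately obtain e where e: "e > 0" "nbhd z e \<subseteq> - (\<Union>j<i. sq (P j) (s j))"
    by (rule nbhd_subset)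
  have "open (nbhd z e)" "z \<in> nbhd z e" using e(1) by (auto intro: open_Times simp: mem_Times_iff)
  then have "nbhd z e \<inter> U \<noteq> {}" using assms(1) by (meson closure_iff_nhds_not_empty open_subset order_refl disjoint_iff)
  moreover have "U \<subseteq> strip W" using U_free by blast
  ultimately have "nbhd z e \<inter> strip W \<inter> U \<noteq> {}" by blast
  moreover have "connected (nbhd z e \<inter> strip W)"
    by (intro convex_connected convex_Int) (auto simp: strip_def intro!: convex_Times)
  ultimately have "nbhd z e \<inter> strip W \<subseteq> U" using connected_subset_piece e(2) by blast
  then show ?thesis using that e(1) by blast
qed

lemma nbhd_in_piece:
  assumes "z \<in> U" obtains e where "e > 0" "nbhd z e \<inter> strip W \<subseteq> U"
  using nbhd_piece[of z] assms U_free closure_subset[of U] by blast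

lemma near_open_strip:
  assumes "z \<in> strip W" "e > 0" obtains z' where "z' \<in> nbhd z e \<inter> open_strip"
proof -
  obtain d where d: "d > 0" "\<And>\<tau>. 0 < \<tau> \<Longrightarrow> \<tau> < d \<Longrightarrow> \<bar>\<tau> * (W/2 - fst z)\<bar> < e \<and> \<bar>\<tau> * 1\<bar> < e"
    using small_multiples[OF assms(2)] by metis
  define \<tau> where "\<tau> = min d 1 / 2"
  have \<tau>: "0 < \<tau>" "\<tau> < d" "\<tau> < 1" using d(1) by (auto simp: \<tau>_def min_def)
  have x: "0 < fst z - \<tau> * (fst z - W/2)" "fst z - \<tau> * (fst z - W/2) < W"
    using convex_comb_greater[OF \<tau>(1,3), of 0 "fst z" "W/2"] convex_comb_less[OF \<tau>(1,3), of "fst z" W "W/2"]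
      assms(1) W_pos by (simp_all add: mem_strip)
  \<comment> \<open>Pushing the point towards the middle line of the strip and upwards takes it off
    the walls and the floor.\<close>
  have "(fst z - \<tau> * (fst z - W/2), snd z + \<tau>) \<in> nbhd z e \<inter> open_strip"
    using d(2)[OF \<tau>(1,2)] x \<tau>(1) assms(1) by (auto simp: mem_strip abs_less_iff algebra_simps)
  then show ?thesis using that by blast
qed

text \<open>\<open>U\<close> may contain points on the walls and the floor and so need not be open.
  Its part in the open strip is open and has the same closure and frontier.\<close>

abbreviation V :: "point set" where "V \<equiv> U \<inter> open_strip"

lemma closure_V: "closure V = closure U"
proof
  have "U \<subseteq> closure V"
  proof
    fix z assume z: "z \<in> U"
    obtain e where e: "e > 0" "nbhd z e \<inter> strip W \<subseteq> U" using nbhd_in_piece[OF z] .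
    show "z \<in> closure V"
      unfolding closure_iff_nhds_not_empty
    proof (intro allI impI)
      fix A T assume T: "T \<subseteq> A" "open T" "z \<in> T"
      obtain d where d: "d > 0" "nbhd z d \<subseteq> T" using nbhd_subset[OF T(2,3)] .
      obtain z' where "z' \<in> nbhd z (min d e) \<inter> open_strip"
        using near_open_strip[of z "min d e"] z U_free d(1) e(1) by auto
      then have "z' \<in> nbhd z d" "z' \<in> nbhd z e \<inter> strip W" "z' \<in> open_strip" by (auto simp: mem_strip)
      then show "V \<inter> A \<noteq> {}" using d(2) e(2) T(1) by blast
    qed
  qed
  then show "closure U \<subseteq> closure V" by (simp add: closure_minimal)
qed (simp add: closure_mono)

lemma interior_U: "interior U = V"
proof
  have "interior (strip W) = open_strip" by (simp add: strip_def interior_Times interior_real_atLeast)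
  then show "interior U \<subseteq> V" using interior_mono[of U "strip W"] U_free interior_subset by blast
  show "V \<subseteq> interior U"
  proof
    fix z assume z: "z \<in> V"
    obtain e where e: "e > 0" "nbhd z e \<inter> strip W \<subseteq> U" using nbhd_in_piece[of z] z by blast
    have "open (nbhd z e \<inter> open_strip)" by (intro open_Int open_Times) auto
    moreover have "nbhd z e \<inter> open_strip \<subseteq> U" using e(2) by (auto simp: mem_strip)
    moreover have "z \<in> nbhd z e \<inter> open_strip" using z e(1) by (auto simp: mem_Times_iff)
    ultimately show "z \<in> interior U" by (meson interiorI)
  qed
qed

lemma open_V: "open V"
  using interior_U open_interior by metis

lemma V_nonempty: "V \<noteq> {}"
  using closure_V in_components_nonempty[OF U_component] closure_eq_empty by metis

text \<open>Near a boundary point of the strip the open strip is convex, so a separation of \<open>V\<close>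
  would extend to a separation of \<open>U\<close>.\<close>

lemma connected_V: "connected V"
proof (rule connectedI)
  fix A B assume AB: "open A" "open B" "A \<inter> V \<noteq> {}" "B \<inter> V \<noteq> {}" "A \<inter> B \<inter> V = {}" "V \<subseteq> A \<union> B"
  \<comment> \<open>\<open>G u\<close> says that \<open>V\<close> lies in \<open>A\<close> near
    \<open>u\<close>, which makes sense also for points of \<open>U\<close> on the walls and the
    floor.\<close>
  define G where "G u \<longleftrightarrow> (\<exists>e>0. nbhd u e \<inter> V \<subseteq> A)" for u
  have G_iff: "G z \<longleftrightarrow> z \<in> A" if "z \<in> V" for z
  proof
    assume "G z"
    then obtain e where "e > 0" "nbhd z e \<inter> V \<subseteq> A" by (auto simp: G_def)
    then show "z \<in> A" using that by (cases z) auto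
  next
    assume "z \<in> A"
    then show "G z" using nbhd_subset[OF AB(1)] unfolding G_def by (metis inf.coboundedI1)
  qed
  have loc: "\<exists>e>0. \<forall>z'\<in>U. \<bar>fst z' - fst z\<bar> < e \<and> \<bar>snd z' - snd z\<bar> < e \<longrightarrow> (G z' \<longleftrightarrow> G z)" if z: "z \<in> U" for z
  proof -
    obtain e where e: "e > 0" "nbhd z e \<inter> strip W \<subseteq> U" using nbhd_in_piece[OF z] .
    define N where "N = nbhd z e \<inter> open_strip"
    have NV: "N = nbhd z e \<inter> V" using e(2) by (auto simp: N_def mem_strip)
    have cN: "connected N" unfolding N_def by (intro convex_connected convex_Int convex_Times) auto
    have "A \<inter> B \<inter> N = {}" "N \<subseteq> A \<union> B" using AB(5,6) unfolding NV by blast+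
    from connectedD[OF cN AB(1,2) this] have or: "N \<subseteq> A \<or> N \<subseteq> B" using \<open>N \<subseteq> A \<union> B\<close> by blast
    have sub: "nbhd z' (e/2) \<subseteq> nbhd z e" if "\<bar>fst z' - fst z\<bar> < e/2" "\<bar>snd z' - snd z\<bar> < e/2" for z'
    proof
      fix w assume "w \<in> nbhd z' (e/2)"
      then have "fst z' - e/2 < fst w" "fst w < fst z' + e/2" "snd z' - e/2 < snd w" "snd w < snd z' + e/2"
        by (auto simp: mem_Times_iff)
      then have "fst z - e < fst w" "fst w < fst z + e" "snd z - e < snd w" "snd w < snd z + e"
        using that by linarith+
      then show "w \<in> nbhd z e" by (simp add: mem_Times_iff)
    qed
    have "G z' \<longleftrightarrow> N \<subseteq> A" if z': "z' \<in> U" "\<bar>fst z' - fst z\<bar> < e/2" "\<bar>snd z' - snd z\<bar> < e/2" for z'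
    proof
      assume "N \<subseteq> A"
      then have "nbhd z' (e/2) \<inter> V \<subseteq> A" using sub[OF z'(2,3)] NV by blast
      then show "G z'" unfolding G_def using e(1) by (intro exI[of _ "e/2"]) auto
    next
      assume "G z'"
      then obtain d where d: "d > 0" "nbhd z' d \<inter> V \<subseteq> A" by (auto simp: G_def)
      obtain y where y: "y \<in> nbhd z' (min d (e/2)) \<inter> open_strip"
        using near_open_strip[of z' "min d (e/2)"] z'(1) U_free d(1) e(1) by auto
      then have "y \<in> nbhd z' d" "y \<in> nbhd z' (e/2)" by auto
      then have "y \<in> N" "y \<in> nbhd z' d" using sub[OF z'(2,3)] y unfolding N_def by blast+
      then have "y \<in> A \<inter> V" using d(2) NV by blast
      then have "\<not> N \<subseteq> B" using AB(5) \<open>y \<in> N\<close> by blast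
      then show "N \<subseteq> A" using or by blast
    qed
    from this this[OF z] show ?thesis using e(1) by (intro exI[of _ "e/2"]) auto
  qed
  obtain p q where pq: "p \<in> A" "p \<in> V" "q \<in> B" "q \<in> V" using AB(3,4) by blast
  have "connected U" using in_components_connected[OF U_component] .
  moreover have "p \<in> U" "q \<in> U" "G p" using pq G_iff by blast+
  ultimately have "G q" using connected_locally_constant[of U G p q] loc by blast
  then show False using G_iff pq AB(5) by blast
qed

lemma closure_strip: "z \<in> closure U \<Longrightarrow> z \<in> strip W"
proof -
  have "closed (strip W)" by (auto simp: strip_def intro: closed_Times)
  then have "closure U \<subseteq> strip W" using U_free by (intro closure_minimal) auto
  then show "z \<in> closure U \<Longrightarrow> z \<in> strip W" by blast
qed

end

text \<open>The formal squares are thickened to rectangles of height at most \<open>H\<close>, placed so that the floor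
  supports both walls: the right wall starts at height \<open>-1\<close> and rests against the right end of the
  floor.\<close>

fun xmin :: "(nat \<Rightarrow> point) \<Rightarrow> real \<Rightarrow> fsq \<Rightarrow> real" where
  "xmin P W (Sq j) = fst (P j)" | "xmin P W SLeft = -1" | "xmin P W SRight = W" | "xmin P W SBottom = -1"

fun xmax :: "(nat \<Rightarrow> point) \<Rightarrow> (nat \<Rightarrow> real) \<Rightarrow> real \<Rightarrow> fsq \<Rightarrow> real" where
  "xmax P s W (Sq j) = fst (P j) + s j" | "xmax P s W SLeft = 0" | "xmax P s W SRight = W + 1" | "xmax P s W SBottom = W"

fun ymin :: "(nat \<Rightarrow> point) \<Rightarrow> fsq \<Rightarrow> real" where
  "ymin P (Sq j) = snd (P j)" | "ymin P SLeft = 0" | "ymin P SRight = -1" | "ymin P SBottom = -1"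

fun ymax :: "(nat \<Rightarrow> point) \<Rightarrow> (nat \<Rightarrow> real) \<Rightarrow> real \<Rightarrow> fsq \<Rightarrow> real" where
  "ymax P s H (Sq j) = snd (P j) + s j" | "ymax P s H SLeft = H" | "ymax P s H SRight = H" | "ymax P s H SBottom = 0"

lemma present_simps [simp]: "present i (Sq j) \<longleftrightarrow> j < i" "present i SLeft" "present i SRight" "present i SBottom"
  by (simp_all add: present_def)

lemma present_cases:
  assumes "present i F" obtains j where "F = Sq j" "j < i" | "F = SLeft" | "F = SRight" | "F = SBottom"
  using assms by (cases F) auto

lemma finite_present: "finite {F. present i F}"
proof (rule finite_subset)
  show "{F. present i F} \<subseteq> Sq ` {..<i} \<union> {SLeft, SRight, SBottom}"
    by (auto elim!: present_cases)
qed auto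

section \<open>Arrow types of the thickened squares\<close>

context packing begin

lemma faces_formal:
  "lf (fset W s P SLeft) = 0" "rf (fset W s P SLeft) = 0" "bf (fset W s P SLeft) = 0" "tf (fset W s P SLeft) = \<infinity>"
  "lf (fset W s P SRight) = W" "rf (fset W s P SRight) = W" "bf (fset W s P SRight) = 0" "tf (fset W s P SRight) = \<infinity>"
  "lf (fset W s P SBottom) = 0" "rf (fset W s P SBottom) = W" "bf (fset W s P SBottom) = 0" "tf (fset W s P SBottom) = 0"
proof -
  have side: "lf ({c} \<times> {0..}) = ereal c" "rf ({c} \<times> {0..}) = ereal c" "bf ({c} \<times> {0..}) = ereal 0" "tf ({c} \<times> {0..}) = \<infinity>" for c
    unfolding lf_def rf_def bf_def tf_def
    by (rule Inf_face[where z = "(c, 0)"] Sup_face[where z = "(c, 0)"] Sup_ray; auto)+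
  show "lf (fset W s P SLeft) = 0" "rf (fset W s P SLeft) = 0" "bf (fset W s P SLeft) = 0" "tf (fset W s P SLeft) = \<infinity>"
    "lf (fset W s P SRight) = W" "rf (fset W s P SRight) = W" "bf (fset W s P SRight) = 0" "tf (fset W s P SRight) = \<infinity>"
    using side by (simp_all add: zero_ereal_def)
  have "lf ({0..W} \<times> {0}) = ereal 0" "bf ({0..W} \<times> {0}) = ereal 0"
    unfolding lf_def bf_def by (rule Inf_face[where z = "(0, 0)"]; use W_pos in auto)+
  moreover have "rf ({0..W} \<times> {0}) = ereal W" "tf ({0..W} \<times> {0}) = ereal 0"
    unfolding rf_def tf_def by (rule Sup_face[where z = "(W, 0)"]; use W_pos in auto)+
  ultimately show "lf (fset W s P SBottom) = 0" "rf (fset W s P SBottom) = W" "bf (fset W s P SBottom) = 0" "tf (fset W s P SBottom) = 0"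
    by (simp_all add: zero_ereal_def)
qed

lemma faces_square:
  assumes "j < i"
  shows "lf (fset W s P (Sq j)) = ereal (fst (P j))" "rf (fset W s P (Sq j)) = ereal (fst (P j) + s j)"
    "bf (fset W s P (Sq j)) = ereal (snd (P j))" "tf (fset W s P (Sq j)) = ereal (snd (P j) + s j)"
  using faces_sq[of "s j" "P j"] sizes[of j] assms i_le by simp_all

lemma square_props:
  assumes "j < i"
  shows "0 < s j" "0 \<le> fst (P j)" "fst (P j) + s j \<le> W" "0 \<le> snd (P j)"
  using in_strip[of j] sizes[of j] assms i_le by simp_all

text \<open>Thickening changes a face only to one of the values -1, \<open>W + 1\<close> and
  \<open>H\<close>. By the bounds none of these equals the coordinate of an opposite side, so an
  equality between opposite sides of boxes is one between true faces.\<close>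

lemma box_faces:
  assumes "present i F" and H: "0 < H" "\<And>j. j < i \<Longrightarrow> snd (P j) + s j < H"
  shows "lf (fset W s P F) = ereal (xmin P W F) \<or> xmin P W F = -1" "xmin P W F \<le> W"
    "rf (fset W s P F) = ereal (xmax P s W F) \<or> xmax P s W F = W + 1" "0 \<le> xmax P s W F"
    "bf (fset W s P F) = ereal (ymin P F) \<or> ymin P F = -1" "ymin P F < H"
    "tf (fset W s P F) = ereal (ymax P s H F) \<or> ymax P s H F = H" "0 \<le> ymax P s H F"
proof -
  have "(lf (fset W s P F) = ereal (xmin P W F) \<or> xmin P W F = -1) \<and> xmin P W F \<le> W \<and>
    (rf (fset W s P F) = ereal (xmax P s W F) \<or> xmax P s W F = W + 1) \<and> 0 \<le> xmax P s W F \<and>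
    (bf (fset W s P F) = ereal (ymin P F) \<or> ymin P F = -1) \<and> ymin P F < H \<and>
    (tf (fset W s P F) = ereal (ymax P s H F) \<or> ymax P s H F = H) \<and> 0 \<le> ymax P s H F"
    using assms(1)
  proof (cases rule: present_cases)
    case (1 j)
    show ?thesis unfolding 1(1) faces_square[OF 1(2)] using square_props[OF 1(2)] H(2)[OF 1(2)] by simp
  next
    case 2 show ?thesis unfolding 2 faces_formal using W_pos H(1) by (simp add: zero_ereal_def)
  next
    case 3 show ?thesis unfolding 3 faces_formal using W_pos H(1) by (simp add: zero_ereal_def)
  next
    case 4 show ?thesis unfolding 4 faces_formal using W_pos H(1) by (simp add: zero_ereal_def)
  qed
  then show "lf (fset W s P F) = ereal (xmin P W F) \<or> xmin P W F = -1" "xmin P W F \<le> W"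
    "rf (fset W s P F) = ereal (xmax P s W F) \<or> xmax P s W F = W + 1" "0 \<le> xmax P s W F"
    "bf (fset W s P F) = ereal (ymin P F) \<or> ymin P F = -1" "ymin P F < H"
    "tf (fset W s P F) = ereal (ymax P s H F) \<or> ymax P s H F = H" "0 \<le> ymax P s H F"
    by blast+
qed

lemma box_types:
  assumes F: "present i F" and G: "present i G" and H: "0 < H" "\<And>j. j < i \<Longrightarrow> snd (P j) + s j < H"
  shows "xmin P W F = xmax P s W G \<Longrightarrow> left_type (fset W s P F) (fset W s P G)"
    "xmax P s W F = xmin P W G \<Longrightarrow> right_type (fset W s P F) (fset W s P G)"
    "ymax P s H F = ymin P G \<Longrightarrow> up_type (fset W s P F) (fset W s P G)"
    "ymin P F = ymax P s H G \<Longrightarrow> down_type (fset W s P F) (fset W s P G)"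
proof -
  note f = box_faces[OF F H] and g = box_faces[OF G H]
  show "left_type (fset W s P F) (fset W s P G)" if "xmin P W F = xmax P s W G"
  proof -
    have "xmin P W F \<noteq> -1" "xmax P s W G \<noteq> W + 1" using that f(2) g(4) by linarith+
    then show ?thesis using f(1) g(3) that by (simp add: left_type_def)
  qed
  show "right_type (fset W s P F) (fset W s P G)" if "xmax P s W F = xmin P W G"
  proof -
    have "xmin P W G \<noteq> -1" "xmax P s W F \<noteq> W + 1" using that g(2) f(4) by linarith+
    then show ?thesis using g(1) f(3) that by (simp add: right_type_def)
  qed
  show "up_type (fset W s P F) (fset W s P G)" if "ymax P s H F = ymin P G"
  proof -
    have "ymin P G \<noteq> -1" "ymax P s H F \<noteq> H" using that g(6) f(8) by linarith+
    then show ?thesis using g(5) f(7) that by (simp add: up_type_def)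
  qed
  show "down_type (fset W s P F) (fset W s P G)" if "ymin P F = ymax P s H G"
  proof -
    have "ymin P F \<noteq> -1" "ymax P s H G \<noteq> H" using that f(6) g(8) by linarith+
    then show ?thesis using f(5) g(7) that by (simp add: down_type_def)
  qed
qed

end

section \<open>The piece as a hole between thickened squares\<close>

locale piece_circuit = piece +
  fixes C :: "fsq list" and st tp :: nat
  assumes circuit: "boundary_circuit W s P i U C"
    and st_less: "st < length C" and start: "is_start W s P (set C) (C ! st)"
    and tp_less: "tp < length C" and top: "is_top W s P (set C) (C ! tp)"
begin

lemma height_bound:
  obtains H where "0 < H" "\<And>j. j < i \<Longrightarrow> snd (P j) + s j < H" "\<And>z. z \<in> closure U \<Longrightarrow> snd z < H"
proof -
  obtain M where M: "\<And>z. z \<in> closure U \<Longrightarrow> norm z \<le> M" using bounded_closure[OF bounded_U] by (auto simp: bounded_iff)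
  define H where "H = Max ((\<lambda>j. snd (P j) + s j) ` {..<i} \<union> {M, 0}) + 1"
  have *: "x < H" if "x \<in> (\<lambda>j. snd (P j) + s j) ` {..<i} \<union> {M, 0}" for x
    using Max_ge[OF _ that] unfolding H_def by fastforce
  show ?thesis
  proof (rule that[of H])
    show "0 < H" "\<And>j. j < i \<Longrightarrow> snd (P j) + s j < H" using * by auto
    fix z assume "z \<in> closure U"
    then have "norm z \<le> M" using M by blast
    moreover have "snd z \<le> norm z"
    proof -
      have "norm (snd z) \<le> norm z" by (metis norm_snd_le prod.collapse)
      then show ?thesis by simp
    qed
    ultimately show "snd z < H" using *[of M] by auto
  qed
qed

context
  fixes H :: real
  assumes H: "0 < H" "\<And>j. j < i \<Longrightarrow> snd (P j) + s j < H" "\<And>z. z \<in> closure U \<Longrightarrow> snd z < H"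
begin

abbreviation "boxes \<equiv> {F. present i F}"
abbreviation "xl \<equiv> xmin P W"
abbreviation "xr \<equiv> xmax P s W"
abbreviation "yb \<equiv> ymin P"
abbreviation "yt \<equiv> ymax P s H"

lemma hole_V: "hole boxes xl xr yb yt V"
proof
  show "finite boxes" by (rule finite_present)
  have cl: "0 \<le> fst z" "fst z \<le> W" "0 \<le> snd z" if "z \<in> closure V" for z
    using closure_strip[of z] that by (simp_all add: closure_V mem_strip)
  show "xl F < xr F" "yb F < yt F" if "F \<in> boxes" for F
    using that W_pos H(1) square_props(1) by (auto elim!: present_cases)
  show "xr F \<le> xl G \<or> xr G \<le> xl F \<or> yt F \<le> yb G \<or> yt G \<le> yb F" if "F \<in> boxes" "G \<in> boxes" "F \<noteq> G" for F G
  proof -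
    have F: "present i F" and G: "present i G" using that by auto
    have sq: "0 \<le> fst (P j)" "fst (P j) + s j \<le> W" "0 \<le> snd (P j)" if "j < i" for j using square_props[OF that] by auto
    show ?thesis using F
    proof (cases rule: present_cases)
      case F: (1 j)
      show ?thesis using G
      proof (cases rule: present_cases)
        case (1 k)
        then show ?thesis using apart[of j k] F that(3) i_le by auto
      qed (use F sq[OF F(2)] in auto)
    next
      case 2
      from G show ?thesis by (cases rule: present_cases) (use 2 sq W_pos that(3) in auto)
    next
      case 3
      from G show ?thesis by (cases rule: present_cases) (use 3 sq W_pos that(3) in auto)
    next
      case 4
      from G show ?thesis by (cases rule: present_cases) (use 4 sq W_pos that(3) in auto)
    qed
  qed
  show "(\<forall>z\<in>closure V. xl F < fst z) \<or> (\<exists>G\<in>boxes. xr G = xl F \<and> yb G < yt F \<and> yb F < yt G)" if "F \<in> boxes" for F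
  proof -
    have F: "present i F" using that by auto
    then show ?thesis
    proof (cases rule: present_cases)
      case (1 j)
      from square_left_support[of j] 1(2) i_le consider "fst (P j) = 0"
        | k where "k < j" "fst (P k) + s k = fst (P j)" "snd (P k) < snd (P j) + s j" "snd (P j) < snd (P k) + s k" by auto
      then show ?thesis
      proof cases
        \<comment> \<open>The left wall is taller than all squares and so supports every square
          standing at it.\<close>
        case 1
        then show ?thesis using \<open>F = Sq j\<close> square_props[OF \<open>j < i\<close>] H(2)[OF \<open>j < i\<close>]
          by (intro disjI2 bexI[of _ SLeft]) auto
      next
        case (2 k)
        then show ?thesis using \<open>F = Sq j\<close> \<open>j < i\<close> by (intro disjI2 bexI[of _ "Sq k"]) auto
      qed
    next
      case 2
      have "\<forall>z\<in>closure V. xl F < fst z" using cl(1) 2 by fastforce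
      then show ?thesis ..
    next
      case 3
      then show ?thesis using H(1) by (intro disjI2 bexI[of _ SBottom]) auto
    next
      case 4
      have "\<forall>z\<in>closure V. xl F < fst z" using cl(1) 4 by fastforce
      then show ?thesis ..
    qed
  qed
  show "(\<forall>z\<in>closure V. yb F < snd z) \<or> (\<exists>G\<in>boxes. yt G = yb F \<and> xl G < xr F \<and> xl F < xr G)" if "F \<in> boxes" for F
  proof -
    have F: "present i F" using that by auto
    then show ?thesis
    proof (cases rule: present_cases)
      case (1 j)
      from square_bottom_support[of j] 1(2) i_le consider "snd (P j) = 0"
        | k where "k < j" "snd (P k) + s k = snd (P j)" "fst (P k) < fst (P j) + s j" "fst (P j) < fst (P k) + s k" by auto
      then show ?thesis
      proof cases
        case 1
        then show ?thesis using \<open>F = Sq j\<close> square_props[OF \<open>j < i\<close>]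
          by (intro disjI2 bexI[of _ SBottom]) auto
      next
        case (2 k)
        then show ?thesis using \<open>F = Sq j\<close> \<open>j < i\<close> by (intro disjI2 bexI[of _ "Sq k"]) auto
      qed
    next
      case 2
      then show ?thesis using W_pos by (intro disjI2 bexI[of _ SBottom]) auto
    next
      case 3
      have "\<forall>z\<in>closure V. yb F < snd z" using cl(3) 3 by fastforce
      then show ?thesis ..
    next
      case 4
      have "\<forall>z\<in>closure V. yb F < snd z" using cl(3) 4 by fastforce
      then show ?thesis ..
    qed
  qed
  show "open V" "connected V" "V \<noteq> {}" by (fact open_V connected_V V_nonempty)+
  show "bounded V" using bounded_U bounded_subset by blast
  show "\<not> (xl F \<le> fst z \<and> fst z \<le> xr F \<and> yb F \<le> snd z \<and> snd z \<le> yt F)" if "F \<in> boxes" "z \<in> V" for F z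
  proof -
    have F: "present i F" using that by auto
    have z: "0 < fst z" "fst z < W" "0 < snd z" "\<And>j. j < i \<Longrightarrow> z \<notin> sq (P j) (s j)"
      using that(2) U_free by (auto simp: mem_Times_iff)
    from F show ?thesis
      by (cases rule: present_cases) (use z in \<open>auto simp: mem_sq\<close>)
  qed
  show "\<exists>F\<in>boxes. xl F \<le> fst z \<and> fst z \<le> xr F \<and> yb F \<le> snd z \<and> snd z \<le> yt F" if "z \<in> closure V" "z \<notin> V" for z
  proof (cases "\<exists>j<i. z \<in> sq (P j) (s j)")
    case True
    then obtain j where "j < i" "z \<in> sq (P j) (s j)" by blast
    then show ?thesis by (intro bexI[of _ "Sq j"]) (auto simp: mem_sq)
  next
    case False
    have zc: "z \<in> closure U" using that(1) by (simp add: closure_V)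
    obtain e where e: "e > 0" "nbhd z e \<inter> strip W \<subseteq> U" using nbhd_piece[OF zc] False by blast
    have "z \<in> nbhd z e \<inter> strip W" using e(1) closure_strip[OF zc] by (simp add: mem_Times_iff)
    then have "z \<in> U" using e(2) by blast
    then have "z \<notin> open_strip" using that(2) by blast
    then have "fst z = 0 \<or> fst z = W \<or> snd z = 0" using closure_strip[OF zc] by (auto simp: mem_strip mem_Times_iff)
    then show ?thesis
    proof (elim disjE)
      assume "fst z = 0"
      then show ?thesis using closure_strip[OF zc] H(3)[OF zc] by (intro bexI[of _ SLeft]) (auto simp: mem_strip)
    next
      assume "fst z = W"
      then show ?thesis using closure_strip[OF zc] H(3)[OF zc] by (intro bexI[of _ SRight]) (auto simp: mem_strip)
    next
      assume "snd z = 0"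
      then show ?thesis using closure_strip[OF zc] H(3)[OF zc] by (intro bexI[of _ SBottom]) (auto simp: mem_strip)
    qed
  qed
qed

interpretation hole boxes xl xr yb yt V by (rule hole_V)

lemma box_of_fset:
  assumes "present i F" "z \<in> closure U"
  shows "z \<in> box_of F \<longleftrightarrow> z \<in> fset W s P F"
proof -
  have z: "0 \<le> fst z" "fst z \<le> W" "0 \<le> snd z" "snd z < H"
    using closure_strip[OF assms(2)] H(3)[OF assms(2)] by (auto simp: mem_strip)
  show ?thesis
    using assms(1)
  proof (cases rule: present_cases)
    case (1 j) show ?thesis unfolding 1(1) by (simp add: mem_box_of mem_sq)
  next
    case 2 show ?thesis unfolding 2 using z by (auto simp: mem_box_of mem_Times_iff)
  next
    case 3 show ?thesis unfolding 3 using z by (auto simp: mem_box_of mem_Times_iff)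
  next
    case 4 show ?thesis unfolding 4 using z by (auto simp: mem_box_of mem_Times_iff)
  qed
qed

lemma top_circuit_V: "\<exists>g a. top_circuit boxes xl xr yb yt V C g a tp st"
proof -
  have C: "distinct C" "set C = adj_squares W s P i U"
    using circuit unfolding boundary_circuit_def by blast+
  obtain g a where ga: "path g \<and> pathfinish g = pathstart g \<and> path_image g = frontier U \<and>
        (\<forall>z \<in> U - path_image g. winding_number (to_cplx \<circ> g) (to_cplx z) = -1) \<and>
        a 0 = 0 \<and> a (length C) = 1 \<and>
        (\<forall>k < length C. a k \<le> a (Suc k) \<and> g ` {a k .. a (Suc k)} \<subseteq> fset W s P (C ! k))"
    using circuit unfolding boundary_circuit_def by (elim conjE exE) (rule that, (rule conjI | assumption)+)
  then have g: "path g" "pathfinish g = pathstart g" "path_image g = frontier U"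
      "\<And>z. z \<in> U - path_image g \<Longrightarrow> winding_number (to_cplx \<circ> g) (to_cplx z) = -1"
    and a: "a 0 = 0" "a (length C) = 1"
      "\<And>k. k < length C \<Longrightarrow> a k \<le> a (Suc k) \<and> g ` {a k..a (Suc k)} \<subseteq> fset W s P (C ! k)"
    by simp_all
  have frontier: "frontier U = closure V - V" by (simp add: frontier_def interior_U closure_V)
  have C_iff: "F \<in> set C \<longleftrightarrow> F \<in> boxes \<and> closure V \<inter> box_of F \<noteq> {}" for F
    unfolding C(2) adj_squares_def closure_V using box_of_fset[of F] by blast
  have CI: "present i F" if "F \<in> set C" for F using that C_iff by blast
  have a_mono: "a j \<le> a k" if "j \<le> k" "k \<le> length C" for j k
    using that
  proof (induction k rule: dec_induct)
    case (step m)
    then show ?case using a(3)[of m] by auto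
  qed simp
  have "hole_circuit boxes xl xr yb yt V C g a"
  proof
    show "distinct C" "path g" "pathfinish g = pathstart g" "a 0 = 0" "a (length C) = 1" by fact+
    show "set C = {F \<in> boxes. closure V \<inter> box_of F \<noteq> {}}" using C_iff by blast
    show "path_image g = closure V - V" using g(3) frontier by simp
    show "winding_number (to_cplx \<circ> g) (to_cplx z) = -1" if "z \<in> V" for z
      using g(4)[of z] that unfolding g(3) frontier by blast
    fix k assume k: "k < length C"
    show "a k \<le> a (Suc k)" using a(3)[OF k] by blast
    show "g ` {a k..a (Suc k)} \<subseteq> box_of (C ! k)"
    proof
      fix z assume z: "z \<in> g ` {a k..a (Suc k)}"
      have "{a k..a (Suc k)} \<subseteq> {0..1}"
        using a_mono[of 0 k] a_mono[of "Suc k" "length C"] k a(1,2) by auto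
      then have "z \<in> frontier U" using z unfolding g(3)[symmetric] path_image_def by blast
      then have "z \<in> closure U" by (simp add: frontier_def)
      moreover have "z \<in> fset W s P (C ! k)" using a(3)[OF k] z by blast
      ultimately show "z \<in> box_of (C ! k)" using box_of_fset CI[OF nth_mem[OF k]] by blast
    qed
  qed
  then interpret hole_circuit boxes xl xr yb yt V C g a .
  \<comment> \<open>The hole has positive height, so its ceiling belongs to a genuine square. Hence
    the top square is genuine as well, and the altered bottom faces of walls and floor cannot
    compete with it.\<close>
  obtain q G0 where q: "q \<in> closure V" "\<And>z. z \<in> closure V \<Longrightarrow> snd z \<le> snd q" "G0 \<in> boxes" "q \<in> box_of G0" "yb G0 = snd q"
    using ceiling_exists by metis
  obtain z0 where "z0 \<in> V" using V_nonempty by blast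
  then have "0 < snd z0" "snd z0 \<le> snd q" using q(2)[of z0] closure_subset[of V] by (auto simp: mem_Times_iff)
  then have G0_pos: "0 < yb G0" using q(5) by simp
  then obtain j0 where j0: "G0 = Sq j0" "j0 < i" using q(3) by (auto elim!: present_cases)
  have G0C: "G0 \<in> set C" using C_iff q(1,3,4) by blast
  have topC: "C ! tp \<in> set C" using tp_less by simp
  have bf_pos: "0 < bf (fset W s P (C ! tp))"
  proof -
    have "ereal 0 < bf (fset W s P G0)" using G0_pos unfolding j0(1) faces_square[OF j0(2)] by simp
    also have "\<dots> \<le> bf (fset W s P (C ! tp))" using top G0C unfolding is_top_def by blast
    finally show ?thesis by (simp add: zero_ereal_def)
  qed
  obtain jt where jt: "C ! tp = Sq jt" "jt < i"
    using CI[OF topC] bf_pos faces_formal(3,7,11) by (cases rule: present_cases) auto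
  have b_top: "0 < yb (C ! tp)" using bf_pos unfolding jt(1) faces_square[OF jt(2)] by (simp add: zero_ereal_def)
  have "top_circuit boxes xl xr yb yt V C g a tp st"
  proof
    show "tp < length C" "st < length C" by (rule tp_less, rule st_less)
    fix G assume G: "G \<in> set C"
    have Gp: "present i G" using CI[OF G] .
    show "yb G \<le> yb (C ! tp)"
      using Gp
    proof (cases rule: present_cases)
      case (1 j)
      have "bf (fset W s P G) \<le> bf (fset W s P (C ! tp))" using top G unfolding is_top_def by blast
      then show ?thesis unfolding 1(1) jt(1) faces_square[OF 1(2)] faces_square[OF jt(2)] by simp
    qed (use b_top in auto)
    show "xr G \<le> xr (C ! tp)" if eq: "yb G = yb (C ! tp)"
      using Gp
    proof (cases rule: present_cases)
      case (1 j)
      have "bf (fset W s P G) = bf (fset W s P (C ! tp))"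
        using eq unfolding 1(1) jt(1) faces_square[OF 1(2)] faces_square[OF jt(2)] by simp
      then have "rf (fset W s P G) \<le> rf (fset W s P (C ! tp))" using top G unfolding is_top_def by (auto simp: le_less)
      then show ?thesis unfolding 1(1) jt(1) faces_square[OF 1(2)] faces_square[OF jt(2)] by simp
    qed (use b_top eq in auto)
    show "yt (C ! st) \<le> yt G"
    proof -
      have le: "tf (fset W s P (C ! st)) \<le> tf (fset W s P G)" using start G unfolding is_start_def by blast
      have sp: "present i (C ! st)" using CI st_less by simp
      note f = box_faces[OF sp H(1,2)] and f' = box_faces[OF Gp H(1,2)]
      \<comment> \<open>Infinite top faces become \<open>H\<close>, the largest value that occurs,
        so the comparison of top faces carries over.\<close>
      have ltH: "yt F \<le> H \<and> (tf (fset W s P F) = ereal (yt F) \<or> tf (fset W s P F) = \<infinity> \<and> yt F = H)" if "present i F" for F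
        using that
      proof (cases rule: present_cases)
        case (1 j)
        then show ?thesis using faces_square[OF 1(2)] H(2)[OF 1(2)] by simp
      qed (use H(1) faces_formal in \<open>simp_all add: zero_ereal_def\<close>)
      show ?thesis using ltH[OF sp] ltH[OF Gp] le by auto
    qed
  qed
  then show ?thesis by blast
qed

end

end

theorem theorem7:
  fixes W :: real and n i :: nat and s :: "nat \<Rightarrow> real" and P :: "nat \<Rightarrow> point"
    and U :: "point set" and C :: "fsq list" and st tp :: nat
  assumes "W > 0" and "\<forall>j<n. 0 < s j \<and> s j \<le> W"
    and "bl_packing W n s P"
    and "1 \<le> i" and "i \<le> n" and "U \<in> pieces W s P i"
    and "boundary_circuit W s P i U C"
    and "st < length C" and "is_start W s P (set C) (C ! st)"
    and "tp < length C" and "is_top W s P (set C) (C ! tp)"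
  shows
    "let m = length C; S = fset W s P;
         en = cnext m tp; pre = cprev m tp; pen = cnext m en
     in (\<forall>j < cdist m st pre.
            left_type (S (C ! ((st + j) mod m))) (S (C ! ((st + j + 1) mod m))) \<or>
            up_type (S (C ! ((st + j) mod m))) (S (C ! ((st + j + 1) mod m)))) \<and>
        (right_type (S (C ! pre)) (S (C ! tp)) \<or> up_type (S (C ! pre)) (S (C ! tp))) \<and>
        (right_type (S (C ! tp)) (S (C ! en)) \<or> down_type (S (C ! tp)) (S (C ! en))) \<and>
        (\<forall>j < cdist m pen st.
            right_type (S (C ! ((st + m - j) mod m))) (S (C ! ((st + m - j - 1) mod m))) \<or>
            down_type (S (C ! ((st + m - j) mod m))) (S (C ! ((st + m - j - 1) mod m)))) \<and>
        (right_type (S (C ! pen)) (S (C ! en)) \<or> up_type (S (C ! pen)) (S (C ! en)))"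
proof -
  have "piece_circuit W n i s P U C st tp"
    by unfold_locales (use assms in auto)
  then interpret piece_circuit W n i s P U C st tp .
  obtain H where H: "0 < H" "\<And>j. j < i \<Longrightarrow> snd (P j) + s j < H" "\<And>z. z \<in> closure U \<Longrightarrow> snd z < H"
    using height_bound by metis
  obtain g a where "top_circuit {F. present i F} (xmin P W) (xmax P s W) (ymin P) (ymax P s H) V C g a tp st"
    using top_circuit_V[OF H] by blast
  then interpret top_circuit "{F. present i F}" "xmin P W" "xmax P s W" "ymin P" "ymax P s H" V C g a tp st .
  let ?S = "\<lambda>x. fset W s P (C ! x)"
  have present: "present i (C ! k)" if "k < length C" for k using C_mem[OF that] by simp
  have types: "xmin P W (C ! x) = xmax P s W (C ! y) \<Longrightarrow> left_type (?S x) (?S y)"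
    "xmax P s W (C ! x) = xmin P W (C ! y) \<Longrightarrow> right_type (?S x) (?S y)"
    "ymax P s H (C ! x) = ymin P (C ! y) \<Longrightarrow> up_type (?S x) (?S y)"
    "ymin P (C ! x) = ymax P s H (C ! y) \<Longrightarrow> down_type (?S x) (?S y)" if "x < length C" "y < length C" for x y
    using box_types[OF present[OF that(1)] present[OF that(2)] H(1)] H(2) by blast+
  have m: "k mod length C < length C" for k using tp_less by (intro mod_less_divisor) linarith
  have idx: "cnext (length C) k < length C" "cprev (length C) k < length C" for k
    using m by (simp_all add: cnext_def cprev_def)
  show ?thesis
    unfolding Let_def
  proof (intro conjI allI impI)
    fix j assume "j < cdist (length C) st (cprev (length C) tp)"
    then show "left_type (?S ((st + j) mod length C)) (?S ((st + j + 1) mod length C)) \<or>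
        up_type (?S ((st + j) mod length C)) (?S ((st + j + 1) mod length C))"
      using circuit_structure(1) types(1,3)[OF m m] by blast
  next
    fix j assume "j < cdist (length C) (cnext (length C) (cnext (length C) tp)) st"
    then show "right_type (?S ((st + length C - j) mod length C)) (?S ((st + length C - j - 1) mod length C)) \<or>
        down_type (?S ((st + length C - j) mod length C)) (?S ((st + length C - j - 1) mod length C))"
      using circuit_structure(4) types(2,4)[OF m m] by blast
  qed (use circuit_structure(2,3,5) types(2-4)[OF idx(2) tp_less] types(2-4)[OF tp_less idx(1)]
      types(2-4)[OF idx(1) idx(1)] in blast)+
qed

end
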